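(* Let $S\in\mathcal{CPMM}$ have a Markov partition $\mathcal Q$ such that the supremum $$S(j',\mathcal Q):=\sup_{i\in\mathcal Q}\frac{n(j',i)}{n(i,j')}$$ is finite for some $j'\in\mathcal Q$. Let $\mathcal P$ be a Markov partition for $S$ and $j\in\mathcal P$ such that $S|_j$ is monotone. Then for every sufficiently large $k\in\mathbb N$, any window perturbation $T\in\mathcal{CPMM}$ of $S$ on $j$ of order $k$ is linearizable.
   Context: A continuous map on a closed interval is piecewise monotone if the interval splits into finitely many subintervals on each of which the map is monotone. A Markov partition for a continuous map $T:[0,1]\to[0,1]$ is a finite or countably infinite collection $\mathcal P$ of closed nondegenerate subintervals of $[0,1]$ such that: (1) distinct elements of $\mathcal P$ have disjoint interiors and $[0,1]\setminus\bigcup\mathcal P$ is at most countable; (2) $T|_i$ is monotone for each $i\in\mathcal P$ (classical), or piecewise monotone for each $i\in\mathcal P$ (slack); (3) for all $i,j\in\mathcal P$ and every maximal interval $i'\subset i$ of monotonicity of $T$, if $T(i')\cap j^\circ\ne\emptyset$ then $T(i')\supset j$. $\mathcal{CPMM}$ is the set of continuous maps $T:[0,1]\to[0,1]$ that are topologically mixing (for all nonempty open $U,V$ there is $n$ with $T^m(U)\cap V\neq\emptyset$ for all $m\ge n$), admit a countably infinite Markov partition, and have finite topological entropy $h_{top}(T)<\infty$. Transition matrix of $T$ with respect to $\mathcal P$: $M=(m_{ij})_{i,j\in\mathcal P}$, where $m_{ij}=0$ if $T(i)\not\supset j$, and otherwise $m_{ij}$ is the maximal number of intervals $i_1,\dots,i_\kappa\subset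 i$ with pairwise disjoint interiors such that each $T|_{i_\ell}$ is monotone and $T(i_\ell)\supset j$ (this number is finite). Write $M^n=(m_{ij}(n))$. For $i,j$ in the partition, $n(i,j)=\min\{n\in\mathbb N:\ m_{ij}(n)\ne0\}$, where $\mathbb N=\{1,2,\dots\}$; in the claim these numbers are computed with the transition matrix of $S$ with respect to $\mathcal Q$. Window perturbation: for $S\in\mathcal{CPMM}$ with Markov partition $\mathcal P$ and $j\in\mathcal P$ such that $S|_j$ is monotone, $T\in\mathcal{CPMM}$ is a window perturbation of $S$ on $j$ of order $k\in\mathbb N$ if $T=S$ on $[0,1]\setminus j^\circ$ and there is a nontrivial partition $(j_i)_{i=1}^{2k+1}$ of $j$ (into nondegenerate subintervals) such that $T(j_i)=S(j)$ and $T|_{j_i}$ is monotone for each $i$. A continuous interval map $S$ has constant slope $s$ if $|S'(x)|=s$ for all but countably many $x$. $T$ is linearizable if it is topologically conjugate to an interval map $[0,1]\to[0,1]$ of constant slope $e^{h_{top}(T)}$. *)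

theory Defs
  imports "HOL-Analysis.Analysis"
begin

text \<open>Self-maps of the unit interval are functions on all of \<open>real\<close>; only their values on
  \<open>{0..1}\<close> matter in the definitions below.\<close>

definition interval_map :: "(real \<Rightarrow> real) \<Rightarrow> bool" where
  "interval_map T \<longleftrightarrow> continuous_on {0..1} T \<and> T ` {0..1} \<subseteq> {0..1}"

text \<open>Monotone means weakly monotone, in either direction.\<close>

definition monotone_map_on :: "real set \<Rightarrow> (real \<Rightarrow> real) \<Rightarrow> bool" where
  "monotone_map_on J T \<longleftrightarrow> mono_on J T \<or> antimono_on J T"

definition piecewise_monotone_on :: "real set \<Rightarrow> (real \<Rightarrow> real) \<Rightarrow> bool" where
  "piecewise_monotone_on J T \<longleftrightarrow>
     (\<exists>\<D>. \<D> division_of J \<and> (\<forall>K\<in>\<D>. monotone_map_on K T))"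

definition maximal_monotone_interval :: "(real \<Rightarrow> real) \<Rightarrow> real set \<Rightarrow> real set \<Rightarrow> bool" where
  "maximal_monotone_interval T i K \<longleftrightarrow>
     is_interval K \<and> K \<subseteq> i \<and> monotone_map_on K T \<and>
     (\<forall>L. is_interval L \<and> K \<subseteq> L \<and> L \<subseteq> i \<and> monotone_map_on L T \<longrightarrow> L = K)"

text \<open>This is the slack notion of Markov partition. It contains the classical one, in which
  the map is monotone on every element.\<close>

definition markov_partition :: "(real \<Rightarrow> real) \<Rightarrow> real set set \<Rightarrow> bool" where
  "markov_partition T P \<longleftrightarrow>
     countable P \<and>
     (\<forall>i\<in>P. \<exists>a b. 0 \<le> a \<and> a < b \<and> b \<le> 1 \<and> i = {a..b}) \<and>
     (\<forall>i\<in>P. \<forall>j\<in>P. i \<noteq> j \<longrightarrow> interior i \<inter> interior j = {}) \<and>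
     countable ({0..1} - \<Union>P) \<and>
     (\<forall>i\<in>P. piecewise_monotone_on i T) \<and>
     (\<forall>i\<in>P. \<forall>j\<in>P. \<forall>K. maximal_monotone_interval T i K \<and> T ` K \<inter> interior j \<noteq> {}
         \<longrightarrow> j \<subseteq> T ` K)"

definition topologically_mixing :: "(real \<Rightarrow> real) \<Rightarrow> bool" where
  "topologically_mixing T \<longleftrightarrow>
     (\<forall>U V. openin (top_of_set {0..1}) U \<and> openin (top_of_set {0..1}) V \<and> U \<noteq> {} \<and> V \<noteq> {}
        \<longrightarrow> (\<exists>n. \<forall>m\<ge>n. (T ^^ m) ` U \<inter> V \<noteq> {}))"

text \<open>Topological entropy, in Bowen's form via \<open>(n, \<epsilon>)\<close>-separated sets. By compactness of the
  unit interval the cardinalities of such sets are bounded when the map is continuous. The limit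
  for \<open>\<epsilon> \<rightarrow> 0\<close> is a supremum since the growth rate decreases in \<open>\<epsilon>\<close>.\<close>

definition separated_set :: "(real \<Rightarrow> real) \<Rightarrow> nat \<Rightarrow> real \<Rightarrow> real set \<Rightarrow> bool" where
  "separated_set T n \<epsilon> E \<longleftrightarrow>
     finite E \<and> E \<subseteq> {0..1} \<and>
     (\<forall>x\<in>E. \<forall>y\<in>E. x \<noteq> y \<longrightarrow> (\<exists>m<n. dist ((T ^^ m) x) ((T ^^ m) y) > \<epsilon>))"

definition topological_entropy :: "(real \<Rightarrow> real) \<Rightarrow> ereal" where
  "topological_entropy T =
     (SUP \<epsilon>\<in>{0<..}. limsup (\<lambda>n.
        (SUP E\<in>{E. E \<noteq> {} \<and> separated_set T n \<epsilon> E}. ereal (ln (real (card E)))) / ereal (real n)))"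

definition CPMM :: "(real \<Rightarrow> real) set" where
  "CPMM = {T. interval_map T \<and> topologically_mixing T \<and>
     (\<exists>P. infinite P \<and> markov_partition T P) \<and> topological_entropy T < \<infinity>}"

text \<open>The maximum below exists for continuous \<open>T\<close> and nondegenerate \<open>j\<close>: by uniform continuity,
  the intervals mapped over \<open>j\<close> have lengths bounded away from zero. Such intervals are
  nondegenerate, so those with pairwise disjoint interiors are distinct, and a set of intervals
  carries the same information as an indexed family.\<close>

definition transition_matrix :: "(real \<Rightarrow> real) \<Rightarrow> real set \<Rightarrow> real set \<Rightarrow> nat" where
  "transition_matrix T i j =
     (if j \<subseteq> T ` i then
        Max {card \<A> | \<A>. finite \<A> \<and>
          (\<forall>K\<in>\<A>. is_interval K \<and> K \<subseteq> i \<and> monotone_map_on K T \<and> j \<subseteq> T ` K) \<and>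
          pairwise (\<lambda>K L. interior K \<inter> interior L = {}) \<A>}
      else 0)"

text \<open>Powers of the possibly infinite matrix; in \<open>ennreal\<close> all the sums converge.\<close>

primrec transition_power ::
    "(real \<Rightarrow> real) \<Rightarrow> real set set \<Rightarrow> nat \<Rightarrow> real set \<Rightarrow> real set \<Rightarrow> ennreal" where
  "transition_power T P 0 i j = (if i = j then 1 else 0)"
| "transition_power T P (Suc n) i j =
     (\<Sum>\<^sub>\<infinity>k\<in>P. of_nat (transition_matrix T i k) * transition_power T P n k j)"

text \<open>For a mixing map with Markov partition \<open>P\<close> and \<open>i, j \<in> P\<close>, the minimum is taken over a
  nonempty set.\<close>

definition transition_time ::
    "(real \<Rightarrow> real) \<Rightarrow> real set set \<Rightarrow> real set \<Rightarrow> real set \<Rightarrow> nat" where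
  "transition_time T P i j = (LEAST n. 1 \<le> n \<and> transition_power T P n i j \<noteq> 0)"

definition transition_time_ratio_sup ::
    "(real \<Rightarrow> real) \<Rightarrow> real set \<Rightarrow> real set set \<Rightarrow> ereal" where
  "transition_time_ratio_sup T j Q =
     (SUP i\<in>Q. ereal (real (transition_time T Q j i) / real (transition_time T Q i j)))"

definition window_perturbation ::
    "(real \<Rightarrow> real) \<Rightarrow> real set \<Rightarrow> nat \<Rightarrow> (real \<Rightarrow> real) \<Rightarrow> bool" where
  "window_perturbation S j k T \<longleftrightarrow>
     T \<in> CPMM \<and> 1 \<le> k \<and> (\<forall>x \<in> {0..1} - interior j. T x = S x) \<and>
     (\<exists>\<D>. \<D> division_of j \<and> card \<D> = 2 * k + 1 \<and>
        (\<forall>K\<in>\<D>. interior K \<noteq> {} \<and> T ` K = S ` j \<and> monotone_map_on K T))"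

definition constant_slope :: "(real \<Rightarrow> real) \<Rightarrow> real \<Rightarrow> bool" where
  "constant_slope g s \<longleftrightarrow>
     countable {x\<in>{0..1}. \<not> (\<exists>D. (g has_real_derivative D) (at x within {0..1}) \<and> \<bar>D\<bar> = s)}"

definition topologically_conjugate :: "(real \<Rightarrow> real) \<Rightarrow> (real \<Rightarrow> real) \<Rightarrow> bool" where
  "topologically_conjugate T g \<longleftrightarrow>
     (\<exists>\<psi> \<phi>. homeomorphism {0..1} {0..1} \<psi> \<phi> \<and> (\<forall>x\<in>{0..1}. \<psi> (T x) = g (\<psi> x)))"

definition linearizable :: "(real \<Rightarrow> real) \<Rightarrow> bool" where
  "linearizable T \<longleftrightarrow>
     (\<exists>g. interval_map g \<and> constant_slope g (exp (real_of_ereal (topological_entropy T))) \<and>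
        topologically_conjugate T g)"

end

theory Submission
  imports Defs
begin

text \<open>
  Fix \<open>y\<close> in the window \<open>j\<close> and count the points of \<open>T\<^sup>-\<^sup>n(y)\<close>. Splitting at the visits to \<open>j\<close> gives a
  renewal equation: if \<open>f n\<close> counts first returns to \<open>j\<close> and \<open>e n\<close> counts first entrances from
  anywhere, the generating functions satisfy \<open>A(z) = 1 / (1 - F(z))\<close> for the returns and
  \<open>E(z) A(z)\<close> for all preimages. The perturbation does not change \<open>e n\<close> and multiplies \<open>f n\<close> by
  \<open>2 k + 1\<close>. The hypothesis on \<open>Q\<close> makes \<open>e n\<close> grow at most exponentially: a preimage of order
  \<open>n\<close> can be completed to a loop of length \<open>O(n)\<close> at \<open>j'\<close>, and the number of loops is controlled
  by the entropy. So for large \<open>k\<close> the root \<open>R\<close> of \<open>F(R) = 1\<close> lies inside the discs of convergence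
  of \<open>F\<close> and \<open>E\<close>.

  The measures on preimages of \<open>y\<close> with weights \<open>z\<^sup>n\<close>, normalised, then have a limit point as
  \<open>z \<rightarrow> R\<close>, as in the Patterson-Sullivan construction. \<open>A(z) \<rightarrow> \<infinity>\<close> makes the limit conformal:
  \<open>T\<close> expands it by \<open>1 / R\<close> on laps. Convergence of \<open>E(R)\<close> gives tightness, which excludes
  atoms. Its distribution function conjugates \<open>T\<close> to a map of constant slope \<open>1 / R\<close>, and
  \<open>1 / R\<close> is \<open>exp\<close> of the entropy by a Lipschitz bound above and by horseshoes below.
\<close>

text \<open>The threshold for \<open>k\<close> must be fixed before \<open>T\<close> is known, but
  the base point has to be chosen after \<open>T\<close>, since it must avoid the countable set of
  forward images of lap endpoints and uncovered points of \<open>T\<close>. The growth bound for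
  \<open>S\<close> is therefore proved with constants that do not depend on the countable set to be
  avoided. From \<open>S\<close> alone come the exponential rate \<open>B\<close> and the least time
  \<open>N\<close> at which the interior of \<open>j\<close> meets itself again. One term of the
  return series is enough to locate the root: \<open>(2 * B) ^ N \<le> 2 * k + 1\<close> makes the
  term of order \<open>N\<close> at least 1 at \<open>1 / (2 * B)\<close>, half of the radius
  \<open>1 / B\<close> within which the entrance series is known to converge.

  The partitions \<open>P\<close> and \<open>Q\<close> need not be related: \<open>Q\<close> serves
  only the growth bound, which is carried from \<open>j'\<close> to the window by mixing. Preimages
  of a point are counted instead of entries of matrix powers. Each preimage of a generic point lies
  on a branch mapped onto all of \<open>j\<close>, so the counts do not depend on the point.\<close>

lemma interval_map_in: "interval_map T \<Longrightarrow> x \<in> {0..1} \<Longrightarrow> T x \<in> {0..1}"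
  unfolding interval_map_def by blast

lemma interval_map_funpow_in:
  assumes "interval_map T" "x \<in> {0..1}"
  shows "(T ^^ n) x \<in> {0..1}"
  using assms(2) by (induction n) (simp_all add: interval_map_in[OF assms(1), simplified])

lemma continuous_on_interval_map_funpow:
  assumes "interval_map T"
  shows "continuous_on {0..1} (T ^^ n)"
proof (induction n)
  case 0
  show ?case by (simp add: id_def)
next
  case (Suc n)
  have "continuous_on ((T ^^ n) ` {0..1}) T"
    using assms interval_map_funpow_in[OF assms] unfolding interval_map_def
    by (meson continuous_on_subset image_subsetI)
  then show ?case
    using continuous_on_compose[OF Suc] by simp
qed

text \<open>If \<open>T ^^ n\<close> collapsed the interval to a point, every later iterate would
  too, and a single point cannot meet both \<open>{0..<1/2}\<close> and \<open>{1/2<..1}\<close>, as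
  mixing demands at all large times.\<close>

lemma topologically_mixing_nonconstant:
  assumes "interval_map T" "topologically_mixing T" "0 \<le> a" "a < b" "b \<le> 1"
  shows "\<exists>x\<in>{a<..<b}. \<exists>x'\<in>{a<..<b}. (T ^^ n) x \<noteq> (T ^^ n) x'"
proof (rule ccontr)
  assume "\<not> ?thesis"
  then have eq: "(T ^^ n) x = (T ^^ n) x'" if "x \<in> {a<..<b}" "x' \<in> {a<..<b}" for x x'
    using that by blast
  let ?U = "{a<..<b}" and ?V = "{0..<1/2::real}" and ?W = "{1/2<..1::real}"
  have U: "openin (top_of_set {0..1}) ?U"
    unfolding openin_open by (rule exI[of _ "{a<..<b}"]) (use assms in auto)
  have V: "openin (top_of_set {0..1}) ?V"
    unfolding openin_open by (rule exI[of _ "{..<1/2}"]) auto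
  have W: "openin (top_of_set {0..1}) ?W"
    unfolding openin_open by (rule exI[of _ "{1/2<..}"]) auto
  have ne: "?U \<noteq> {}" "?V \<noteq> {}" "?W \<noteq> {}" using \<open>a < b\<close> by auto
  obtain n1 where n1: "\<And>m. m \<ge> n1 \<Longrightarrow> (T ^^ m) ` ?U \<inter> ?V \<noteq> {}"
    using assms(2)[unfolded topologically_mixing_def, rule_format, OF conjI, OF U conjI, OF V conjI, OF ne(1,2)]
    by blast
  obtain n2 where n2: "\<And>m. m \<ge> n2 \<Longrightarrow> (T ^^ m) ` ?U \<inter> ?W \<noteq> {}"
    using assms(2)[unfolded topologically_mixing_def, rule_format, OF conjI, OF U conjI, OF W conjI, OF ne(1,3)]
    by blast
  define m where "m = n1 + n2"
  have eqm: "(T ^^ (m + n)) x = (T ^^ (m + n)) x'" if "x \<in> ?U" "x' \<in> ?U" for x x'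
    using eq[OF that] by (simp add: funpow_add)
  have "(T ^^ (m + n)) ` ?U \<inter> ?V \<noteq> {}" "(T ^^ (m + n)) ` ?U \<inter> ?W \<noteq> {}"
    by (rule n1, simp add: m_def, rule n2, simp add: m_def)
  note h = this
  obtain p where p: "p \<in> (T ^^ (m + n)) ` ?U \<inter> ?V" using h(1)[folded ex_in_conv] by (rule exE)
  obtain q where q: "q \<in> (T ^^ (m + n)) ` ?U \<inter> ?W" using h(2)[folded ex_in_conv] by (rule exE)
  note pq = IntD1[OF p] IntD2[OF p] IntD1[OF q] IntD2[OF q]
  obtain x where x: "x \<in> ?U" "p = (T ^^ (m + n)) x" using pq(1) by (rule imageE)
  obtain x' where x': "x' \<in> ?U" "q = (T ^^ (m + n)) x'" using pq(3) by (rule imageE)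
  have "p = q" using eqm[OF x(1) x'(1)] x(2) x'(2) by simp
  then show False using pq(2,4) by simp
qed

text \<open>Equal values at two points force a weakly monotone map to be constant between them,
  which mixing forbids. This turns the weak monotonicity of the definitions into the injectivity
  used from here on.\<close>

lemma monotone_map_on_inj:
  assumes T: "interval_map T" "topologically_mixing T"
    and K: "is_interval K" "K \<subseteq> {0..1}" "monotone_map_on K T"
  shows "inj_on T K"
proof -
  have False if "x \<in> K" "y \<in> K" "x < y" "T x = T y" for x y
  proof -
    have sub: "{x..y} \<subseteq> K"
      using mem_is_interval_1_I[OF K(1) that(1,2)] by auto
    have "T u = T x" if "u \<in> {x<..<y}" for u
    proof -
      have "u \<in> K" "x \<le> u" "u \<le> y" using sub that by auto
      then have "(T x \<le> T u \<and> T u \<le> T y) \<or> (T y \<le> T u \<and> T u \<le> T x)"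
        using K(3) \<open>x \<in> K\<close> \<open>y \<in> K\<close> unfolding monotone_map_on_def monotone_on_def by blast
      then show ?thesis using \<open>T x = T y\<close> by auto
    qed
    moreover have "0 \<le> x" "y \<le> 1" using K(2) that by auto
    then obtain u v where "u \<in> {x<..<y}" "v \<in> {x<..<y}" "T u \<noteq> T v"
      using topologically_mixing_nonconstant[OF T, of x y 1] \<open>x < y\<close> by auto
    ultimately show False by simp
  qed
  then show ?thesis unfolding inj_on_def by (metis linorder_less_linear)
qed

section \<open>Topological entropy\<close>

lemma topological_entropy_nonneg: "0 \<le> topological_entropy T"
proof -
  let ?S = "\<lambda>n. (SUP E\<in>{E. E \<noteq> {} \<and> separated_set T n 1 E}. ereal (ln (real (card E))))"
  have "0 \<le> ?S n" for n
    by (rule SUP_upper2[of "{0}"]) (auto simp: separated_set_def)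
  then have "0 \<le> ?S n / ereal (real n)" for n
    unfolding divide_ereal_def by (intro ereal_0_le_mult inverse_ereal_ge0I) auto
  then have "0 \<le> limsup (\<lambda>n. ?S n / ereal (real n))"
    by (metis (no_types, lifting) always_eventually le_Limsup trivial_limit_sequentially)
  also have "\<dots> \<le> topological_entropy T"
    unfolding topological_entropy_def by (rule SUP_upper) simp
  finally show ?thesis .
qed

lemma finite_disjoint_compact_gap:
  fixes C :: "'i \<Rightarrow> 'a::heine_borel set"
  assumes "finite X" "\<And>x. x \<in> X \<Longrightarrow> compact (C x)"
    and "\<And>x x'. x \<in> X \<Longrightarrow> x' \<in> X \<Longrightarrow> x \<noteq> x' \<Longrightarrow> C x \<inter> C x' = {}"
  shows "\<exists>\<epsilon>>0. \<forall>x\<in>X. \<forall>x'\<in>X. x \<noteq> x' \<longrightarrow> (\<forall>u\<in>C x. \<forall>v\<in>C x'. dist u v > \<epsilon>)"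
proof -
  have "\<exists>d>0. x \<noteq> x' \<longrightarrow> (\<forall>u\<in>C x. \<forall>v\<in>C x'. d \<le> dist u v)" if "x \<in> X" "x' \<in> X" for x x'
    using separate_compact_closed[of "C x" "C x'"] assms that
    by (cases "x = x'") (auto simp: compact_imp_closed intro: exI[of _ 1])
  then obtain d where d: "\<And>x x'. x \<in> X \<Longrightarrow> x' \<in> X \<Longrightarrow> d x x' > 0"
    "\<And>x x' u v. x \<in> X \<Longrightarrow> x' \<in> X \<Longrightarrow> x \<noteq> x' \<Longrightarrow> u \<in> C x \<Longrightarrow> v \<in> C x' \<Longrightarrow> d x x' \<le> dist u v"
    by metis
  define m where "m = Min (insert 1 ((\<lambda>(x,x'). d x x') ` (X \<times> X)))"
  have fin: "finite (insert 1 ((\<lambda>(x,x'). d x x') ` (X \<times> X)))" using assms(1) by simp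
  have "m > 0" unfolding m_def using fin d(1) by (subst Min_gr_iff) auto
  moreover have "m \<le> d x x'" if "x \<in> X" "x' \<in> X" for x x'
    unfolding m_def using fin that by (intro Min_le) auto
  ultimately show ?thesis
    using d(2) by (intro exI[of _ "m/2"]) (smt (verit, best) field_sum_of_halves)
qed

lemma ereal_le_divide_mult:
  fixes c n q :: real
  assumes "ereal (q * c) \<le> s" "n > 0" "q > 0"
  shows "ereal (c / n) \<le> s / ereal (n * q)"
proof (cases s)
  case (real r)
  then have "c / n \<le> r / (n * q)" using assms by (simp add: field_simps)
  then show ?thesis using real assms by simp
qed (use assms in auto)

text \<open>Every word over \<open>X\<close> is realised as the itinerary of a point under
  \<open>T ^^ n\<close>. The pieces are compact and disjoint, hence a positive distance apart, so
  different words give separated points and there are \<open>card X ^ p\<close> of them for words of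
  length \<open>p\<close>.\<close>

lemma horseshoe_entropy:
  assumes T: "interval_map T" and n: "n \<ge> 1" and X: "finite X" "X \<noteq> {}"
    and C: "\<And>x. x \<in> X \<Longrightarrow> compact (C x)" "\<And>x. x \<in> X \<Longrightarrow> C x \<subseteq> J"
      "\<And>x. x \<in> X \<Longrightarrow> J \<subseteq> (T ^^ n) ` C x"
    and disj: "\<And>x x'. x \<in> X \<Longrightarrow> x' \<in> X \<Longrightarrow> x \<noteq> x' \<Longrightarrow> C x \<inter> C x' = {}"
    and J: "J \<subseteq> {0..1}" "J \<noteq> {}"
  shows "ereal (ln (card X) / n) \<le> topological_entropy T"
proof -
  obtain \<epsilon> where \<epsilon>: "\<epsilon> > 0"
    "\<And>x x' u v. x \<in> X \<Longrightarrow> x' \<in> X \<Longrightarrow> x \<noteq> x' \<Longrightarrow> u \<in> C x \<Longrightarrow> v \<in> C x' \<Longrightarrow> dist u v > \<epsilon>"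
    using finite_disjoint_compact_gap[of X C] X(1) C(1) disj by metis
  \<comment> \<open>The point is built from the end of the word backwards: a point following
    \<open>ws\<close> lies in \<open>J\<close>, so it has a preimage under \<open>T ^^ n\<close> in
    the piece of the new first letter.\<close>
  have "\<exists>z\<in>J. \<forall>i<length ws. (T ^^ (n * i)) z \<in> C (ws ! i)" if "set ws \<subseteq> X" for ws
    using that
  proof (induction ws)
    case Nil
    then show ?case using J by auto
  next
    case (Cons x ws)
    then obtain z where z: "z \<in> J" "\<And>i. i < length ws \<Longrightarrow> (T ^^ (n * i)) z \<in> C (ws ! i)"
      by auto
    obtain u where u: "u \<in> C x" "(T ^^ n) u = z" using C(3)[of x] z(1) Cons.prems by auto
    have "(T ^^ (n * i)) u \<in> C ((x # ws) ! i)" if "i < length (x # ws)" for i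
    proof (cases i)
      case 0
      then show ?thesis using u by simp
    next
      case (Suc i')
      have "(T ^^ (n * i)) u = (T ^^ (n * i')) z"
        using u(2) by (simp add: Suc add.commute[of n] funpow_add)
      then show ?thesis using z(2)[of i'] that Suc by simp
    qed
    moreover have "u \<in> J" using u C(2)[of x] Cons.prems by auto
    ultimately show ?case by blast
  qed
  then obtain pt where pt: "\<And>ws. set ws \<subseteq> X \<Longrightarrow> pt ws \<in> J"
    "\<And>ws i. set ws \<subseteq> X \<Longrightarrow> i < length ws \<Longrightarrow> (T ^^ (n * i)) (pt ws) \<in> C (ws ! i)"
    by metis
  define sep where "sep N = (SUP E\<in>{E. E \<noteq> {} \<and> separated_set T N \<epsilon> E}. ereal (ln (real (card E))))" for N
  have key: "ereal (ln (card X) / n) \<le> sep (n * Suc p) / ereal (real (n * Suc p))" for p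
  proof -
    let ?W = "{ws. set ws \<subseteq> X \<and> length ws = Suc p}"
    have sepW: "\<exists>m<n * Suc p. dist ((T ^^ m) (pt ws)) ((T ^^ m) (pt ws')) > \<epsilon>"
      if "ws \<in> ?W" "ws' \<in> ?W" "ws \<noteq> ws'" for ws ws'
    proof -
      have "\<exists>i<Suc p. ws ! i \<noteq> ws' ! i"
        using that nth_equalityI[of ws ws'] by auto
      then obtain i where i: "i < Suc p" "ws ! i \<noteq> ws' ! i" by auto
      have "dist ((T ^^ (n * i)) (pt ws)) ((T ^^ (n * i)) (pt ws')) > \<epsilon>"
        using that i by (intro \<epsilon>(2)[of "ws ! i" "ws' ! i"] pt(2)) (auto simp: subset_iff)
      moreover have "n * i < n * Suc p" using i n by (simp del: mult_Suc_right)
      ultimately show ?thesis by blast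
    qed
    have inj: "inj_on pt ?W"
    proof (rule inj_onI, rule ccontr)
      fix ws ws' assume "ws \<in> ?W" "ws' \<in> ?W" "pt ws = pt ws'" "ws \<noteq> ws'"
      then show False using sepW[of ws ws'] \<epsilon>(1) by simp
    qed
    have "card (pt ` ?W) = card X ^ Suc p"
      using card_image[OF inj] card_lists_length_eq[OF X(1)] by simp
    moreover have "finite ?W" using X(1) by (rule finite_lists_length_eq)
    moreover have "separated_set T (n * Suc p) \<epsilon> (pt ` ?W)"
      unfolding separated_set_def using sepW \<open>finite ?W\<close> pt(1) J(1) by blast
    moreover have "?W \<noteq> {}"
      using card_lists_length_eq[OF X(1), of "Suc p"] X by (metis card.empty card_0_eq power_not_zero)
    ultimately have "ereal (ln (real (card X ^ Suc p))) \<le> sep (n * Suc p)"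
      unfolding sep_def by (intro SUP_upper2[of "pt ` ?W"]) auto
    moreover have "ln (real (card X ^ Suc p)) = real (Suc p) * ln (card X)"
      using X by (simp add: ln_realpow card_gt_0_iff del: power_Suc)
    ultimately have le: "ereal (real (Suc p) * ln (card X)) \<le> sep (n * Suc p)" by (simp only:)
    show ?thesis
      using ereal_le_divide_mult[OF le, of "real n"] n by (simp del: mult_Suc_right of_nat_Suc)
  qed
  have "ereal (ln (card X) / n) \<le> limsup ((\<lambda>N. sep N / ereal (real N)) \<circ> (\<lambda>p. n * Suc p))"
    using key by (intro le_Limsup) (auto simp del: mult_Suc_right)
  also have "\<dots> \<le> limsup (\<lambda>N. sep N / ereal (real N))"
    using n by (intro limsup_subseq_mono) (auto simp: strict_mono_def)
  also have "\<dots> \<le> topological_entropy T"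
    unfolding topological_entropy_def sep_def using \<epsilon>(1) by (intro SUP_upper) simp
  finally show ?thesis .
qed

text \<open>The cells \<open>[m * d, (m + 1) * d)\<close> contain at most one point of
  \<open>E\<close> each.\<close>

lemma card_separated_le:
  fixes E :: "real set"
  assumes "finite E" "E \<subseteq> {0..1}" "d > 0"
    and "\<And>x y. x \<in> E \<Longrightarrow> y \<in> E \<Longrightarrow> x \<noteq> y \<Longrightarrow> d \<le> \<bar>x - y\<bar>"
  shows "real (card E) \<le> 1 / d + 1"
proof -
  have "inj_on (\<lambda>x. nat \<lfloor>x / d\<rfloor>) E"
  proof (rule inj_onI)
    fix x y assume xy: "x \<in> E" "y \<in> E" "nat \<lfloor>x / d\<rfloor> = nat \<lfloor>y / d\<rfloor>"
    have "0 \<le> x" "0 \<le> y" using xy assms(2) by auto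
    then have "\<lfloor>x / d\<rfloor> = \<lfloor>y / d\<rfloor>" using xy(3) \<open>d > 0\<close>
      by (metis divide_nonneg_pos eq_nat_nat_iff zero_le_floor)
    then have "\<bar>x / d - y / d\<bar> < 1" by linarith
    then have "\<bar>x - y\<bar> < d" using \<open>d > 0\<close>
      by (simp add: diff_divide_distrib[symmetric] abs_divide)
    then show "x = y" using assms(4)[OF xy(1,2)] by fastforce
  qed
  moreover have "(\<lambda>x. nat \<lfloor>x / d\<rfloor>) ` E \<subseteq> {..nat \<lfloor>1 / d\<rfloor>}"
  proof -
    have "\<lfloor>x / d\<rfloor> \<le> \<lfloor>1 / d\<rfloor>" if "x \<in> E" for x
      using that assms(2,3) by (intro floor_mono divide_right_mono) auto
    then show ?thesis by (auto intro: nat_mono)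
  qed
  ultimately have "card E \<le> card {..nat \<lfloor>1 / d\<rfloor>}"
    by (metis card_image card_mono finite_atMost)
  then have "real (card E) \<le> real (nat \<lfloor>1 / d\<rfloor>) + 1" by simp
  also have "\<dots> \<le> 1 / d + 1" using \<open>d > 0\<close> by simp
  finally show ?thesis .
qed

text \<open>In the coordinate \<open>\<psi>\<close> the map stretches by at most \<open>s\<close>,
  so points that get separated within \<open>n\<close> steps start at \<open>\<psi>\<close>-distance
  at least \<open>\<delta> / s ^ n\<close>. Uniform continuity of the inverse of
  \<open>\<psi>\<close> supplies \<open>\<delta>\<close> from \<open>\<epsilon>\<close>.\<close>

lemma entropy_le_of_Lipschitz:
  assumes T: "interval_map T" and \<psi>: "continuous_on {0..1} \<psi>" "inj_on \<psi> {0..1}" "\<psi> ` {0..1} \<subseteq> {0..1}"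
    and lip: "\<And>x y. x \<in> {0..1} \<Longrightarrow> y \<in> {0..1} \<Longrightarrow> \<bar>\<psi> (T x) - \<psi> (T y)\<bar> \<le> s * \<bar>\<psi> x - \<psi> y\<bar>"
    and s: "s \<ge> (1::real)"
  shows "topological_entropy T \<le> ereal (ln s)"
  unfolding topological_entropy_def
proof (rule SUP_least)
  fix \<epsilon> :: real assume "\<epsilon> \<in> {0<..}"
  then have \<epsilon>: "\<epsilon> > 0" by simp
  define sep where "sep n = (SUP E\<in>{E. E \<noteq> {} \<and> separated_set T n \<epsilon> E}. ereal (ln (real (card E))))" for n
  define \<phi> where "\<phi> = inv_into {0..1} \<psi>"
  have "continuous_on (\<psi> ` {0..1}) \<phi>"
    unfolding \<phi>_def using \<psi> by (intro continuous_on_inv) auto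
  then have "uniformly_continuous_on (\<psi> ` {0..1}) \<phi>"
    using \<psi>(1) by (intro compact_uniformly_continuous compact_continuous_image) auto
  then obtain \<delta> where \<delta>: "\<delta> > 0"
    "\<And>u v. u \<in> \<psi> ` {0..1} \<Longrightarrow> v \<in> \<psi> ` {0..1} \<Longrightarrow> dist v u < \<delta> \<Longrightarrow> dist (\<phi> v) (\<phi> u) < \<epsilon>"
    unfolding uniformly_continuous_on_def using \<epsilon> by metis
  have far: "\<delta> \<le> \<bar>\<psi> u - \<psi> v\<bar>" if "u \<in> {0..1}" "v \<in> {0..1}" "dist u v > \<epsilon>" for u v
  proof (rule ccontr)
    assume "\<not> ?thesis"
    then have "dist (\<phi> (\<psi> u)) (\<phi> (\<psi> v)) < \<epsilon>"
      using that by (intro \<delta>(2)) (auto simp: dist_real_def)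
    then show False using that \<psi>(2) by (simp add: \<phi>_def)
  qed
  have lipn: "\<bar>\<psi> ((T ^^ m) x) - \<psi> ((T ^^ m) y)\<bar> \<le> s ^ m * \<bar>\<psi> x - \<psi> y\<bar>"
    if "x \<in> {0..1}" "y \<in> {0..1}" for x y m
  proof (induction m)
    case (Suc m)
    have "\<bar>\<psi> ((T ^^ Suc m) x) - \<psi> ((T ^^ Suc m) y)\<bar>
        \<le> s * \<bar>\<psi> ((T ^^ m) x) - \<psi> ((T ^^ m) y)\<bar>"
      using lip[OF interval_map_funpow_in[OF T that(1)] interval_map_funpow_in[OF T that(2)]] by simp
    also have "\<dots> \<le> s * (s ^ m * \<bar>\<psi> x - \<psi> y\<bar>)"
      using Suc s by (intro mult_left_mono) auto
    finally show ?case by (simp add: mult.assoc)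
  qed simp
  define c where "c = ln (1 / \<delta> + 1)"
  have bound: "sep n \<le> ereal (real n * ln s + c)" for n
    unfolding sep_def
  proof (rule SUP_least)
    fix E assume "E \<in> {E. E \<noteq> {} \<and> separated_set T n \<epsilon> E}"
    then have E: "E \<noteq> {}" "finite E" "E \<subseteq> {0..1}"
      "\<And>x y. x \<in> E \<Longrightarrow> y \<in> E \<Longrightarrow> x \<noteq> y \<Longrightarrow> \<exists>m<n. dist ((T ^^ m) x) ((T ^^ m) y) > \<epsilon>"
      unfolding separated_set_def by auto
    have gap: "\<delta> / s ^ n \<le> \<bar>\<psi> x - \<psi> y\<bar>" if "x \<in> E" "y \<in> E" "x \<noteq> y" for x y
    proof -
      obtain m where m: "m < n" "dist ((T ^^ m) x) ((T ^^ m) y) > \<epsilon>"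
        using E(4)[OF \<open>x \<in> E\<close> \<open>y \<in> E\<close> \<open>x \<noteq> y\<close>] by auto
      have x01: "x \<in> {0..1}" "y \<in> {0..1}" using that E(3) by auto
      have "\<delta> \<le> \<bar>\<psi> ((T ^^ m) x) - \<psi> ((T ^^ m) y)\<bar>"
        using m(2) interval_map_funpow_in[OF T] x01 by (intro far) auto
      also have "\<dots> \<le> s ^ m * \<bar>\<psi> x - \<psi> y\<bar>" by (rule lipn[OF x01])
      also have "\<dots> \<le> s ^ n * \<bar>\<psi> x - \<psi> y\<bar>"
        using m(1) s by (intro mult_right_mono power_increasing) auto
      finally have "\<delta> \<le> \<bar>\<psi> x - \<psi> y\<bar> * s ^ n" by (simp add: mult.commute)
      then show ?thesis using s by (subst pos_divide_le_eq) auto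
    qed
    have "real (card (\<psi> ` E)) \<le> 1 / (\<delta> / s ^ n) + 1"
    proof (rule card_separated_le)
      show "finite (\<psi> ` E)" "\<psi> ` E \<subseteq> {0..1}" using E(2,3) \<psi>(3) by blast+
      show "\<delta> / s ^ n > 0" using \<delta>(1) s by simp
      fix u v assume uv: "u \<in> \<psi> ` E" "v \<in> \<psi> ` E" "u \<noteq> v"
      obtain x y where xy: "x \<in> E" "u = \<psi> x" "y \<in> E" "v = \<psi> y" using uv by blast
      then have "x \<noteq> y" using uv(3) by blast
      then show "\<delta> / s ^ n \<le> \<bar>u - v\<bar>" using gap[OF xy(1,3)] xy by simp
    qed
    moreover have "card (\<psi> ` E) = card E"
      using \<psi>(2) E(3) by (meson card_image inj_on_subset)
    moreover have "1 / (\<delta> / s ^ n) + 1 \<le> s ^ n * (1 / \<delta> + 1)"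
      using one_le_power[OF s, of n] by (simp add: distrib_left)
    ultimately have le: "real (card E) \<le> s ^ n * (1 / \<delta> + 1)" by simp
    have "0 < 1 / \<delta> + 1" using \<delta>(1) by (simp add: add_pos_pos)
    moreover have "card E > 0" using E by (simp add: card_gt_0_iff)
    ultimately have "ln (real (card E)) \<le> ln (s ^ n * (1 / \<delta> + 1))"
      using le s by (subst ln_le_cancel_iff) auto
    also have "\<dots> = real n * ln s + c"
      using s \<open>0 < 1 / \<delta> + 1\<close> by (simp add: c_def ln_mult ln_realpow)
    finally show "ereal (ln (real (card E))) \<le> ereal (real n * ln s + c)" by simp
  qed
  have "limsup (\<lambda>n. sep n / ereal (real n)) \<le> limsup (\<lambda>n. ereal (ln s + c / real n))"
  proof (rule Limsup_mono)
    show "\<forall>\<^sub>F n in sequentially. sep n / ereal (real n) \<le> ereal (ln s + c / real n)"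
    proof (rule eventually_sequentiallyI[of 1])
      fix n :: nat assume n: "1 \<le> n"
      have "sep n / ereal (real n) \<le> ereal (real n * ln s + c) / ereal (real n)"
        using bound n by (intro ereal_divide_right_mono) auto
      also have "\<dots> = ereal (ln s + c / real n)" using n by (simp add: field_simps)
      finally show "sep n / ereal (real n) \<le> ereal (ln s + c / real n)" .
    qed
  qed
  also have "\<dots> = ereal (ln s)"
  proof (rule lim_imp_Limsup)
    have "(\<lambda>n. ln s + c / real n) \<longlonglongrightarrow> ln s + 0"
      by (intro tendsto_intros lim_const_over_n)
    then show "(\<lambda>n. ereal (ln s + c / real n)) \<longlonglongrightarrow> ereal (ln s)" by simp
  qed simp
  finally show "limsup (\<lambda>n. (SUP E\<in>{E. E \<noteq> {} \<and> separated_set T n \<epsilon> E}. ereal (ln (real (card E)))) / ereal (real n))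
      \<le> ereal (ln s)" unfolding sep_def .
qed

section \<open>Laps\<close>

text \<open>Between a preimage of \<open>c\<close> and a preimage of \<open>d\<close> all values of
  \<open>{c..d}\<close> are already taken. By injectivity \<open>x\<close> lies strictly between
  these two preimages.\<close>

lemma interval_inj_image_interior:
  fixes f :: "real \<Rightarrow> real"
  assumes "continuous_on {a..b} f" "inj_on f {a..b}" "f ` {a..b} = {c..d}"
    and x: "x \<in> {a..b}" "f x \<in> {c<..<d}"
  shows "x \<in> {a<..<b}"
proof -
  have cd: "c \<in> f ` {a..b}" "d \<in> f ` {a..b}" using x(2) assms(3) by auto
  obtain p where p: "p \<in> {a..b}" "c = f p" using cd(1) by blast
  obtain q where q: "q \<in> {a..b}" "d = f q" using cd(2) by blast
  have sub: "closed_segment p q \<subseteq> {a..b}"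
    using p(1) q(1) by (simp add: closed_segment_subset)
  have "connected (f ` closed_segment p q)"
    using assms(1) sub by (intro connected_continuous_image) (auto intro: continuous_on_subset)
  moreover have "f p \<in> f ` closed_segment p q" "f q \<in> f ` closed_segment p q" by auto
  ultimately have "f x \<in> f ` closed_segment p q"
    using p(2) q(2) x(2) unfolding connected_iff_interval
    by (metis greaterThanLessThan_iff order_less_imp_le)
  then obtain u where "u \<in> closed_segment p q" "f x = f u" by blast
  then have "x \<in> closed_segment p q" using assms(2) sub x(1) by (metis inj_onD subsetD)
  moreover have "x \<noteq> p" "x \<noteq> q" using p q x by auto
  ultimately show ?thesis
    using p(1) q(1) by (auto simp: closed_segment_eq_real_ivl split: if_splits)
qed

text \<open>The endpoints \<open>a\<close> and \<open>b\<close> have distinct values in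
  \<open>{c..d}\<close> but not in its interior, so these are \<open>c\<close> and \<open>d\<close>
  in some order; injectivity keeps inner points away from both.\<close>

lemma interval_inj_image_endpoints:
  fixes f :: "real \<Rightarrow> real"
  assumes "continuous_on {a..b} f" "inj_on f {a..b}" "f ` {a..b} = {c..d}" "c < d"
  shows "a < b" "f a \<notin> {c<..<d}" "f b \<notin> {c<..<d}"
    and "x \<in> {a<..<b} \<Longrightarrow> f x \<in> {c<..<d}"
proof -
  have "(c + d) / 2 \<in> f ` {a..b}" using assms(3,4) by simp
  then obtain u where "u \<in> {a..b}" "f u = (c + d) / 2" by (metis imageE)
  then have "u \<in> {a<..<b}" using interval_inj_image_interior[OF assms(1-3), of u] assms(4) by simp
  then show ab: "a < b" by simp
  show ends: "f a \<notin> {c<..<d}" "f b \<notin> {c<..<d}"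
    using interval_inj_image_interior[OF assms(1-3), of a] interval_inj_image_interior[OF assms(1-3), of b] ab
    by auto
  have "f a \<in> {c..d}" "f b \<in> {c..d}" using ab assms(3) by auto
  moreover have "f a \<noteq> f b" using ab inj_onD[OF assms(2), of a b] by auto
  ultimately have eq: "{f a, f b} = {c, d}" using ends by auto
  show "f x \<in> {c<..<d}" if "x \<in> {a<..<b}"
  proof -
    have "f x \<in> {c..d}" using that assms(3) by auto
    moreover have "f x \<noteq> f a" "f x \<noteq> f b" using that inj_onD[OF assms(2), of x a] inj_onD[OF assms(2), of x b] by auto
    then have "f x \<noteq> c" "f x \<noteq> d" using eq by (metis doubleton_eq_iff)+
    ultimately show ?thesis by simp
  qed
qed

text \<open>The laps \<open>L\<close> are kept apart from the partition \<open>P\<close> because an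
  element of a slack partition may hold several laps, and because a window perturbation keeps
  \<open>P\<close> while it changes the laps inside one element.\<close>

locale lap_system =
  fixes T :: "real \<Rightarrow> real" and P L :: "real set set"
  assumes T: "interval_map T"
    and P_interval: "i \<in> P \<Longrightarrow> \<exists>a b. 0 \<le> a \<and> a < b \<and> b \<le> 1 \<and> i = {a..b}"
    and P_disjoint: "i \<in> P \<Longrightarrow> i' \<in> P \<Longrightarrow> i \<noteq> i' \<Longrightarrow> interior i \<inter> interior i' = {}"
    and L_countable: "countable L"
    and L_interval: "K \<in> L \<Longrightarrow> \<exists>a b. a < b \<and> K = {a..b}"
    and L_sub: "K \<in> L \<Longrightarrow> \<exists>i\<in>P. K \<subseteq> i"
    and L_inj: "K \<in> L \<Longrightarrow> inj_on T K"
    and L_markov: "K \<in> L \<Longrightarrow> i \<in> P \<Longrightarrow> T ` K \<inter> interior i \<noteq> {} \<Longrightarrow> i \<subseteq> T ` K"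
    and L_cover: "countable ({0..1} - \<Union>L)"
begin

definition exceptional :: "real set" where
  "exceptional = {0..1} - (\<Union>K\<in>L. interior K)"

text \<open>Excluding forward images of exceptional points means that no preimage of
  \<open>w\<close>, of any order, is a lap endpoint or an uncovered point. Genericity is thus
  inherited by preimages, and the route of a backward orbit through \<open>L\<close> and
  \<open>P\<close> is unambiguous.\<close>

definition generic :: "real \<Rightarrow> bool" where
  "generic w \<longleftrightarrow> w \<in> {0..1} \<and> (\<forall>n. w \<notin> (T ^^ n) ` exceptional)"

lemma funpow_in: "x \<in> {0..1} \<Longrightarrow> (T ^^ n) x \<in> {0..1}"
  by (rule interval_map_funpow_in[OF T])

lemma P_sub: "i \<in> P \<Longrightarrow> i \<subseteq> {0..1}"
  using P_interval by fastforce

lemma L_sub_unit: "K \<in> L \<Longrightarrow> K \<subseteq> {0..1}"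
  using L_sub P_sub by blast

lemma countable_exceptional: "countable exceptional"
proof -
  have "K - interior K \<subseteq> {Inf K, Sup K}" if "K \<in> L" for K
    using L_interval[OF that] by auto
  then have "countable (K - interior K)" if "K \<in> L" for K
    using that by (meson countable_subset countable_finite finite.emptyI finite.insertI)
  then have "countable (({0..1} - \<Union>L) \<union> (\<Union>K\<in>L. K - interior K))"
    using L_countable L_cover by auto
  then show ?thesis by (rule countable_subset[rotated]) (auto simp: exceptional_def)
qed

lemma countable_nongeneric: "countable {w\<in>{0..1}. \<not> generic w}"
proof -
  have "{w\<in>{0..1}. \<not> generic w} \<subseteq> (\<Union>n. (T ^^ n) ` exceptional)"
    by (auto simp: generic_def)
  moreover have "countable (\<Union>n. (T ^^ n) ` exceptional)" using countable_exceptional by auto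
  ultimately show ?thesis by (rule countable_subset)
qed

lemma generic_preimage:
  assumes "x \<in> {0..1}" "generic ((T ^^ n) x)"
  shows "generic x"
  unfolding generic_def
proof (intro conjI allI notI)
  fix m assume "x \<in> (T ^^ m) ` exceptional"
  then obtain z where "z \<in> exceptional" "x = (T ^^ m) z" by blast
  then have "(T ^^ n) x \<in> (T ^^ (n + m)) ` exceptional" by (auto simp: funpow_add)
  then show False using assms(2) unfolding generic_def by blast
qed (use assms in auto)

lemma generic_in_lap:
  assumes "generic x"
  obtains K where "K \<in> L" "x \<in> interior K"
proof -
  have "x \<in> {0..1}" "x \<notin> (T ^^ 0) ` exceptional" using assms unfolding generic_def by blast+
  then show thesis using that by (auto simp: exceptional_def)
qed

text \<open>An open set that misses \<open>interior i\<close> also misses its closure, which is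
  \<open>i\<close> since \<open>i\<close> is nondegenerate.\<close>

lemma P_eqI:
  assumes "i \<in> P" "i' \<in> P" "x \<in> i" "x \<in> interior i'"
  shows "i = i'"
proof (rule ccontr)
  assume "i \<noteq> i'"
  obtain a b where i: "i = {a..b}" "a < b" using P_interval[OF assms(1)] by blast
  have "interior i' \<inter> interior i = {}" using P_disjoint[OF assms(1,2) \<open>i \<noteq> i'\<close>] by blast
  then have "interior i' \<inter> closure (interior i) = {}" by (simp add: open_Int_closure_eq_empty)
  moreover have "closure (interior i) = i" using i by simp
  ultimately show False using assms(3,4) by blast
qed

lemma generic_interior:
  assumes "generic x" "i \<in> P" "x \<in> i"
  shows "x \<in> interior i"
proof -
  obtain K where K: "K \<in> L" "x \<in> interior K" using assms(1) by (rule generic_in_lap)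
  obtain i' where i': "i' \<in> P" "K \<subseteq> i'" using L_sub[OF K(1)] by blast
  have "x \<in> interior i'" using K(2) interior_mono[OF i'(2)] by blast
  then show ?thesis using P_eqI[OF assms(2) i'(1) assms(3)] by simp
qed

text \<open>These are the full branches of the iterate over \<open>j\<close>: closed intervals
  carried homeomorphically onto \<open>j\<close>. The set \<open>L\<close> holds the laps of
  \<open>T\<close> itself.\<close>

definition is_lap :: "nat \<Rightarrow> real set \<Rightarrow> real set \<Rightarrow> bool" where
  "is_lap n j K \<longleftrightarrow> compact K \<and> connected K \<and> K \<subseteq> {0..1} \<and> inj_on (T ^^ n) K \<and> (T ^^ n) ` K = j"

text \<open>Branches are pulled back one step at a time. The branch \<open>K'\<close> through
  \<open>T x\<close> lies in one element \<open>i'\<close> of \<open>P\<close>, with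
  \<open>T x\<close> in its interior by genericity. The lap \<open>M\<close> around \<open>x\<close>
  then covers \<open>i'\<close> by the Markov property, and the inverse of \<open>T\<close> on
  \<open>M\<close> carries \<open>K'\<close> to a branch through \<open>x\<close>. The clause on
  intermediate images keeps track of itineraries.\<close>

lemma lap_exists:
  assumes j: "j \<in> P" and "generic ((T ^^ n) x)" "(T ^^ n) x \<in> j" "x \<in> {0..1}"
  shows "\<exists>K. x \<in> K \<and> is_lap n j K \<and> (\<forall>l<n. \<exists>M\<in>L. (T ^^ l) ` K \<subseteq> M)"
  using assms(2-)
proof (induction n arbitrary: x)
  case 0
  obtain a b where "j = {a..b}" using P_interval[OF j] by blast
  then show ?case using 0 P_sub[OF j] by (intro exI[of _ j]) (auto simp: is_lap_def)
next
  case (Suc n)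
  let ?u = "T x"
  have Tn: "(T ^^ Suc n) z = (T ^^ n) (T z)" for z by (simp add: funpow_swap1)
  have u: "?u \<in> {0..1}" using funpow_in[of x 1] Suc.prems(3) by simp
  obtain K' where K': "?u \<in> K'" "is_lap n j K'" "\<And>l. l < n \<Longrightarrow> \<exists>M\<in>L. (T ^^ l) ` K' \<subseteq> M"
    using Suc.IH[OF Suc.prems(1,2)[unfolded Tn] u] by blast
  \<comment> \<open>For order 0 the branch is \<open>j\<close> itself; otherwise its own first lap
    lies in an element of \<open>P\<close>.\<close>
  have "\<exists>i'\<in>P. K' \<subseteq> i'"
  proof (cases n)
    case 0
    then show ?thesis using K'(2) j by (auto simp: is_lap_def)
  next
    case (Suc m)
    then obtain M where "M \<in> L" "(T ^^ 0) ` K' \<subseteq> M" using K'(3)[of 0] by blast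
    then show ?thesis using L_sub by (metis funpow_0 image_cong image_ident subset_trans)
  qed
  then obtain i' where i': "i' \<in> P" "K' \<subseteq> i'" by blast
  have "generic ?u" by (rule generic_preimage[OF u Suc.prems(1)[unfolded Tn]])
  then have "?u \<in> interior i'" using generic_interior i' K'(1) by blast
  have "generic x" by (rule generic_preimage[OF Suc.prems(3,1)])
  then obtain M where M: "M \<in> L" "x \<in> interior M" by (rule generic_in_lap)
  have xM: "x \<in> M" using M(2) interior_subset by blast
  have "i' \<subseteq> T ` M" using L_markov[OF M(1) i'(1)] \<open>?u \<in> interior i'\<close> xM by blast
  then have K'M: "K' \<subseteq> T ` M" using i' by blast
  obtain a b where ab: "M = {a..b}" using L_interval[OF M(1)] by blast
  define g where "g = inv_into M T"
  define K where "K = g ` K'"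
  have "continuous_on M T"
    using T L_sub_unit[OF M(1)] unfolding interval_map_def by (meson continuous_on_subset)
  then have "continuous_on (T ` M) g"
    unfolding g_def using L_inj[OF M(1)] ab by (intro continuous_on_inv) auto
  then have g: "continuous_on K' g" using K'M continuous_on_subset by blast
  have TK: "T ` K = K'" unfolding K_def g_def using K'M by (simp add: image_f_inv_f image_image f_inv_into_f subset_iff)
  have KM: "K \<subseteq> M" unfolding K_def g_def using K'M by (auto intro: inv_into_into)
  have inj: "inj_on T K" using L_inj[OF M(1)] KM by (rule inj_on_subset)
  have eq: "T ^^ Suc n = (T ^^ n) \<circ> T" using Tn by auto
  have "is_lap (Suc n) j K"
    unfolding is_lap_def
  proof (intro conjI)
    show "compact K" "connected K"
      unfolding K_def using g K'(2)
      by (auto simp: is_lap_def intro: compact_continuous_image connected_continuous_image)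
    show "K \<subseteq> {0..1}" using KM L_sub_unit[OF M(1)] by blast
    show "inj_on (T ^^ Suc n) K"
      unfolding eq using inj TK K'(2) by (intro comp_inj_on) (auto simp: is_lap_def)
    show "(T ^^ Suc n) ` K = j"
      unfolding eq image_comp[symmetric] TK using K'(2) by (simp add: is_lap_def)
  qed
  moreover have "x \<in> K"
  proof -
    have "g ?u = x" unfolding g_def using L_inj[OF M(1)] xM by simp
    then show ?thesis unfolding K_def using K'(1) by force
  qed
  moreover have "\<exists>M\<in>L. (T ^^ l) ` K \<subseteq> M" if "l < Suc n" for l
  proof (cases l)
    case 0
    then show ?thesis using KM M(1) by auto
  next
    case (Suc m)
    have "(T ^^ l) ` K = (T ^^ m) ` T ` K" unfolding Suc by (auto simp: funpow_swap1 image_iff)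
    then show ?thesis using K'(3)[of m] that Suc TK by simp
  qed
  ultimately show ?case by blast
qed

text \<open>On a branch, the points mapped into \<open>interior j\<close> are exactly the inner
  points. So no endpoint of one branch is an inner point of the other, and two intervals with a
  common inner point and this property coincide.\<close>

lemma lap_unique:
  assumes j: "j \<in> P" and K: "is_lap n j K" "is_lap n j K'"
    and p: "p \<in> K" "p \<in> K'" "(T ^^ n) p \<in> interior j"
  shows "K = K'"
proof -
  let ?f = "T ^^ n"
  obtain c d where cd: "j = {c..d}" "c < d" using P_interval[OF j] by blast
  obtain a b where ab: "K = {a..b}" using K(1) connected_compact_interval_1 unfolding is_lap_def by blast
  obtain a' b' where ab': "K' = {a'..b'}" using K(2) connected_compact_interval_1 unfolding is_lap_def by blast
  have cont: "continuous_on K ?f" "continuous_on K' ?f"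
    using K continuous_on_interval_map_funpow[OF T] unfolding is_lap_def by (meson continuous_on_subset)+
  have inj: "inj_on ?f K" "inj_on ?f K'" and im: "?f ` K = {c..d}" "?f ` K' = {c..d}"
    using K cd unfolding is_lap_def by auto
  note E = interval_inj_image_endpoints[OF cont(1)[unfolded ab] inj(1)[unfolded ab] im(1)[unfolded ab] cd(2)]
  note E' = interval_inj_image_endpoints[OF cont(2)[unfolded ab'] inj(2)[unfolded ab'] im(2)[unfolded ab'] cd(2)]
  have fp: "?f p \<in> {c<..<d}" using p(3) cd by simp
  have "p \<in> {a<..<b}"
    using interval_inj_image_interior[OF cont(1)[unfolded ab] inj(1)[unfolded ab] im(1)[unfolded ab] _ fp] p ab by simp
  moreover have "p \<in> {a'<..<b'}"
    using interval_inj_image_interior[OF cont(2)[unfolded ab'] inj(2)[unfolded ab'] im(2)[unfolded ab'] _ fp] p ab' by simp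
  ultimately have "\<not> a < a'" "\<not> a' < a" "\<not> b < b'" "\<not> b' < b"
    using E(2,3) E(4)[of a'] E(4)[of b'] E'(2,3) E'(4)[of a] E'(4)[of b] by auto
  then show ?thesis using ab ab' by auto
qed

section \<open>Counting preimages\<close>

text \<open>The predicate \<open>\<beta>\<close> prescribes the times \<open>l < n\<close> at which
  the orbit is in \<open>j\<close>: constantly false describes first entrances, and
  \<open>\<lambda>l. l = 0\<close> describes first returns. The final time \<open>n\<close> is left
  free.\<close>

definition preimages :: "real set \<Rightarrow> (nat \<Rightarrow> bool) \<Rightarrow> nat \<Rightarrow> real \<Rightarrow> real set" where
  "preimages j \<beta> n w = {x\<in>{0..1}. (T ^^ n) x = w \<and> (\<forall>l<n. (T ^^ l) x \<in> j \<longleftrightarrow> \<beta> l)}"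

text \<open>At each time before the last, a branch is carried into one lap and so into one element
  of \<open>P\<close>. If one generic point of it is then in \<open>j\<close>, that element is
  \<open>j\<close>, and the whole branch makes the visit.\<close>

lemma lap_itinerary:
  assumes j: "j \<in> P" and K: "x \<in> K" "x' \<in> K" "K \<subseteq> {0..1}" "\<exists>M\<in>L. (T ^^ l) ` K \<subseteq> M"
    and gen: "generic x" "generic ((T ^^ l) x)" and "(T ^^ l) x \<in> j"
  shows "(T ^^ l) x' \<in> j"
proof -
  obtain M where M: "M \<in> L" "(T ^^ l) ` K \<subseteq> M" using K(4) by (rule bexE)
  obtain i where i: "i \<in> P" "M \<subseteq> i" using L_sub[OF M(1)] by (rule bexE)
  have Ki: "(T ^^ l) z \<in> i" if "z \<in> K" for z using M(2) i(2) that by blast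
  have "(T ^^ l) x \<in> interior i" using generic_interior[OF gen(2) i(1)] Ki[OF K(1)] by simp
  then have "j = i" by (rule P_eqI[OF j i(1) assms(8)])
  then show ?thesis using Ki[OF K(2)] by simp
qed

lemma generic_iterate:
  assumes "x \<in> {0..1}" "generic ((T ^^ n) x)" "l \<le> n"
  shows "generic ((T ^^ l) x)"
proof -
  have "(T ^^ n) x = (T ^^ (n - l)) ((T ^^ l) x)"
    using assms(3) by (metis comp_apply funpow_add le_add_diff_inverse2)
  then show ?thesis using assms(2) funpow_in[OF assms(1)] generic_preimage by metis
qed

lemma preimages_lap:
  assumes j: "j \<in> P" and w: "generic w" "w \<in> j" and x: "x \<in> preimages j \<beta> n w"
  obtains K where "x \<in> K" "is_lap n j K" "\<And>l. l < n \<Longrightarrow> \<exists>M\<in>L. (T ^^ l) ` K \<subseteq> M"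
    "\<And>w'. generic w' \<Longrightarrow> w' \<in> j \<Longrightarrow> \<exists>x'\<in>K. x' \<in> preimages j \<beta> n w'"
proof -
  have x': "x \<in> {0..1}" "(T ^^ n) x = w" "\<And>l. l < n \<Longrightarrow> (T ^^ l) x \<in> j \<longleftrightarrow> \<beta> l"
    using x unfolding preimages_def by auto
  obtain K where K: "x \<in> K" "is_lap n j K" "\<And>l. l < n \<Longrightarrow> \<exists>M\<in>L. (T ^^ l) ` K \<subseteq> M"
    using lap_exists[OF j, of n x] w x' by auto
  have "\<exists>x'\<in>K. x' \<in> preimages j \<beta> n w'" if w': "generic w'" "w' \<in> j" for w'
  proof -
    obtain z where z: "z \<in> K" "(T ^^ n) z = w'" using K(2) w'(2) unfolding is_lap_def by blast
    have K01: "K \<subseteq> {0..1}" using K(2) unfolding is_lap_def by blast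
    then have z01: "z \<in> {0..1}" using z by blast
    have "(T ^^ l) z \<in> j \<longleftrightarrow> \<beta> l" if "l < n" for l
    proof -
      have g: "generic x" "generic ((T ^^ l) x)" "generic z" "generic ((T ^^ l) z)"
        using generic_iterate[of x n 0] generic_iterate[of x n l] generic_iterate[of z n 0]
          generic_iterate[of z n l] x' z z01 w(1) w'(1) that by auto
      then have "(T ^^ l) z \<in> j \<longleftrightarrow> (T ^^ l) x \<in> j"
        using lap_itinerary[OF j _ _ K01 K(3)[OF that], of x z] lap_itinerary[OF j _ _ K01 K(3)[OF that], of z x]
          K(1) z(1) by blast
      then show ?thesis using x'(3)[OF that] by simp
    qed
    then show ?thesis using z z01 unfolding preimages_def by blast
  qed
  then show thesis using that[OF K(1,2)] K(3) by meson
qed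

text \<open>A branch over \<open>j\<close> contains one preimage of \<open>w\<close> and one of
  \<open>w'\<close>, with the same visits to \<open>j\<close>. This pairing is injective by
  uniqueness of branches. Applied in both directions it makes the counts independent of the generic
  point, which the renewal equation relies on.\<close>

lemma preimages_card:
  assumes j: "j \<in> P" and w: "generic w" "w \<in> j" and w': "generic w'" "w' \<in> j"
    and fin: "finite (preimages j \<beta> n w')"
  shows "finite (preimages j \<beta> n w)" "card (preimages j \<beta> n w) \<le> card (preimages j \<beta> n w')"
proof -
  have "\<exists>K x'. x \<in> K \<and> is_lap n j K \<and> x' \<in> K \<and> x' \<in> preimages j \<beta> n w'"
    if "x \<in> preimages j \<beta> n w" for x
    using preimages_lap[OF j w that] w' by metis
  then obtain K \<phi> where K: "\<And>x. x \<in> preimages j \<beta> n w \<Longrightarrow> x \<in> K x" "\<And>x. x \<in> preimages j \<beta> n w \<Longrightarrow> is_lap n j (K x)"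
    "\<And>x. x \<in> preimages j \<beta> n w \<Longrightarrow> \<phi> x \<in> K x"
    "\<And>x. x \<in> preimages j \<beta> n w \<Longrightarrow> \<phi> x \<in> preimages j \<beta> n w'"
    by metis
  have "inj_on \<phi> (preimages j \<beta> n w)"
  proof (rule inj_onI)
    fix x z assume xz: "x \<in> preimages j \<beta> n w" "z \<in> preimages j \<beta> n w" "\<phi> x = \<phi> z"
    have "(T ^^ n) (\<phi> x) = w'" using K(4)[OF xz(1)] unfolding preimages_def by blast
    then have "(T ^^ n) (\<phi> x) \<in> interior j" using generic_interior[OF w'(1) j w'(2)] by simp
    then have "K x = K z" using lap_unique[OF j K(2)[OF xz(1)] K(2)[OF xz(2)], of "\<phi> x"] K(3) xz by metis
    moreover have "(T ^^ n) x = (T ^^ n) z" using xz unfolding preimages_def by auto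
    ultimately show "x = z" using K(1,2) xz unfolding is_lap_def by (metis inj_onD)
  qed
  moreover have "\<phi> ` preimages j \<beta> n w \<subseteq> preimages j \<beta> n w'" using K(4) by blast
  ultimately show "finite (preimages j \<beta> n w)" "card (preimages j \<beta> n w) \<le> card (preimages j \<beta> n w')"
    using fin inj_on_finite card_inj_on_le by metis+
qed

text \<open>The finitely many branches met by the preimages of the single point \<open>w'\<close>
  carry the preimages of all other generic points as well, and for \<open>n \<ge> 1\<close> each
  branch lies inside one lap. Tightness rests on this uniformity.\<close>

lemma preimages_finite_cover:
  assumes j: "j \<in> P" and w': "generic w'" "w' \<in> j"
    and fin: "finite (preimages j \<beta> n w')" and n: "n \<ge> 1"
  obtains F where "finite F" "F \<subseteq> L" "\<And>w. generic w \<Longrightarrow> w \<in> j \<Longrightarrow> preimages j \<beta> n w \<subseteq> \<Union>F"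
proof -
  have "\<exists>K M. x \<in> K \<and> is_lap n j K \<and> K \<subseteq> M \<and> M \<in> L" if x: "x \<in> preimages j \<beta> n w'" for x
  proof -
    obtain K where K: "x \<in> K" "is_lap n j K" "\<And>l. l < n \<Longrightarrow> \<exists>M\<in>L. (T ^^ l) ` K \<subseteq> M"
      by (rule preimages_lap[OF j w' x]) blast
    obtain M where "M \<in> L" "(T ^^ 0) ` K \<subseteq> M" using K(3)[of 0] n by auto
    then show ?thesis using K(1,2) by (intro exI[of _ K] exI[of _ M]) simp
  qed
  then obtain K M where K: "\<And>x. x \<in> preimages j \<beta> n w' \<Longrightarrow> x \<in> K x" "\<And>x. x \<in> preimages j \<beta> n w' \<Longrightarrow> is_lap n j (K x)"
    "\<And>x. x \<in> preimages j \<beta> n w' \<Longrightarrow> K x \<subseteq> M x" "\<And>x. x \<in> preimages j \<beta> n w' \<Longrightarrow> M x \<in> L"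
    by metis
  have "preimages j \<beta> n w \<subseteq> \<Union>(M ` preimages j \<beta> n w')" if w: "generic w" "w \<in> j" for w
  proof
    fix x assume x: "x \<in> preimages j \<beta> n w"
    obtain N x' where N: "x \<in> N" "is_lap n j N" "x' \<in> N" "x' \<in> preimages j \<beta> n w'"
      using preimages_lap[OF j w x] w' by metis
    have "(T ^^ n) x' = w'" using N(4) unfolding preimages_def by blast
    then have "(T ^^ n) x' \<in> interior j" using generic_interior[OF w'(1) j w'(2)] by simp
    then have "N = K x'" using lap_unique[OF j N(2) K(2)[OF N(4)] N(3) K(1)[OF N(4)]] by simp
    then show "x \<in> \<Union>(M ` preimages j \<beta> n w')" using K(3)[OF N(4)] N by blast
  qed
  then show thesis using that[of "M ` preimages j \<beta> n w'"] fin K(4) by blast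
qed

text \<open>The branches of \<open>T ^^ n\<close> through the points of the fibre over
  \<open>y\<close> in \<open>j\<close> form a horseshoe, once the smallest and the largest point
  \<open>c\<close>, \<open>d\<close> are discarded, because their branches may stick out of
  \<open>{c..d}\<close>. These two points account for the summand 2.\<close>

lemma loops_entropy_bound:
  assumes j: "j \<in> P" and y: "generic y" "y \<in> j" and h: "topological_entropy T = ereal h"
  shows "finite {x\<in>j. (T ^^ n) x = y}" "real (card {x\<in>j. (T ^^ n) x = y}) \<le> 2 + exp (n * h)"
proof -
  let ?X = "{x\<in>j. (T ^^ n) x = y}"
  have bound: "real (card Y) \<le> 2 + exp (n * h)" if Y: "finite Y" "Y \<subseteq> ?X" for Y
  proof (cases "n = 0 \<or> card Y \<le> 2")
    case True
    have "card Y \<le> card {y}" if "n = 0" using Y that by (intro card_mono) auto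
    then have "card Y \<le> 2" using True by auto
    moreover have "0 < exp (n * h)" by simp
    ultimately show ?thesis by linarith
  next
    case False
    then have n: "n \<ge> 1" and card: "card Y > 2" by auto
    then have ne: "Y \<noteq> {}" by auto
    define c where "c = Min Y"
    define d where "d = Max Y"
    have cd: "c \<in> Y" "d \<in> Y" using Y(1) ne by (simp_all add: c_def d_def)
    have le: "c \<le> x" "x \<le> d" if "x \<in> Y" for x using Y(1) that by (simp_all add: c_def d_def)
    define X where "X = Y - {c, d}"
    have X: "finite X" "card Y \<le> card X + 2"
    proof -
      show "finite X" using Y(1) X_def by simp
      have "card Y - card {c, d} \<le> card X" unfolding X_def by (rule diff_card_le_card_Diff) simp
      moreover have "card {c, d} \<le> 2" by (simp add: card_insert_if)
      ultimately show "card Y \<le> card X + 2" by linarith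
    qed
    have Xne: "X \<noteq> {}" using X card by auto
    have Yx: "x \<in> {0..1}" "generic x" "(T ^^ n) x = y" "x \<in> interior j" if "x \<in> Y" for x
    proof -
      show x: "x \<in> {0..1}" "(T ^^ n) x = y" using that Y P_sub[OF j] by auto
      then show g: "generic x" using y generic_preimage by metis
      show "x \<in> interior j" using generic_interior[OF g j] that Y by auto
    qed
    have "\<exists>K. x \<in> K \<and> is_lap n j K" if "x \<in> Y" for x
      using lap_exists[OF j, of n x] Yx[OF that] y by auto
    then obtain K where K: "\<And>x. x \<in> Y \<Longrightarrow> x \<in> K x" "\<And>x. x \<in> Y \<Longrightarrow> is_lap n j (K x)" by metis
    have XY: "x \<in> Y" "x \<noteq> c" "x \<noteq> d" if "x \<in> X" for x using that X_def by auto
    have cont: "continuous_on (K x) (T ^^ n)" if "x \<in> Y" for x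
      using K(2)[OF that] continuous_on_interval_map_funpow[OF T] unfolding is_lap_def
      by (meson continuous_on_subset)
    have only: "z = x" if "x \<in> Y" "z \<in> Y" "z \<in> K x" for x z
      using K(1,2)[OF that(1)] that(3) Yx[OF that(1)] Yx[OF that(2)] unfolding is_lap_def
      by (metis inj_onD)
    define J where "J = {c..d}"
    have "is_interval (interior j)" using P_interval[OF j] by (auto simp: is_interval_1)
    then have Jj: "J \<subseteq> interior j"
      unfolding J_def using mem_is_interval_1_I Yx(4)[OF cd(1)] Yx(4)[OF cd(2)] by (meson atLeastAtMost_iff subsetI)
    \<comment> \<open>Neighbouring branches may share an endpoint, which is mapped to the boundary
      of \<open>j\<close>. Trimming to the part mapped into \<open>J\<close>, inside
      \<open>interior j\<close>, makes them disjoint.\<close>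
    define C where "C x = {u \<in> K x. (T ^^ n) u \<in> J}" for x
    have "ereal (ln (card X) / n) \<le> topological_entropy T"
    proof (rule horseshoe_entropy[OF T n X(1) Xne, of C J])
      show "compact (C x)" if "x \<in> X" for x
      proof -
        have Kx: "compact (K x)" using K(2)[OF XY(1)[OF that]] unfolding is_lap_def by blast
        have "closed (K x \<inter> (T ^^ n) -` J)"
          using Kx cont[OF XY(1)[OF that]] unfolding J_def
          by (intro continuous_closed_preimage compact_imp_closed) auto
        then have "compact (K x \<inter> (K x \<inter> (T ^^ n) -` J))" using Kx by (intro compact_Int_closed)
        moreover have "K x \<inter> (K x \<inter> (T ^^ n) -` J) = C x" unfolding C_def by blast
        ultimately show ?thesis by simp
      qed
      \<comment> \<open>The interval \<open>K x\<close> meets the fibre over \<open>y\<close> only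
        in \<open>x\<close>, so it cannot reach \<open>c\<close> or \<open>d\<close>, which belong
        to this fibre and enclose \<open>x\<close>.\<close>
      show "C x \<subseteq> J" if "x \<in> X" for x
      proof
        fix u assume "u \<in> C x"
        then have u: "u \<in> K x" unfolding C_def by blast
        have I: "is_interval (K x)"
          using K(2)[OF XY(1)[OF that]] unfolding is_lap_def is_interval_connected_1 by blast
        have "c \<le> u"
        proof (rule ccontr)
          assume "\<not> c \<le> u"
          then have "c \<in> K x"
            using mem_is_interval_1_I[OF I u K(1)[OF XY(1)[OF that]]] le(1)[OF XY(1)[OF that]] by simp
          then show False using only[OF XY(1)[OF that] cd(1)] XY(2)[OF that] by simp
        qed
        moreover have "u \<le> d"
        proof (rule ccontr)
          assume "\<not> u \<le> d"
          then have "d \<in> K x"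
            using mem_is_interval_1_I[OF I K(1)[OF XY(1)[OF that]] u] le(2)[OF XY(1)[OF that]] by simp
          then show False using only[OF XY(1)[OF that] cd(2)] XY(3)[OF that] by simp
        qed
        ultimately show "u \<in> J" unfolding J_def by simp
      qed
      show "J \<subseteq> (T ^^ n) ` C x" if "x \<in> X" for x
      proof
        fix v assume "v \<in> J"
        then have "v \<in> (T ^^ n) ` K x"
          using Jj interior_subset K(2)[OF XY(1)[OF that]] unfolding is_lap_def by blast
        then show "v \<in> (T ^^ n) ` C x" using \<open>v \<in> J\<close> unfolding C_def by blast
      qed
      show "C x \<inter> C x' = {}" if xx: "x \<in> X" "x' \<in> X" "x \<noteq> x'" for x x'
      proof (rule ccontr)
        assume "C x \<inter> C x' \<noteq> {}"
        then obtain u where "u \<in> K x" "u \<in> K x'" "(T ^^ n) u \<in> interior j" using Jj unfolding C_def by blast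
        then have "K x = K x'" using lap_unique[OF j K(2)[OF XY(1)[OF xx(1)]] K(2)[OF XY(1)[OF xx(2)]]] by blast
        then show False using only[OF XY(1)[OF xx(1)] XY(1)[OF xx(2)]] K(1)[OF XY(1)[OF xx(2)]] xx(3) by simp
      qed
      show "J \<subseteq> {0..1}" using Jj interior_subset P_sub[OF j] by blast
      show "J \<noteq> {}" unfolding J_def using le(1)[OF cd(2)] by simp
    qed
    then have "ln (card X) \<le> n * h" using h n by (simp add: field_simps)
    then have "real (card X) \<le> exp (n * h)"
      using Xne X(1) by (metis card_gt_0_iff exp_le_cancel_iff exp_ln of_nat_0_less_iff)
    then show ?thesis using X(2) by linarith
  qed
  show fin: "finite ?X"
  proof (rule ccontr)
    assume "infinite ?X"
    then obtain Y where Y: "finite Y \<and> card Y = nat \<lceil>3 + exp (n * h)\<rceil> \<and> Y \<subseteq> ?X"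
      using infinite_arbitrarily_large by blast
    then have "real (nat \<lceil>3 + exp (n * h)\<rceil>) \<le> 2 + exp (n * h)" using bound[of Y] by simp
    moreover have "real (nat \<lceil>3 + exp (n * h)\<rceil>) \<ge> 3 + exp (n * h)" by (rule real_nat_ceiling_ge)
    ultimately show False by linarith
  qed
  show "real (card ?X) \<le> 2 + exp (n * h)" using bound[OF fin] by blast
qed

end

section \<open>Renewal structure\<close>

lemma sum_convolution_le:
  fixes u v :: "nat \<Rightarrow> real"
  assumes "\<And>n. 0 \<le> u n" "\<And>n. 0 \<le> v n"
  shows "(\<Sum>n\<le>M. \<Sum>i\<le>n. u i * v (n - i)) \<le> (\<Sum>i\<le>M. u i) * (\<Sum>k\<le>M. v k)"
proof -
  have "(\<Sum>n\<le>M. \<Sum>i\<le>n. u i * v (n - i)) = (\<Sum>(i,k)\<in>{(i,k). i + k \<le> M}. u i * v k)"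
    by (rule sum.triangle_reindex_eq[symmetric])
  also have "\<dots> \<le> (\<Sum>(i,k)\<in>{..M} \<times> {..M}. u i * v k)"
    using assms by (intro sum_mono2) auto
  also have "\<dots> = (\<Sum>i\<le>M. u i) * (\<Sum>k\<le>M. v k)"
    by (simp add: sum_product sum.cartesian_product)
  finally show ?thesis .
qed

text \<open>The assumption \<open>window\<close> ties \<open>N\<close> to the growth rate
  \<open>B\<close> of the entrances and forces a root of the return series at or below
  \<open>1 / (2 * B)\<close>. Its point may differ from \<open>y\<close>, since return counts agree
  at all generic points of \<open>j\<close>. The finite cover \<open>D\<close> of the window by laps
  bounds returns by entrances.\<close>

locale renewal_system = lap_system +
  fixes j :: "real set" and y :: real and D :: "real set set" and C B :: real and N :: nat
  assumes mixing: "topologically_mixing T"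
    and j: "j \<in> P" and y: "generic y" "y \<in> j"
    and D: "finite D" "D \<subseteq> L" "j = \<Union>D"
    and entrance_finite: "finite (preimages j (\<lambda>_. False) n y)"
    and entrance_le: "real (card (preimages j (\<lambda>_. False) n y)) \<le> C * B ^ n"
    and B: "B \<ge> 1"
    and N: "N \<ge> 1"
    and window: "\<exists>w\<in>j. \<exists>A \<subseteq> preimages j (\<lambda>l. l = 0) N w. generic w \<and> (2 * B) ^ N \<le> real (card A)"
begin

abbreviation first_entrances :: "nat \<Rightarrow> real \<Rightarrow> real set" where
  "first_entrances \<equiv> preimages j (\<lambda>_. False)"

abbreviation first_returns :: "nat \<Rightarrow> real \<Rightarrow> real set" where
  "first_returns \<equiv> preimages j (\<lambda>l. l = 0)"

definition entrances :: "nat \<Rightarrow> nat" where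
  "entrances n = card (first_entrances n y)"

definition loops :: "nat \<Rightarrow> real set" where
  "loops n = {x\<in>j. (T ^^ n) x = y}"

text \<open>The value at 0 is set to 0 because the preimages of order 0 are \<open>{y}\<close>, and
  a return must take at least one step for the renewal equation to be recursive.\<close>

definition returns :: "nat \<Rightarrow> nat" where
  "returns n = (if n = 0 then 0 else card (first_returns n y))"

definition hits :: "real set \<Rightarrow> nat \<Rightarrow> nat" where
  "hits A n = card {x\<in>A. (T ^^ n) x = y}"

abbreviation loop_count :: "nat \<Rightarrow> nat" where
  "loop_count n \<equiv> card (loops n)"

lemma j_sub: "j \<subseteq> {0..1}"
  by (rule P_sub[OF j])

lemma loops_generic: "w \<in> loops n \<Longrightarrow> generic w"
  using generic_preimage[of w n] y j_sub unfolding loops_def by blast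

lemma entrance_card:
  assumes "generic w" "w \<in> j"
  shows "finite (first_entrances n w)" "card (first_entrances n w) = entrances n"
proof -
  note * = preimages_card[OF j assms y entrance_finite]
  show "finite (first_entrances n w)" by (rule *(1))
  show "card (first_entrances n w) = entrances n"
    unfolding entrances_def using *(2) preimages_card(2)[OF j y assms *(1)] by (rule antisym)
qed

text \<open>After its first step out of the window, a first return of order \<open>n + 1\<close> is
  a first entrance of order \<open>n\<close>. The first step is injective on each member of
  \<open>D\<close>.\<close>

lemma return_preimages_Suc:
  "finite (first_returns (Suc n) y)"
  "card (first_returns (Suc n) y) \<le> card D * entrances n"
proof -
  let ?X = "first_returns (Suc n) y" and ?E = "first_entrances n y"
  have "\<exists>K\<in>D. x \<in> K" if "x \<in> ?X" for x
    using that D(3) unfolding preimages_def by fastforce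
  then obtain \<kappa> where \<kappa>: "\<And>x. x \<in> ?X \<Longrightarrow> \<kappa> x \<in> D" "\<And>x. x \<in> ?X \<Longrightarrow> x \<in> \<kappa> x" by metis
  let ?g = "\<lambda>x. (\<kappa> x, T x)"
  have inj: "inj_on ?g ?X"
  proof (rule inj_onI)
    fix x x' assume x: "x \<in> ?X" "x' \<in> ?X" "?g x = ?g x'"
    then have "T x = T x'" "x \<in> \<kappa> x" "x' \<in> \<kappa> x" "\<kappa> x \<in> L" using \<kappa> D(2) by auto
    then show "x = x'" using L_inj by (metis inj_onD)
  qed
  have sub: "?g ` ?X \<subseteq> D \<times> ?E"
  proof (clarify, intro conjI)
    fix x assume x: "x \<in> ?X"
    then show "\<kappa> x \<in> D" by (rule \<kappa>)
    have x': "x \<in> {0..1}" "(T ^^ Suc n) x = y" "\<And>l. l < Suc n \<Longrightarrow> (T ^^ l) x \<in> j \<longleftrightarrow> l = 0"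
      using x unfolding preimages_def by auto
    have "T x \<in> {0..1}" using funpow_in[OF x'(1), of 1] by simp
    moreover have "(T ^^ n) (T x) = y" using x'(2) by (simp add: funpow_swap1)
    moreover have "(T ^^ l) (T x) \<notin> j" if "l < n" for l
      using x'(3)[of "Suc l"] that by (simp add: funpow_swap1)
    ultimately show "T x \<in> ?E" unfolding preimages_def by simp
  qed
  have fin: "finite (D \<times> ?E)" using D(1) entrance_finite by simp
  show "finite ?X" using inj sub fin by (rule inj_on_finite)
  show "card ?X \<le> card D * entrances n"
    using card_inj_on_le[OF inj sub fin] by (simp add: card_cartesian_product entrances_def)
qed

lemma return_card:
  assumes "generic w" "w \<in> j" "n \<ge> 1"
  shows "finite (first_returns n w)" "card (first_returns n w) = returns n"
proof -
  have "finite (first_returns n y)" using return_preimages_Suc(1)[of "n - 1"] assms(3) by simp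
  note * = preimages_card[OF j assms(1,2) y this]
  show "finite (first_returns n w)" by (rule *(1))
  show "card (first_returns n w) = returns n"
    using *(2) preimages_card(2)[OF j y assms(1,2) *(1)] assms(3) by (simp add: returns_def)
qed

lemma returns_N: "(2 * B) ^ N \<le> real (returns N)"
proof -
  obtain w A where w: "w \<in> j" "generic w" "A \<subseteq> first_returns N w" "(2 * B) ^ N \<le> real (card A)"
    using window by blast
  have "card A \<le> returns N" using card_mono[OF return_card(1)[OF w(2,1) N] w(3)] return_card(2)[OF w(2,1) N] by simp
  then show ?thesis using w(4) by linarith
qed

lemma first_entrance:
  assumes "x \<in> {0..1}" "(T ^^ n) x = y"
  obtains m where "m \<le> n" "(T ^^ m) x \<in> loops (n - m)" "x \<in> first_entrances m ((T ^^ m) x)"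
proof -
  define m where "m = (LEAST m. (T ^^ m) x \<in> j)"
  have n: "(T ^^ n) x \<in> j" using assms(2) y(2) by simp
  have m: "m \<le> n" "(T ^^ m) x \<in> j" unfolding m_def using n by (auto intro: Least_le LeastI)
  have "(T ^^ l) x \<notin> j" if "l < m" for l using that not_less_Least unfolding m_def by blast
  moreover have "(T ^^ (n - m)) ((T ^^ m) x) = y"
    using assms(2) m(1) by (metis comp_apply funpow_add le_add_diff_inverse2)
  ultimately show thesis using that[of m] m assms(1) unfolding preimages_def loops_def by simp
qed

lemma first_return:
  assumes "x \<in> loops n" "n \<ge> 1"
  obtains m where "1 \<le> m" "m \<le> n" "(T ^^ m) x \<in> loops (n - m)" "x \<in> first_returns m ((T ^^ m) x)"
proof -
  obtain n' where n': "n = Suc n'" using assms(2) by (cases n) auto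
  have x: "x \<in> j" "(T ^^ n) x = y" "x \<in> {0..1}" using assms(1) j_sub unfolding loops_def by auto
  have Tx: "T x \<in> {0..1}" using funpow_in[OF x(3), of 1] by simp
  have "(T ^^ n') (T x) = y" using x(2) unfolding n' by (simp add: funpow_swap1)
  then obtain m where m: "m \<le> n'" "(T ^^ m) (T x) \<in> loops (n' - m)"
    "T x \<in> first_entrances m ((T ^^ m) (T x))"
    by (rule first_entrance[OF Tx])
  have eq: "(T ^^ Suc l) x = (T ^^ l) (T x)" for l by (simp add: funpow_swap1)
  have "(T ^^ l) x \<in> j \<longleftrightarrow> l = 0" if "l < Suc m" for l
  proof (cases l)
    case (Suc l')
    then have "(T ^^ l') (T x) \<notin> j" using m(3) that unfolding preimages_def by simp
    then show ?thesis unfolding Suc eq by simp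
  qed (use x in simp)
  then have "x \<in> first_returns (Suc m) ((T ^^ Suc m) x)"
    using x(3) unfolding preimages_def by blast
  then show thesis using that[of "Suc m"] m(1,2) n' eq[of m] by simp
qed

lemma return_preimages_disjoint:
  assumes "x \<in> first_returns m w" "x \<in> first_returns m' w'"
    and "w \<in> j" "w' \<in> j" "1 \<le> m" "1 \<le> m'"
  shows "m = m' \<and> w = w'"
proof -
  have a: "(T ^^ m) x = w" "\<And>l. l < m \<Longrightarrow> (T ^^ l) x \<in> j \<longleftrightarrow> l = 0"
    using assms(1) unfolding preimages_def by auto
  have b: "(T ^^ m') x = w'" "\<And>l. l < m' \<Longrightarrow> (T ^^ l) x \<in> j \<longleftrightarrow> l = 0"
    using assms(2) unfolding preimages_def by auto
  have "\<not> m < m'" using b(2)[of m] a(1) assms(3,5) by auto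
  moreover have "\<not> m' < m" using a(2)[of m'] b(1) assms(4,6) by auto
  ultimately have "m = m'" by simp
  then show ?thesis using a(1) b(1) by simp
qed

lemma loops_renewal:
  assumes "n \<ge> 1"
  shows "loops n = (\<Union>(m, w)\<in>(SIGMA m:{1..n}. loops (n - m)). first_returns m w)"
proof (intro equalityI subsetI)
  fix x assume x: "x \<in> loops n"
  obtain m where "1 \<le> m" "m \<le> n" "(T ^^ m) x \<in> loops (n - m)" "x \<in> first_returns m ((T ^^ m) x)"
    by (rule first_return[OF x assms])
  then show "x \<in> (\<Union>(m, w)\<in>(SIGMA m:{1..n}. loops (n - m)). first_returns m w)" by auto
next
  fix x assume "x \<in> (\<Union>(m, w)\<in>(SIGMA m:{1..n}. loops (n - m)). first_returns m w)"
  then obtain m w where m: "1 \<le> m" "m \<le> n" "w \<in> loops (n - m)" "x \<in> first_returns m w" by auto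
  have x: "(T ^^ m) x = w" "\<And>l. l < m \<Longrightarrow> (T ^^ l) x \<in> j \<longleftrightarrow> l = 0"
    using m(4) unfolding preimages_def by auto
  have "(T ^^ n) x = (T ^^ (n - m)) w" using m(2) x(1)
    by (metis comp_apply funpow_add le_add_diff_inverse2)
  then have "(T ^^ n) x = y" using m(3) unfolding loops_def by simp
  moreover have "x \<in> j" using x(2)[of 0] m(1) by simp
  ultimately show "x \<in> loops n" unfolding loops_def by simp
qed

lemma loops_0: "loops 0 = {y}"
  using y(2) by (auto simp: loops_def)

lemma loops_finite: "finite (loops n)"
proof (induction n rule: less_induct)
  case (less n)
  show ?case
  proof (cases "n = 0")
    case False
    then have n: "n \<ge> 1" by simp
    have "finite (SIGMA m:{1..n}. loops (n - m))" using less by (intro finite_SigmaI) auto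
    moreover have "finite (first_returns m w)" if "m \<in> {1..n}" "w \<in> loops (n - m)" for m w
      using return_card(1)[of w m] loops_generic[OF that(2)] that unfolding loops_def by simp
    ultimately show ?thesis unfolding loops_renewal[OF n] by (intro finite_UN_I) auto
  qed (simp add: loops_0)
qed

text \<open>Loops are sorted by the time \<open>m\<close> and the place \<open>w\<close> of their
  first return. The number of loops with given \<open>(m, w)\<close> is \<open>returns m\<close>
  whatever \<open>w\<close> is, so the sum becomes a convolution.\<close>

lemma loop_count_renewal:
  "real (loop_count n) = (if n = 0 then 1 else 0) + (\<Sum>m\<le>n. real (returns m) * real (loop_count (n - m)))"
proof (cases "n = 0")
  case True
  then show ?thesis by (simp add: loops_0 returns_def)
next
  case False
  then have n: "n \<ge> 1" by simp
  let ?I = "SIGMA m:{1..n}. loops (n - m)"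
  have fin: "finite ?I" using loops_finite by (intro finite_SigmaI) auto
  have ret: "finite (first_returns m w)" "card (first_returns m w) = returns m"
    if "(m, w) \<in> ?I" for m w
    using return_card[of w m] loops_generic[of w "n - m"] that unfolding loops_def by auto
  have "loop_count n = (\<Sum>(m, w)\<in>?I. card (first_returns m w))"
  proof -
    have "card (\<Union>p\<in>?I. case p of (m, w) \<Rightarrow> first_returns m w)
        = (\<Sum>p\<in>?I. card (case p of (m, w) \<Rightarrow> first_returns m w))"
    proof (rule card_UN_disjoint[OF fin])
      show "\<forall>p\<in>?I. finite (case p of (m, w) \<Rightarrow> first_returns m w)" using ret by auto
      show "\<forall>p\<in>?I. \<forall>q\<in>?I. p \<noteq> q \<longrightarrow> (case p of (m, w) \<Rightarrow> first_returns m w) \<inter>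
          (case q of (m, w) \<Rightarrow> first_returns m w) = {}"
      proof (intro ballI impI, rule ccontr)
        fix p q assume pq: "p \<in> ?I" "q \<in> ?I" "p \<noteq> q"
          "(case p of (m, w) \<Rightarrow> first_returns m w) \<inter>
          (case q of (m, w) \<Rightarrow> first_returns m w) \<noteq> {}"
        obtain m w m' w' where p: "p = (m, w)" and q: "q = (m', w')" by (cases p, cases q) auto
        obtain x where "x \<in> first_returns m w" "x \<in> first_returns m' w'"
          using pq(4) p q by auto
        moreover have "w \<in> j" "w' \<in> j" "1 \<le> m" "1 \<le> m'" using pq(1,2) p q unfolding loops_def by auto
        ultimately show False using return_preimages_disjoint pq(3) p q by blast
      qed
    qed
    then show ?thesis unfolding loops_renewal[OF n] by (simp add: case_prod_unfold)
  qed
  also have "\<dots> = (\<Sum>(m, w)\<in>?I. returns m)" using ret(2) by (intro sum.cong) auto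
  also have "\<dots> = (\<Sum>m\<in>{1..n}. returns m * loop_count (n - m))"
    using loops_finite by (subst sum.Sigma[symmetric]) (auto simp: mult.commute)
  finally have "real (loop_count n) = (\<Sum>m\<in>{1..n}. real (returns m) * real (loop_count (n - m)))"
    by simp
  also have "\<dots> = (\<Sum>m\<le>n. real (returns m) * real (loop_count (n - m)))"
    by (intro sum.mono_neutral_left) (auto simp: returns_def)
  finally show ?thesis using False by simp
qed

lemma hits_sub:
  assumes "A \<subseteq> {0..1}"
  shows "{x\<in>A. (T ^^ n) x = y} \<subseteq> (\<Union>(m, w)\<in>(SIGMA m:{..n}. loops (n - m)). first_entrances m w \<inter> A)"
proof
  fix x assume "x \<in> {x\<in>A. (T ^^ n) x = y}"
  then have x: "x \<in> A" "x \<in> {0..1}" "(T ^^ n) x = y" using assms by auto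
  obtain m where "m \<le> n" "(T ^^ m) x \<in> loops (n - m)" "x \<in> first_entrances m ((T ^^ m) x)"
    by (rule first_entrance[OF x(2,3)])
  then show "x \<in> (\<Union>(m, w)\<in>(SIGMA m:{..n}. loops (n - m)). first_entrances m w \<inter> A)"
    using x(1) by auto
qed

text \<open>An orbit from \<open>A\<close> to \<open>y\<close> is a first entrance at some
  \<open>w\<close> followed by a loop from \<open>w\<close>. The bound \<open>u\<close> may be
  smaller than \<open>entrances\<close>; for tightness it vanishes at small orders.\<close>

lemma hits_bound:
  assumes A: "A \<subseteq> {0..1}"
    and u: "\<And>m w. generic w \<Longrightarrow> w \<in> j \<Longrightarrow> card (first_entrances m w \<inter> A) \<le> u m"
  shows "finite {x\<in>A. (T ^^ n) x = y}" "hits A n \<le> (\<Sum>m\<le>n. u m * loop_count (n - m))"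
proof -
  let ?I = "SIGMA m:{..n}. loops (n - m)"
  have fin: "finite ?I" using loops_finite by (intro finite_SigmaI) auto
  have gen: "generic w \<and> w \<in> j" if "(m, w) \<in> ?I" for m w
    using loops_generic[of w "n - m"] that unfolding loops_def by auto
  have fin2: "finite (\<Union>(m, w)\<in>?I. first_entrances m w \<inter> A)"
    using fin gen entrance_card(1) by (intro finite_UN_I) auto
  then show "finite {x\<in>A. (T ^^ n) x = y}" using hits_sub[OF A] finite_subset by blast
  have "hits A n \<le> card (\<Union>(m, w)\<in>?I. first_entrances m w \<inter> A)"
    unfolding hits_def by (rule card_mono[OF fin2 hits_sub[OF A]])
  also have "\<dots> \<le> (\<Sum>p\<in>?I. card (case p of (m, w) \<Rightarrow> first_entrances m w \<inter> A))"
    by (rule card_UN_le[OF fin])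
  also have "\<dots> \<le> (\<Sum>(m, w)\<in>?I. u m)" using u gen by (intro sum_mono) auto
  also have "\<dots> = (\<Sum>m\<le>n. u m * loop_count (n - m))"
    using loops_finite by (subst sum.Sigma[symmetric]) (auto simp: mult.commute)
  finally show "hits A n \<le> (\<Sum>m\<le>n. u m * loop_count (n - m))" .
qed

lemma hits_finite: "A \<subseteq> {0..1} \<Longrightarrow> finite {x\<in>A. (T ^^ n) x = y}"
  using hits_bound(1)[of A entrances] entrance_card
  by (metis Int_lower1 card_mono)

section \<open>Generating functions\<close>

text \<open>Half of the radius \<open>1 / B\<close> guaranteed by \<open>entrance_le\<close>. The
  remaining room gives summability at \<open>r0\<close> itself and continuity of the return series
  there.\<close>

definition r0 :: real where "r0 = 1 / (2 * B)"

lemma r0: "0 < r0" "r0 \<le> 1/2" "r0 * B = 1/2"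
  using B by (auto simp: r0_def field_simps)

lemma C_nonneg: "0 \<le> C"
  using entrance_le[of 0] by (metis mult.right_neutral of_nat_0_le_iff order_trans power_0)

lemma entrances_summable:
  assumes "0 \<le> z" "z \<le> r0"
  shows "summable (\<lambda>n. real (entrances n) * z ^ n)"
proof (rule summable_comparison_test')
  show "summable (\<lambda>n. C * (1/2) ^ n)" by (intro summable_mult summable_geometric) simp
  fix n :: nat
  have "real (entrances n) * z ^ n \<le> (C * B ^ n) * r0 ^ n"
    using entrance_le[of n] assms C_nonneg B unfolding entrances_def by (intro mult_mono power_mono) auto
  also have "\<dots> = C * (r0 * B) ^ n" by (simp add: power_mult_distrib)
  finally show "norm (real (entrances n) * z ^ n) \<le> C * (1/2) ^ n" using assms r0(3) by simp
qed

definition ret_gf :: "real \<Rightarrow> real" where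
  "ret_gf z = (\<Sum>n. real (returns n) * z ^ n)"

text \<open>The point \<open>3 / (4 * B)\<close> is strictly between \<open>r0\<close> and
  \<open>1 / B\<close>, so the closed interval up to \<open>r0\<close> is interior to the disc of
  convergence.\<close>

lemma returns_summable_ext: "summable (\<lambda>n. real (returns n) * (3 / (4 * B)) ^ n)"
proof (rule summable_comparison_test')
  let ?c = "real (card D) * C / B"
  show "summable (\<lambda>n. ?c * (3/4) ^ n)" by (intro summable_mult summable_geometric) simp
  fix n :: nat
  show "norm (real (returns n) * (3 / (4 * B)) ^ n) \<le> ?c * (3/4) ^ n"
  proof (cases n)
    case 0
    then show ?thesis using C_nonneg B by (simp add: returns_def)
  next
    case (Suc m)
    have "real (returns n) \<le> real (card D * entrances m)"
      using return_preimages_Suc(2)[of m] unfolding returns_def Suc by (simp del: of_nat_mult)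
    also have "\<dots> \<le> real (card D) * (C * B ^ m)"
      using entrance_le[of m] by (simp add: entrances_def mult_left_mono)
    also have "\<dots> = ?c * B ^ n" using B by (simp add: Suc)
    finally have "real (returns n) * (3 / (4 * B)) ^ n \<le> (?c * B ^ n) * (3 / (4 * B)) ^ n"
      using B by (intro mult_right_mono) auto
    also have "\<dots> = ?c * (B * (3 / (4 * B))) ^ n" by (simp only: power_mult_distrib mult.assoc)
    also have "B * (3 / (4 * B)) = 3/4" using B by simp
    finally show ?thesis using B by (simp add: abs_of_nonneg)
  qed
qed

lemma r0_less: "r0 < 3 / (4 * B)"
  using B by (simp add: r0_def field_simps)

lemma returns_summable:
  assumes "0 \<le> z" "z \<le> r0"
  shows "summable (\<lambda>n. real (returns n) * z ^ n)"
  using assms r0_less B by (intro powser_inside[OF returns_summable_ext]) auto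

lemma ret_gf_isCont:
  assumes "0 \<le> z" "z \<le> r0"
  shows "isCont ret_gf z"
  unfolding ret_gf_def using assms r0_less B by (intro isCont_powser[OF returns_summable_ext]) auto

text \<open>At \<open>r0\<close> the term of order \<open>N\<close> alone is at least
  \<open>(2 * B) ^ N * r0 ^ N = 1\<close>, so the intermediate value theorem applies between 0 and
  \<open>r0\<close>.\<close>

lemma ex_radius: "\<exists>r. 0 < r \<and> r \<le> r0 \<and> ret_gf r = 1"
proof -
  have z: "ret_gf 0 = 0" unfolding ret_gf_def powser_zero by (simp only: returns_def) simp
  have "(2 * B) * r0 = 1" using B by (simp add: r0_def)
  then have "1 = (2 * B) ^ N * r0 ^ N" by (metis power_mult_distrib power_one)
  also have "\<dots> \<le> real (returns N) * r0 ^ N"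
    using returns_N r0(1) by (intro mult_right_mono) auto
  also have "\<dots> \<le> ret_gf r0"
    unfolding ret_gf_def using sum_le_suminf[OF returns_summable[of r0], of "{N}"] r0(1) by simp
  finally have "\<exists>r\<ge>0. r \<le> r0 \<and> ret_gf r = 1"
    using z r0(1) ret_gf_isCont by (intro IVT) auto
  then show ?thesis using z by (metis less_eq_real_def zero_neq_one)
qed

definition R :: real where "R = (SOME r. 0 < r \<and> r \<le> r0 \<and> ret_gf r = 1)"

lemma R: "0 < R" "R \<le> r0" "ret_gf R = 1" "R \<le> 1/2"
  using someI_ex[OF ex_radius] r0(2) unfolding R_def by auto

lemma ret_gf_less_1:
  assumes "0 \<le> z" "z < R"
  shows "ret_gf z < 1"
proof -
  have s: "summable (\<lambda>n. real (returns n) * z ^ n)" "summable (\<lambda>n. real (returns n) * R ^ n)"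
    using assms R by (auto intro!: returns_summable)
  have "0 < (\<Sum>n. real (returns n) * R ^ n - real (returns n) * z ^ n)"
  proof (rule suminf_pos2[where i = N])
    show "summable (\<lambda>n. real (returns n) * R ^ n - real (returns n) * z ^ n)" using s by (intro summable_diff)
    show "0 \<le> real (returns n) * R ^ n - real (returns n) * z ^ n" for n
      using assms by (simp add: mult_left_mono power_mono)
    have "0 < (2 * B) ^ N" using B by simp
    then have "0 < real (returns N)" using returns_N by linarith
    moreover have "z ^ N < R ^ N" using assms N by (intro power_strict_mono) auto
    ultimately show "0 < real (returns N) * R ^ N - real (returns N) * z ^ N" by simp
  qed
  also have "\<dots> = ret_gf R - ret_gf z" unfolding ret_gf_def using s by (simp add: suminf_diff)
  finally show ?thesis using R(3) by simp
qed

section \<open>The loop series and its divergence at the root\<close>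

definition loop_gf :: "real \<Rightarrow> real" where
  "loop_gf z = (\<Sum>n. real (loop_count n) * z ^ n)"

lemma convolution_power:
  fixes u v :: "nat \<Rightarrow> real"
  shows "(\<Sum>i\<le>n. u i * v (n - i)) * z ^ n = (\<Sum>i\<le>n. (u i * z ^ i) * (v (n - i) * z ^ (n - i)))"
  unfolding sum_distrib_right
proof (rule sum.cong)
  fix i assume "i \<in> {..n}"
  then have "z ^ n = z ^ i * z ^ (n - i)" by (simp add: power_add[symmetric])
  then show "u i * v (n - i) * z ^ n = u i * z ^ i * (v (n - i) * z ^ (n - i))" by simp
qed simp

lemma loop_count_renewal_power:
  "real (loop_count n) * z ^ n = (if n = 0 then 1 else 0)
    + (\<Sum>i\<le>n. (real (returns i) * z ^ i) * (real (loop_count (n - i)) * z ^ (n - i)))"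
proof -
  have "real (loop_count n) * z ^ n = (if n = 0 then 1 else 0) * z ^ n
      + (\<Sum>i\<le>n. real (returns i) * real (loop_count (n - i))) * z ^ n"
    using arg_cong[OF loop_count_renewal[of n], of "\<lambda>t. t * z ^ n"] by (simp only: distrib_right)
  moreover have "(if n = 0 then 1 else 0) * z ^ n = (if n = 0 then 1 else 0)" by simp
  ultimately show ?thesis
    by (simp only: convolution_power[of "\<lambda>i. real (returns i)" "\<lambda>k. real (loop_count k)"])
qed

text \<open>The product formula presupposes convergence, so partial sums are used: the renewal
  equation bounds a partial sum \<open>s\<close> by \<open>1 + ret_gf z * s\<close>, hence by
  \<open>1 / (1 - ret_gf z)\<close>.\<close>

lemma loops_summable:
  assumes z: "0 \<le> z" "z < R"
  shows "summable (\<lambda>n. real (loop_count n) * z ^ n)"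
proof (rule bounded_imp_summable)
  let ?a = "\<lambda>n. real (loop_count n) * z ^ n" and ?f = "\<lambda>n. real (returns n) * z ^ n"
  show "0 \<le> ?a n" for n using z by simp
  fix M
  have f: "summable ?f" using z R by (intro returns_summable) auto
  have "(\<Sum>n\<le>M. ?a n) = (\<Sum>n\<le>M. (if n = 0 then 1 else 0) + (\<Sum>i\<le>n. ?f i * ?a (n - i)))"
    by (rule sum.cong[OF refl loop_count_renewal_power])
  also have "\<dots> = 1 + (\<Sum>n\<le>M. \<Sum>i\<le>n. ?f i * ?a (n - i))"
    by (simp add: sum.distrib)
  also have "\<dots> \<le> 1 + (\<Sum>n\<le>M. ?f n) * (\<Sum>n\<le>M. ?a n)"
    using sum_convolution_le[of ?f ?a M] z by simp
  also have "\<dots> \<le> 1 + ret_gf z * (\<Sum>n\<le>M. ?a n)"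
    using sum_le_suminf[OF f, of "{..M}"] z
    by (intro add_left_mono mult_right_mono sum_nonneg) (auto simp: ret_gf_def)
  finally have "(1 - ret_gf z) * (\<Sum>n\<le>M. ?a n) \<le> 1" by (simp add: algebra_simps)
  then show "(\<Sum>n\<le>M. ?a n) \<le> 1 / (1 - ret_gf z)"
    using ret_gf_less_1[OF z] by (simp add: field_simps)
qed

lemma loop_gf_eq:
  assumes z: "0 \<le> z" "z < R"
  shows "loop_gf z = 1 / (1 - ret_gf z)"
proof -
  let ?a = "\<lambda>n. real (loop_count n) * z ^ n" and ?f = "\<lambda>n. real (returns n) * z ^ n"
  have "(\<lambda>n. \<Sum>i\<le>n. ?f i * ?a (n - i)) sums (suminf ?f * suminf ?a)"
    using z loops_summable[OF z] returns_summable[of z] R by (intro Cauchy_product_sums) auto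
  moreover have "(\<lambda>n. if n = 0 then 1 else 0::real) sums 1"
    using sums_single[of 0 "\<lambda>_. 1::real"] by (simp add: if_distrib cong: if_cong)
  ultimately have "(\<lambda>n. (if n = 0 then 1 else 0) + (\<Sum>i\<le>n. ?f i * ?a (n - i))) sums (1 + suminf ?f * suminf ?a)"
    by (intro sums_add)
  then have "?a sums (1 + suminf ?f * suminf ?a)"
    by (simp only: loop_count_renewal_power[of _ z, symmetric])
  then have "loop_gf z = 1 + ret_gf z * loop_gf z"
    unfolding loop_gf_def ret_gf_def by (rule sums_unique[symmetric])
  then show ?thesis using ret_gf_less_1[OF z] by (simp add: field_simps)
qed

lemma eventually_below_R: "\<forall>\<^sub>F z in at_left R. 0 < z \<and> z < R"
  using eventually_at_left_field R(1) by blast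

lemma loop_gf_at_top: "filterlim loop_gf at_top (at_left R)"
proof -
  have "(ret_gf \<longlongrightarrow> 1) (at_left R)"
    using ret_gf_isCont[of R] R unfolding isCont_def by (metis at_le order.refl order.strict_implies_order subset_UNIV tendsto_mono)
  then have "((\<lambda>z. 1 - ret_gf z) \<longlongrightarrow> 1 - 1) (at_left R)" by (intro tendsto_intros)
  moreover have "\<forall>\<^sub>F z in at_left R. 0 < 1 - ret_gf z"
    using eventually_below_R ret_gf_less_1 by (auto elim!: eventually_mono)
  ultimately have "filterlim (\<lambda>z. inverse (1 - ret_gf z)) at_top (at_left R)"
    by (intro filterlim_inverse_at_top) auto
  moreover have "\<forall>\<^sub>F z in at_left R. inverse (1 - ret_gf z) = loop_gf z"
    using eventually_below_R loop_gf_eq by (auto elim!: eventually_mono simp: divide_inverse)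
  ultimately show ?thesis by (rule filterlim_cong[OF refl refl, THEN iffD1, rotated])
qed

section \<open>Weighted preimage counts of sets: tightness and transformation under the map\<close>

definition hit_gf :: "real set \<Rightarrow> real \<Rightarrow> real" where
  "hit_gf A z = (\<Sum>n. real (hits A n) * z ^ n)"

lemma hit_gf_bound:
  assumes z: "0 \<le> z" "z < R"
    and h: "\<And>n. hits A n \<le> (\<Sum>m\<le>n. u m * loop_count (n - m))"
    and u: "summable (\<lambda>n. real (u n) * z ^ n)"
  shows "summable (\<lambda>n. real (hits A n) * z ^ n)"
    "hit_gf A z \<le> (\<Sum>n. real (u n) * z ^ n) * loop_gf z"
proof -
  let ?a = "\<lambda>n. real (loop_count n) * z ^ n" and ?u = "\<lambda>n. real (u n) * z ^ n"
  have s: "(\<lambda>n. \<Sum>i\<le>n. ?u i * ?a (n - i)) sums (suminf ?u * suminf ?a)"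
    using z loops_summable[OF z] u by (intro Cauchy_product_sums) auto
  have le: "real (hits A n) * z ^ n \<le> (\<Sum>i\<le>n. ?u i * ?a (n - i))" for n
  proof -
    have "real (hits A n) \<le> (\<Sum>m\<le>n. real (u m) * real (loop_count (n - m)))"
      using of_nat_mono[OF h[of n], where 'a=real] by simp
    then have "real (hits A n) * z ^ n \<le> (\<Sum>m\<le>n. real (u m) * real (loop_count (n - m))) * z ^ n"
      using z by (intro mult_right_mono) auto
    then show ?thesis
      by (simp only: convolution_power[of "\<lambda>i. real (u i)" "\<lambda>k. real (loop_count k)"])
  qed
  show *: "summable (\<lambda>n. real (hits A n) * z ^ n)"
    using le z by (intro summable_comparison_test'[OF sums_summable[OF s]]) auto
  show "hit_gf A z \<le> suminf ?u * loop_gf z"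
    unfolding hit_gf_def loop_gf_def sums_unique[OF s]
    using le * sums_summable[OF s] by (intro suminf_le) auto
qed

lemma hits_summable:
  assumes "A \<subseteq> {0..1}" "0 \<le> z" "z < R"
  shows "summable (\<lambda>n. real (hits A n) * z ^ n)"
proof (rule hit_gf_bound(1)[OF assms(2,3), of A entrances])
  show "hits A n \<le> (\<Sum>m\<le>n. entrances m * loop_count (n - m))" for n
    using entrance_card by (intro hits_bound(2)[OF assms(1)]) (metis Int_lower1 card_mono)
  show "summable (\<lambda>n. real (entrances n) * z ^ n)" using assms R by (intro entrances_summable) auto
qed

lemma loop_gf_le_hit_gf:
  assumes "0 \<le> z" "z < R"
  shows "loop_gf z \<le> hit_gf {0..1} z"
  unfolding loop_gf_def hit_gf_def
proof (rule suminf_le)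
  show "real (loop_count n) * z ^ n \<le> real (hits {0..1} n) * z ^ n" for n
    using assms hits_finite[of "{0..1}" n] j_sub unfolding loops_def hits_def
    by (intro mult_right_mono of_nat_mono card_mono) auto
qed (use loops_summable hits_summable assms in auto)

text \<open>Tightness: the mass of the normalised preimage measures does not escape to the points where
  the laps accumulate.\<close>

lemma hit_gf_tight:
  assumes "\<epsilon> > 0"
  shows "\<exists>F. finite F \<and> F \<subseteq> L \<and> (\<forall>A z. A \<subseteq> {0..1} \<longrightarrow> A \<inter> \<Union>F = {} \<longrightarrow> 0 \<le> z \<longrightarrow> z < R \<longrightarrow>
    hit_gf A z \<le> \<epsilon> * loop_gf z)"
proof -
  let ?e = "\<lambda>n. real (entrances n) * r0 ^ n"
  have e: "summable ?e" using r0 by (intro entrances_summable) auto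
  obtain M where M: "norm (\<Sum>i. ?e (i + M)) < \<epsilon>" using suminf_exist_split[OF assms e] by blast
  have "\<exists>F. finite F \<and> F \<subseteq> L \<and> (\<forall>w. generic w \<longrightarrow> w \<in> j \<longrightarrow> first_entrances m w \<subseteq> \<Union>F)" for m
  proof (cases "m = 0")
    \<comment> \<open>An entrance of order 0 is the base point itself, which lies in
      \<open>j\<close>.\<close>
    case True
    then show ?thesis using D by (intro exI[of _ D]) (auto simp: preimages_def)
  next
    case False
    then show ?thesis using preimages_finite_cover[OF j y entrance_finite, of m] by (metis One_nat_def Suc_leI not_gr_zero)
  qed
  then obtain F where F: "\<And>m. finite (F m)" "\<And>m. F m \<subseteq> L"
    "\<And>m w. generic w \<Longrightarrow> w \<in> j \<Longrightarrow> first_entrances m w \<subseteq> \<Union>(F m)" by metis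
  define G where "G = (\<Union>m<M. F m)"
  show ?thesis
  proof (intro exI[of _ G] conjI allI impI)
    show "finite G" "G \<subseteq> L" unfolding G_def using F by auto
    fix A z assume A: "A \<subseteq> {0..1}" "A \<inter> \<Union>G = {}" and z: "0 \<le> z" "z < R"
    \<comment> \<open>All first entrances of order below \<open>M\<close> start in \<open>G\<close>,
      so \<open>A\<close> sees only the tail of the entrance series. The tail at \<open>r0\<close>
      dominates the tails at all \<open>z < R\<close>, which makes the estimate uniform.\<close>
    define u where "u m = (if m < M then 0 else entrances m)" for m
    have h: "card (first_entrances m w \<inter> A) \<le> u m" if "generic w" "w \<in> j" for m w
    proof (cases "m < M")
      case True
      then have "first_entrances m w \<inter> A = {}" using F(3)[OF that, of m] A(2) unfolding G_def by blast
      then show ?thesis by simp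
    next
      case False
      then show ?thesis using entrance_card[OF that, of m] by (metis Int_lower1 card_mono u_def)
    qed
    have us: "summable (\<lambda>n. real (u n) * r ^ n)" if "0 \<le> r" "r \<le> r0" for r
      using that by (intro summable_comparison_test'[OF entrances_summable[OF that]]) (auto simp: u_def)
    have zr: "z \<le> r0" using z R by simp
    have "hit_gf A z \<le> (\<Sum>n. real (u n) * z ^ n) * loop_gf z"
      using hit_gf_bound(2)[OF z hits_bound(2)[OF A(1) h] us[OF z(1) zr]] .
    also have "\<dots> \<le> \<epsilon> * loop_gf z"
    proof (rule mult_right_mono)
      have "(\<Sum>n. real (u n) * z ^ n) \<le> (\<Sum>n. real (u n) * r0 ^ n)"
        using us z zr r0 by (intro suminf_le mult_left_mono power_mono) auto
      also have "\<dots> = (\<Sum>n. real (u (n + M)) * r0 ^ (n + M)) + (\<Sum>n<M. real (u n) * r0 ^ n)"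
        using r0 by (intro suminf_split_initial_segment us) auto
      also have "\<dots> = (\<Sum>i. ?e (i + M))" by (simp add: u_def)
      also have "\<dots> \<le> \<epsilon>" using M by simp
      finally show "(\<Sum>n. real (u n) * z ^ n) \<le> \<epsilon>" .
      show "0 \<le> loop_gf z" unfolding loop_gf_def using z loops_summable[OF z] by (intro suminf_nonneg) auto
    qed
    finally show "hit_gf A z \<le> \<epsilon> * loop_gf z" .
  qed
qed

lemma hit_gf_mono:
  assumes "A \<subseteq> A'" "A' \<subseteq> {0..1}" "0 \<le> z" "z < R"
  shows "hit_gf A z \<le> hit_gf A' z"
  unfolding hit_gf_def
proof (rule suminf_le)
  show "real (hits A n) * z ^ n \<le> real (hits A' n) * z ^ n" for n
    using assms hits_finite[of A' n] unfolding hits_def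
    by (intro mult_right_mono of_nat_mono card_mono) auto
qed (use assms hits_summable in auto)

lemma hit_gf_Un:
  assumes "A \<subseteq> {0..1}" "A' \<subseteq> {0..1}" "A \<inter> A' = {}" "0 \<le> z" "z < R"
  shows "hit_gf (A \<union> A') z = hit_gf A z + hit_gf A' z"
proof -
  have "hits (A \<union> A') n = hits A n + hits A' n" for n
  proof -
    have "{x\<in>A \<union> A'. (T ^^ n) x = y} = {x\<in>A. (T ^^ n) x = y} \<union> {x\<in>A'. (T ^^ n) x = y}" by auto
    then show ?thesis unfolding hits_def using assms(3) hits_finite assms(1,2)
      by (simp only:) (rule card_Un_disjoint, auto)
  qed
  then show ?thesis unfolding hit_gf_def
    using suminf_add[OF hits_summable[OF assms(1,4,5)] hits_summable[OF assms(2,4,5)]]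
    by (simp add: distrib_right)
qed

lemma hit_gf_nonneg:
  assumes "A \<subseteq> {0..1}" "0 \<le> z" "z < R"
  shows "0 \<le> hit_gf A z"
  unfolding hit_gf_def using assms hits_summable by (intro suminf_nonneg) auto

text \<open>A point contributes at most \<open>z ^ n\<close> at each order and
  \<open>z \<le> 1/2\<close>. Compared with the diverging total mass this is negligible, so boundary
  points of intervals do not matter in the limit.\<close>

lemma hit_gf_point:
  assumes "p \<in> {0..1}" "0 \<le> z" "z < R"
  shows "hit_gf {p} z \<le> 2"
proof -
  have z: "z \<le> 1/2" using assms R by simp
  have "hits {p} n \<le> card {p}" for n unfolding hits_def by (intro card_mono) auto
  then have 1: "real (hits {p} n) \<le> 1" for n by (metis card.empty card_insert_disjoint empty_iff finite.emptyI One_nat_def of_nat_1 of_nat_mono)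
  have "real (hits {p} n) * z ^ n \<le> 1 * (1/2) ^ n" for n
    using 1 z assms by (intro mult_mono power_mono) auto
  then have "hit_gf {p} z \<le> (\<Sum>n. (1/2) ^ n)"
    unfolding hit_gf_def using assms by (intro suminf_le hits_summable summable_geometric) auto
  also have "\<dots> = 2" by (subst suminf_geometric) auto
  finally show ?thesis .
qed

lemma hit_gf_image:
  assumes A: "A \<subseteq> {0..1}" and z: "0 \<le> z" "z < R"
  shows "z * hit_gf (T ` A) z \<le> hit_gf A z"
    and "inj_on T A \<Longrightarrow> hit_gf A z \<le> 1 + z * hit_gf (T ` A) z"
proof -
  have TA: "T ` A \<subseteq> {0..1}" using A T unfolding interval_map_def by blast
  have s: "summable (\<lambda>n. real (hits (T ` A) n) * z ^ n)" "summable (\<lambda>n. real (hits A n) * z ^ n)"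
    using hits_summable A TA z by auto
  have s': "summable (\<lambda>n. real (hits A (Suc n)) * z ^ Suc n)"
    using s(2) by (subst summable_Suc_iff)
  have split: "hit_gf A z = real (hits A 0) + (\<Sum>n. real (hits A (Suc n)) * z ^ Suc n)"
    unfolding hit_gf_def using suminf_split_head[OF s(2)] by simp
  have zG: "z * hit_gf (T ` A) z = (\<Sum>n. real (hits (T ` A) n) * z ^ Suc n)"
    unfolding hit_gf_def suminf_mult[OF s(1), symmetric] by (intro suminf_cong) simp
  have sz: "summable (\<lambda>n. real (hits (T ` A) n) * z ^ Suc n)"
    using summable_mult[OF s(1), of z] by (simp add: mult.left_commute)
  have sub: "{u\<in>T ` A. (T ^^ n) u = y} = T ` {x\<in>A. (T ^^ Suc n) x = y}" for n
    by (auto simp: funpow_swap1)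
  have fin: "finite {x\<in>A. (T ^^ Suc n) x = y}" for n using hits_finite[OF A] .
  have le: "hits (T ` A) n \<le> hits A (Suc n)" for n
    unfolding hits_def sub by (rule card_image_le[OF fin])
  have "z * hit_gf (T ` A) z \<le> (\<Sum>n. real (hits A (Suc n)) * z ^ Suc n)"
    unfolding zG using le z sz s' by (intro suminf_le mult_right_mono) auto
  then show "z * hit_gf (T ` A) z \<le> hit_gf A z" unfolding split by simp
  show "hit_gf A z \<le> 1 + z * hit_gf (T ` A) z" if inj: "inj_on T A"
  proof -
    have "hits (T ` A) n = hits A (Suc n)" for n
      unfolding hits_def sub by (intro card_image inj_on_subset[OF inj]) auto
    moreover have "hits A 0 \<le> card {y}" unfolding hits_def by (intro card_mono) auto
    ultimately show ?thesis unfolding split zG by simp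
  qed
qed

end

section \<open>The conformal distribution function\<close>

text \<open>By Tychonoff's theorem the family has a cluster point in the product of copies of
  \<open>{0..1}\<close>. Refining \<open>F\<close> by the preimages of neighbourhoods of this point
  gives convergence at all \<open>t\<close> simultaneously.\<close>

lemma pointwise_cluster_function:
  fixes f :: "'z \<Rightarrow> real \<Rightarrow> real"
  assumes F: "F \<noteq> bot" and f: "\<And>z t. f z t \<in> {0..1}"
  obtains \<Phi> H where "H \<le> F" "H \<noteq> bot" "\<And>t. ((\<lambda>z. f z t) \<longlongrightarrow> \<Phi> t) H"
proof -
  have "compactin (product_topology (\<lambda>_. euclidean) UNIV) (PiE UNIV (\<lambda>_::real. {0..1::real}))"
    by (subst compactin_PiE) simp
  then have "compact (PiE UNIV (\<lambda>_::real. {0..1::real}))"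
    by (simp only: euclidean_product_topology compactin_euclidean_iff)
  moreover have "eventually (\<lambda>g. g \<in> PiE UNIV (\<lambda>_::real. {0..1::real})) (filtermap f F)"
    unfolding eventually_filtermap using f by (intro always_eventually allI PiE_I) auto
  moreover have "filtermap f F \<noteq> bot" using F by (simp add: filtermap_bot_iff)
  ultimately obtain \<Phi> where \<Phi>: "inf (nhds \<Phi>) (filtermap f F) \<noteq> bot"
    unfolding compact_filter by blast
  define H where "H = inf F (filtercomap f (nhds \<Phi>))"
  have "H \<noteq> bot"
  proof
    assume "H = bot"
    then have "eventually (\<lambda>_. False) (inf F (filtercomap f (nhds \<Phi>)))" unfolding H_def by simp
    then obtain Q Q' where Q: "eventually Q F" "eventually Q' (filtercomap f (nhds \<Phi>))"
      "\<And>x. Q x \<Longrightarrow> Q' x \<Longrightarrow> False" unfolding eventually_inf by blast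
    then obtain W where W: "eventually W (nhds \<Phi>)" "\<And>x. W (f x) \<Longrightarrow> Q' x"
      unfolding eventually_filtercomap by blast
    have "eventually (\<lambda>g. \<not> W g) (filtermap f F)"
      unfolding eventually_filtermap using Q(1) by (rule eventually_mono) (use Q(3) W(2) in blast)
    then have "eventually (\<lambda>_. False) (inf (nhds \<Phi>) (filtermap f F))"
      using W(1) unfolding eventually_inf by (intro exI[of _ W] exI[of _ "\<lambda>g. \<not> W g"]) simp
    then show False using \<Phi> by (simp add: trivial_limit_def)
  qed
  moreover have "((\<lambda>z. f z t) \<longlongrightarrow> \<Phi> t) H" for t
  proof -
    have "filterlim f (nhds \<Phi>) H"
      unfolding H_def filterlim_iff_le_filtercomap by simp
    moreover have "filterlim (\<lambda>g. g t) (nhds (\<Phi> t)) (nhds \<Phi>)"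
    proof (rule topological_tendstoI)
      fix S assume S: "open S" "\<Phi> t \<in> S"
      have "open ((\<lambda>g. g t) -` S)"
        using S(1) continuous_on_product_coordinates by (rule open_vimage)
      then show "\<forall>\<^sub>F g in nhds \<Phi>. g t \<in> S"
        using S(2) by (intro eventually_nhds[THEN iffD2] exI[of _ "(\<lambda>g. g t) -` S"]) simp
    qed
    ultimately show ?thesis by (rule filterlim_compose[rotated])
  qed
  moreover have "H \<le> F" unfolding H_def by simp
  ultimately show thesis using that by blast
qed

lemma interval_inj_image_segment:
  fixes f :: "real \<Rightarrow> real"
  assumes "continuous_on {a..b} f" "inj_on f {a..b}" "a \<le> b"
  shows "f ` {a..b} \<subseteq> closed_segment (f a) (f b)"
proof
  fix v assume "v \<in> f ` {a..b}"
  then obtain x where x: "x \<in> {a..b}" "v = f x" by blast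
  have "strict_mono_on {a..b} f \<or> strict_antimono_on {a..b} f"
    using assms injective_eq_monotone_map[of "{a..b}" f] by simp
  then show "v \<in> closed_segment (f a) (f b)"
  proof
    assume "strict_mono_on {a..b} f"
    then have m: "f s < f t" if "s \<in> {a..b}" "t \<in> {a..b}" "s < t" for s t
      using that unfolding monotone_on_def by blast
    have "f a \<le> f x" using m[of a x] x(1) assms(3) by (cases "a = x") auto
    moreover have "f x \<le> f b" using m[of x b] x(1) assms(3) by (cases "b = x") auto
    ultimately show ?thesis using x(2) by (auto simp: closed_segment_eq_real_ivl)
  next
    assume "strict_antimono_on {a..b} f"
    then have m: "f t < f s" if "s \<in> {a..b}" "t \<in> {a..b}" "s < t" for s t
      using that unfolding monotone_on_def by blast
    have "f x \<le> f a" using m[of a x] x(1) assms(3) by (cases "a = x") auto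
    moreover have "f b \<le> f x" using m[of x b] x(1) assms(3) by (cases "b = x") auto
    ultimately show ?thesis using x(2) by (auto simp: closed_segment_eq_real_ivl)
  qed
qed

context renewal_system
begin

lemma hit_gf_unit_pos: "0 \<le> z \<Longrightarrow> z < R \<Longrightarrow> 0 < hit_gf {0..1} z"
  using loop_gf_le_hit_gf[of z] loop_gf_eq[of z] ret_gf_less_1[of z]
  by (smt (verit, best) divide_pos_pos)

definition cdf :: "real \<Rightarrow> real \<Rightarrow> real" where
  "cdf z t = hit_gf {0..t} z / hit_gf {0..1} z"

lemma cdf_diff:
  assumes "0 \<le> a" "a \<le> b" "b \<le> 1" "0 \<le> z" "z < R"
  shows "cdf z b - cdf z a = hit_gf {a<..b} z / hit_gf {0..1} z"
proof -
  have "{0..b} = {0..a} \<union> {a<..b}" using assms by auto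
  moreover have "{a<..b} \<subseteq> {0..1}" "{0..a} \<subseteq> {0..1}" "{0..a} \<inter> {a<..b} = {}" using assms by auto
  ultimately have "hit_gf {0..b} z = hit_gf {0..a} z + hit_gf {a<..b} z"
    using hit_gf_Un[of "{0..a}" "{a<..b}" z] assms(4,5) by simp
  then show ?thesis unfolding cdf_def by (simp add: diff_divide_distrib[symmetric])
qed

text \<open>Differences of \<open>cdf\<close> measure half-open intervals; the 2 bounds the mass of
  the missing endpoint.\<close>

lemma hit_gf_segment:
  assumes "a \<in> {0..1}" "b \<in> {0..1}" "0 \<le> z" "z < R"
  shows "hit_gf {0..1} z * \<bar>cdf z b - cdf z a\<bar> \<le> hit_gf (closed_segment a b) z"
    "hit_gf (closed_segment a b) z \<le> hit_gf {0..1} z * \<bar>cdf z b - cdf z a\<bar> + 2"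
proof -
  have *: "hit_gf {0..1} z * \<bar>cdf z b - cdf z a\<bar> \<le> hit_gf {a..b} z \<and>
    hit_gf {a..b} z \<le> hit_gf {0..1} z * \<bar>cdf z b - cdf z a\<bar> + 2" if "0 \<le> a" "a \<le> b" "b \<le> 1" for a b
  proof -
    have q: "0 < hit_gf {0..1} z" by (rule hit_gf_unit_pos[OF assms(3,4)])
    have n: "0 \<le> hit_gf {a<..b} z" using that assms by (intro hit_gf_nonneg) auto
    have "\<bar>cdf z b - cdf z a\<bar> = hit_gf {a<..b} z / hit_gf {0..1} z"
      using n q unfolding cdf_diff[OF that assms(3,4)] by simp
    then have eq: "hit_gf {0..1} z * \<bar>cdf z b - cdf z a\<bar> = hit_gf {a<..b} z" using q by simp
    have "{a..b} = {a} \<union> {a<..b}" using that by auto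
    moreover have "{a<..b} \<subseteq> {0..1}" "{a} \<subseteq> {0..1}" "{a} \<inter> {a<..b} = {}" using that by auto
    ultimately have "hit_gf {a..b} z = hit_gf {a} z + hit_gf {a<..b} z"
      using hit_gf_Un[of "{a}" "{a<..b}" z] assms(3,4) by simp
    moreover have "hit_gf {a} z \<le> 2" "0 \<le> hit_gf {a} z"
      using that assms by (auto intro!: hit_gf_point hit_gf_nonneg)
    ultimately show ?thesis using eq by linarith
  qed
  show "hit_gf {0..1} z * \<bar>cdf z b - cdf z a\<bar> \<le> hit_gf (closed_segment a b) z"
    using *[of a b] *[of b a] assms by (simp add: closed_segment_eq_real_ivl abs_minus_commute)
  show "hit_gf (closed_segment a b) z \<le> hit_gf {0..1} z * \<bar>cdf z b - cdf z a\<bar> + 2"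
    using *[of a b] *[of b a] assms by (simp add: closed_segment_eq_real_ivl abs_minus_commute)
qed

lemma continuous_on_T: "K \<subseteq> {0..1} \<Longrightarrow> continuous_on K T"
  using T unfolding interval_map_def by (meson continuous_on_subset)

lemma T_in: "x \<in> {0..1} \<Longrightarrow> T x \<in> {0..1}"
  by (rule interval_map_in[OF T])

text \<open>By connectedness the image of a segment contains the segment between the images of its
  ends, which gives the first estimate even across turning points. If \<open>T\<close> is injective
  on the segment, the two sets agree and the estimate reverses.\<close>

lemma cdf_image:
  assumes x: "x \<in> {0..1}" "x' \<in> {0..1}" and z: "0 \<le> z" "z < R"
  shows "z * \<bar>cdf z (T x) - cdf z (T x')\<bar> \<le> \<bar>cdf z x - cdf z x'\<bar> + 2 / hit_gf {0..1} z"
    and "inj_on T (closed_segment x x') \<Longrightarrow>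
      \<bar>cdf z x - cdf z x'\<bar> \<le> z * \<bar>cdf z (T x) - cdf z (T x')\<bar> + 2 / hit_gf {0..1} z"
proof -
  let ?q = "hit_gf {0..1} z" and ?S = "closed_segment x x'" and ?S' = "closed_segment (T x) (T x')"
  have q: "0 < ?q" by (rule hit_gf_unit_pos[OF z])
  have S: "?S \<subseteq> {0..1}" using x by (simp add: closed_segment_subset)
  have Tx: "T x \<in> {0..1}" "T x' \<in> {0..1}" using T_in x by auto
  have TS: "T ` ?S \<subseteq> {0..1}" using T_in S by blast
  have "connected (T ` ?S)" using continuous_on_T[OF S] by (intro connected_continuous_image) auto
  then have "is_interval (T ` ?S)" by (simp add: is_interval_connected_1)
  then have sub: "?S' \<subseteq> T ` ?S"
    by (simp add: closed_segment_subset is_interval_convex)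
  have "?q * (z * \<bar>cdf z (T x) - cdf z (T x')\<bar>) = z * (?q * \<bar>cdf z (T x') - cdf z (T x)\<bar>)"
    by (simp add: abs_minus_commute)
  also have "\<dots> \<le> z * hit_gf ?S' z"
    using hit_gf_segment(1)[OF Tx z] z by (intro mult_left_mono) auto
  also have "\<dots> \<le> z * hit_gf (T ` ?S) z"
    using hit_gf_mono[OF sub TS z] z by (intro mult_left_mono) auto
  also have "\<dots> \<le> hit_gf ?S z" by (rule hit_gf_image(1)[OF S z])
  also have "\<dots> \<le> ?q * \<bar>cdf z x - cdf z x'\<bar> + 2"
    using hit_gf_segment(2)[OF x z] by (simp add: abs_minus_commute)
  also have "\<dots> = ?q * (\<bar>cdf z x - cdf z x'\<bar> + 2 / ?q)" using q by (simp add: distrib_left)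
  finally show "z * \<bar>cdf z (T x) - cdf z (T x')\<bar> \<le> \<bar>cdf z x - cdf z x'\<bar> + 2 / ?q"
    using q by (simp only: mult_le_cancel_left_pos)
  show "\<bar>cdf z x - cdf z x'\<bar> \<le> z * \<bar>cdf z (T x) - cdf z (T x')\<bar> + 2 / ?q" if inj: "inj_on T ?S"
  proof -
    have sup: "T ` ?S \<subseteq> ?S'"
    proof (cases "x \<le> x'")
      case True
      then have eq: "?S = {x..x'}" by (simp add: closed_segment_eq_real_ivl)
      show ?thesis
        using interval_inj_image_segment[of x x' T] continuous_on_T[OF S] inj True unfolding eq by blast
    next
      case False
      then have eq: "?S = {x'..x}" by (simp add: closed_segment_eq_real_ivl)
      show ?thesis
        using interval_inj_image_segment[of x' x T] continuous_on_T[OF S] inj False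
        unfolding eq closed_segment_commute[of "T x"] by simp
    qed
    have S'1: "?S' \<subseteq> {0..1}" using Tx by (simp add: closed_segment_subset)
    have "?q * \<bar>cdf z x - cdf z x'\<bar> \<le> hit_gf ?S z"
      using hit_gf_segment(1)[OF x z] by (simp add: abs_minus_commute)
    also have "\<dots> \<le> 1 + z * hit_gf (T ` ?S) z" by (rule hit_gf_image(2)[OF S z inj])
    also have "\<dots> \<le> 1 + z * hit_gf ?S' z"
      using hit_gf_mono[OF sup S'1 z] z by (intro add_left_mono mult_left_mono) auto
    also have "\<dots> \<le> 1 + z * (?q * \<bar>cdf z (T x) - cdf z (T x')\<bar> + 2)"
      using hit_gf_segment(2)[OF Tx z] z
      by (intro add_left_mono mult_left_mono) (auto simp: abs_minus_commute)
    \<comment> \<open>Both errors together are \<open>1 + 2 * z\<close>, at most 2 because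
      \<open>z < R \<le> 1/2\<close>.\<close>
    also have "\<dots> \<le> ?q * (z * \<bar>cdf z (T x) - cdf z (T x')\<bar>) + 2"
      using z R by (simp add: distrib_left mult.left_commute)
    also have "\<dots> = ?q * (z * \<bar>cdf z (T x) - cdf z (T x')\<bar> + 2 / ?q)" using q by (simp add: distrib_left)
    finally show ?thesis using q by (simp only: mult_le_cancel_left_pos)
  qed
qed

text \<open>All estimates for \<open>cdf\<close> carry an error \<open>2 / hit_gf {0..1} z\<close>.
  It vanishes in the limit since the total mass dominates the diverging loop series. The inequality
  valid without injectivity later yields the Lipschitz bound for the entropy.\<close>

lemma conformal_distribution:
  obtains \<Phi> where "mono_on {0..1} \<Phi>" "\<Phi> 0 = 0" "\<Phi> 1 = (1::real)"
    "\<And>x x'. x \<in> {0..1} \<Longrightarrow> x' \<in> {0..1} \<Longrightarrow> R * \<bar>\<Phi> (T x) - \<Phi> (T x')\<bar> \<le> \<bar>\<Phi> x - \<Phi> x'\<bar>"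
    "\<And>x x'. x \<in> {0..1} \<Longrightarrow> x' \<in> {0..1} \<Longrightarrow> inj_on T (closed_segment x x') \<Longrightarrow>
      \<bar>\<Phi> x - \<Phi> x'\<bar> = R * \<bar>\<Phi> (T x) - \<Phi> (T x')\<bar>"
    "\<And>\<epsilon>. \<epsilon> > 0 \<Longrightarrow> \<exists>F. finite F \<and> F \<subseteq> L \<and>
      (\<forall>a b. 0 \<le> a \<longrightarrow> a \<le> b \<longrightarrow> b \<le> 1 \<longrightarrow> {a<..<b} \<inter> \<Union>F = {} \<longrightarrow> \<Phi> b - \<Phi> a \<le> \<epsilon>)"
proof -
  let ?q = "hit_gf {0..1}"
  have cdf01: "cdf z t \<in> {0..1}" if "0 < z" "z < R" "t \<in> {0..1}" for z t
  proof -
    have "0 < ?q z" using that by (intro hit_gf_unit_pos) auto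
    moreover have "0 \<le> hit_gf {0..t} z" using that by (intro hit_gf_nonneg) auto
    moreover have "hit_gf {0..t} z \<le> ?q z" using that by (intro hit_gf_mono) auto
    ultimately show ?thesis unfolding cdf_def by simp
  qed
  \<comment> \<open>The value 0 outside the meaningful range keeps \<open>f\<close> in
    \<open>{0..1}\<close> everywhere, as the compactness argument requires.\<close>
  define f where "f z t = (if 0 < z \<and> z < R \<and> t \<in> {0..1} then cdf z t else 0)" for z t
  have "f z t \<in> {0..1}" for z t unfolding f_def using cdf01 by auto
  moreover have "at_left R \<noteq> bot" by simp
  ultimately obtain \<Phi> H where H: "H \<le> at_left R" "H \<noteq> bot" "\<And>t. ((\<lambda>z. f z t) \<longlongrightarrow> \<Phi> t) H"
    using pointwise_cluster_function[of "at_left R" f] by blast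
  have ev: "\<forall>\<^sub>F z in H. 0 < z \<and> z < R" using eventually_below_R H(1) by (rule filter_leD[rotated])
  have lim: "((\<lambda>z. cdf z t) \<longlongrightarrow> \<Phi> t) H" if "t \<in> {0..1}" for t
    using H(3)[of t] by (rule Lim_transform_eventually) (use ev that in \<open>auto elim!: eventually_mono simp: f_def\<close>)
  have zR: "((\<lambda>z. z) \<longlongrightarrow> R) H" by (rule tendsto_mono[OF H(1) tendsto_ident_at])
  have "filterlim ?q at_top (at_left R)"
    using loop_gf_at_top by (rule filterlim_at_top_mono)
      (use eventually_below_R loop_gf_le_hit_gf in \<open>auto elim!: eventually_mono\<close>)
  then have "((\<lambda>z. 2 / ?q z) \<longlongrightarrow> 0) (at_left R)"
    by (intro tendsto_divide_0[OF tendsto_const] filterlim_at_top_imp_at_infinity)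
  then have q0: "((\<lambda>z. 2 / ?q z) \<longlongrightarrow> 0) H" using H(1) by (rule tendsto_mono[rotated])
  show thesis
  proof (rule that)
    show "mono_on {0..1} \<Phi>"
    proof (rule mono_onI)
      fix s t :: real assume st: "s \<in> {0..1}" "t \<in> {0..1}" "s \<le> t"
      have "\<forall>\<^sub>F z in H. cdf z s \<le> cdf z t"
        using ev
      proof eventually_elim
        case (elim z)
        then have "hit_gf {0..s} z \<le> hit_gf {0..t} z" using st by (intro hit_gf_mono) auto
        then show ?case unfolding cdf_def using hit_gf_unit_pos[of z] elim by (intro divide_right_mono) auto
      qed
      then show "\<Phi> s \<le> \<Phi> t" using lim st by (intro tendsto_le[OF H(2)])
    qed
    show "\<Phi> 1 = 1"
    proof -
      have "\<forall>\<^sub>F z in H. cdf z 1 = 1"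
        using ev
      proof eventually_elim
        case (elim z)
        then have "0 < ?q z" by (intro hit_gf_unit_pos) auto
        then show ?case unfolding cdf_def by simp
      qed
      then have "((\<lambda>z. cdf z 1) \<longlongrightarrow> 1) H" by (rule tendsto_eventually)
      moreover have "((\<lambda>z. cdf z 1) \<longlongrightarrow> \<Phi> 1) H" by (rule lim) simp
      ultimately show ?thesis using H(2) by (metis tendsto_unique)
    qed
    show "\<Phi> 0 = 0"
    proof -
      have "\<forall>\<^sub>F z in H. norm (cdf z 0) \<le> 2 / ?q z"
        using ev
      proof eventually_elim
        case (elim z)
        then have "hit_gf {0..0} z \<le> 2" "0 \<le> hit_gf {0..0} z" "0 < ?q z"
          using hit_gf_point[of 0 z] hit_gf_nonneg[of "{0}" z] hit_gf_unit_pos[of z] by auto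
        then show ?case unfolding cdf_def by (simp add: divide_right_mono)
      qed
      then have "((\<lambda>z. cdf z 0) \<longlongrightarrow> 0) H" using q0 by (rule Lim_null_comparison)
      moreover have "((\<lambda>z. cdf z 0) \<longlongrightarrow> \<Phi> 0) H" by (rule lim) simp
      ultimately show ?thesis using H(2) by (metis tendsto_unique)
    qed
    have i1: "R * \<bar>\<Phi> (T x) - \<Phi> (T x')\<bar> \<le> \<bar>\<Phi> x - \<Phi> x'\<bar>" if x: "x \<in> {0..1}" "x' \<in> {0..1}" for x x'
    proof -
      have "\<forall>\<^sub>F z in H. z * \<bar>cdf z (T x) - cdf z (T x')\<bar> \<le> \<bar>cdf z x - cdf z x'\<bar> + 2 / ?q z"
        using ev by eventually_elim (use cdf_image(1)[OF x] in auto)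
      moreover have "((\<lambda>z. z * \<bar>cdf z (T x) - cdf z (T x')\<bar>) \<longlongrightarrow> R * \<bar>\<Phi> (T x) - \<Phi> (T x')\<bar>) H"
        using x T_in by (intro tendsto_intros zR lim) auto
      moreover have "((\<lambda>z. \<bar>cdf z x - cdf z x'\<bar> + 2 / ?q z) \<longlongrightarrow> \<bar>\<Phi> x - \<Phi> x'\<bar> + 0) H"
        using x by (intro tendsto_add tendsto_rabs tendsto_diff q0 lim) auto
      ultimately have "R * \<bar>\<Phi> (T x) - \<Phi> (T x')\<bar> \<le> \<bar>\<Phi> x - \<Phi> x'\<bar> + 0"
        by (intro tendsto_le[OF H(2)])
      then show ?thesis by simp
    qed
    show "R * \<bar>\<Phi> (T x) - \<Phi> (T x')\<bar> \<le> \<bar>\<Phi> x - \<Phi> x'\<bar>" if "x \<in> {0..1}" "x' \<in> {0..1}" for x x'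
      using i1[OF that] .
    show "\<bar>\<Phi> x - \<Phi> x'\<bar> = R * \<bar>\<Phi> (T x) - \<Phi> (T x')\<bar>"
      if x: "x \<in> {0..1}" "x' \<in> {0..1}" and inj: "inj_on T (closed_segment x x')" for x x'
    proof -
      have "\<forall>\<^sub>F z in H. \<bar>cdf z x - cdf z x'\<bar> \<le> z * \<bar>cdf z (T x) - cdf z (T x')\<bar> + 2 / ?q z"
        using ev by eventually_elim (use cdf_image(2)[OF x _ _ inj] in auto)
      moreover have "((\<lambda>z. z * \<bar>cdf z (T x) - cdf z (T x')\<bar> + 2 / ?q z) \<longlongrightarrow> R * \<bar>\<Phi> (T x) - \<Phi> (T x')\<bar> + 0) H"
        using x T_in by (intro tendsto_add tendsto_mult tendsto_rabs tendsto_diff q0 zR lim) auto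
      moreover have "((\<lambda>z. \<bar>cdf z x - cdf z x'\<bar>) \<longlongrightarrow> \<bar>\<Phi> x - \<Phi> x'\<bar>) H"
        using x by (intro tendsto_rabs tendsto_diff lim) auto
      ultimately have "\<bar>\<Phi> x - \<Phi> x'\<bar> \<le> R * \<bar>\<Phi> (T x) - \<Phi> (T x')\<bar> + 0"
        by (intro tendsto_le[OF H(2)])
      then show ?thesis using i1[OF x] by simp
    qed
    show "\<exists>F. finite F \<and> F \<subseteq> L \<and>
      (\<forall>a b. 0 \<le> a \<longrightarrow> a \<le> b \<longrightarrow> b \<le> 1 \<longrightarrow> {a<..<b} \<inter> \<Union>F = {} \<longrightarrow> \<Phi> b - \<Phi> a \<le> \<epsilon>)" if \<epsilon>: "\<epsilon> > 0" for \<epsilon>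
    proof -
      obtain F where "finite F \<and> F \<subseteq> L \<and> (\<forall>A z. A \<subseteq> {0..1} \<longrightarrow> A \<inter> \<Union>F = {} \<longrightarrow> 0 \<le> z \<longrightarrow> z < R \<longrightarrow>
          hit_gf A z \<le> \<epsilon> * loop_gf z)"
        using hit_gf_tight[OF \<epsilon>] by (rule exE)
      then have F: "finite F" "F \<subseteq> L"
        "A \<subseteq> {0..1} \<Longrightarrow> A \<inter> \<Union>F = {} \<Longrightarrow> 0 \<le> z \<Longrightarrow> z < R \<Longrightarrow> hit_gf A z \<le> \<epsilon> * loop_gf z" for A z
        by simp_all
      have "\<Phi> b - \<Phi> a \<le> \<epsilon>" if ab: "0 \<le> a" "a \<le> b" "b \<le> 1" "{a<..<b} \<inter> \<Union>F = {}" for a b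
      proof -
        have "\<forall>\<^sub>F z in H. cdf z b - cdf z a \<le> \<epsilon> + 2 / ?q z"
          using ev
        proof eventually_elim
          case (elim z)
          then have z: "0 \<le> z" "z < R" by auto
          have q: "0 < ?q z" by (rule hit_gf_unit_pos[OF z])
          have "{a<..b} \<subseteq> {a<..<b} \<union> {b}" by auto
          then have "hit_gf {a<..b} z \<le> hit_gf ({a<..<b} \<union> {b}) z"
            using ab z by (intro hit_gf_mono) auto
          also have "\<dots> = hit_gf {a<..<b} z + hit_gf {b} z" using ab z by (intro hit_gf_Un) auto
          also have "\<dots> \<le> \<epsilon> * loop_gf z + 2"
            using ab z by (intro add_mono F(3) hit_gf_point) auto
          also have "\<dots> \<le> \<epsilon> * ?q z + 2" using loop_gf_le_hit_gf[OF z] \<epsilon> by simp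
          finally have "hit_gf {a<..b} z / ?q z \<le> (\<epsilon> * ?q z + 2) / ?q z"
            using q by (intro divide_right_mono) auto
          also have "\<dots> = \<epsilon> + 2 / ?q z" using q by (simp add: add_divide_distrib)
          finally show ?case unfolding cdf_diff[OF ab(1-3) z] .
        qed
        moreover have "((\<lambda>z. cdf z b - cdf z a) \<longlongrightarrow> \<Phi> b - \<Phi> a) H" using ab by (intro tendsto_diff lim) auto
        moreover have "((\<lambda>z. \<epsilon> + 2 / ?q z) \<longlongrightarrow> \<epsilon> + 0) H" by (intro tendsto_add tendsto_const q0)
        ultimately have "\<Phi> b - \<Phi> a \<le> \<epsilon> + 0" by (intro tendsto_le[OF H(2)])
        then show ?thesis by simp
      qed
      then show ?thesis using F(1,2) by blast
    qed
  qed
qed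

end

section \<open>Linearization\<close>

text \<open>Only the analytic properties of the limit are retained. Neither the base point nor any
  counting enters the proof that \<open>\<Phi>\<close> is a conjugacy.\<close>

locale conformal_map =
  fixes T :: "real \<Rightarrow> real" and L :: "real set set" and R :: real and \<Phi> :: "real \<Rightarrow> real"
  assumes T: "interval_map T" and mixing: "topologically_mixing T"
    and L_countable: "countable L"
    and L_interval: "K \<in> L \<Longrightarrow> \<exists>a b. a < b \<and> K = {a..b}"
    and L_sub_unit: "K \<in> L \<Longrightarrow> K \<subseteq> {0..1}"
    and L_inj: "K \<in> L \<Longrightarrow> inj_on T K"
    and L_cover: "countable ({0..1} - \<Union>L)"
    and R: "0 < R" "R < 1"
    and mono: "mono_on {0..1} \<Phi>" and \<Phi>0: "\<Phi> 0 = 0" and \<Phi>1: "\<Phi> 1 = 1"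
    and expand: "x \<in> {0..1} \<Longrightarrow> x' \<in> {0..1} \<Longrightarrow> R * \<bar>\<Phi> (T x) - \<Phi> (T x')\<bar> \<le> \<bar>\<Phi> x - \<Phi> x'\<bar>"
    and conformal: "x \<in> {0..1} \<Longrightarrow> x' \<in> {0..1} \<Longrightarrow> inj_on T (closed_segment x x') \<Longrightarrow>
      \<bar>\<Phi> x - \<Phi> x'\<bar> = R * \<bar>\<Phi> (T x) - \<Phi> (T x')\<bar>"
    and tight: "\<epsilon> > 0 \<Longrightarrow> \<exists>F. finite F \<and> F \<subseteq> L \<and>
      (\<forall>a b. 0 \<le> a \<longrightarrow> a \<le> b \<longrightarrow> b \<le> 1 \<longrightarrow> {a<..<b} \<inter> \<Union>F = {} \<longrightarrow> \<Phi> b - \<Phi> a \<le> \<epsilon>)"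
begin

lemma T_in: "x \<in> {0..1} \<Longrightarrow> T x \<in> {0..1}"
  by (rule interval_map_in[OF T])

lemma cont_T: "continuous_on {0..1} T"
  using T unfolding interval_map_def by blast

lemma conformal_lap:
  assumes "K \<in> L" "x \<in> K" "x' \<in> K"
  shows "\<bar>\<Phi> x - \<Phi> x'\<bar> = R * \<bar>\<Phi> (T x) - \<Phi> (T x')\<bar>"
proof (rule conformal)
  show "x \<in> {0..1}" "x' \<in> {0..1}" using assms L_sub_unit by blast+
  obtain a b where "K = {a..b}" using L_interval[OF assms(1)] by blast
  then have "closed_segment x x' \<subseteq> K" using assms by (simp add: closed_segment_subset)
  then show "inj_on T (closed_segment x x')" by (rule inj_on_subset[OF L_inj[OF assms(1)]])
qed

text \<open>The two sides of \<open>p\<close> are treated separately because \<open>p\<close> may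
  end a lap on one side while laps accumulate on the other. If a lap contains \<open>p\<close> and
  the nearby points of \<open>S\<close>, the oscillation is \<open>R\<close> times that at
  \<open>T p\<close>; the hypothesis there is two-sided, as \<open>T\<close> may reverse
  orientation. Otherwise every finite set of laps misses a short one-sided interval at
  \<open>p\<close>, and \<open>tight\<close> bounds its mass.\<close>

lemma one_sided_oscillation:
  assumes p: "p \<in> {0..1}" and S: "S \<subseteq> {0..1}"
    and dich: "\<And>K. K \<in> L \<Longrightarrow> (p \<in> K \<and> eventually (\<lambda>q. q \<in> K) (at p within S)) \<or> eventually (\<lambda>q. q \<notin> K) (at p within S)"
    and between: "\<And>q u. q \<in> S \<Longrightarrow> (p < u \<and> u < q) \<or> (q < u \<and> u < p) \<Longrightarrow> u \<in> S"
    and IH: "\<And>p. p \<in> {0..1} \<Longrightarrow> eventually (\<lambda>q. \<bar>\<Phi> q - \<Phi> p\<bar> \<le> R ^ n) (at p within {0..1})"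
  shows "eventually (\<lambda>q. \<bar>\<Phi> q - \<Phi> p\<bar> \<le> R ^ Suc n) (at p within S)"
proof (cases "\<exists>K\<in>L. p \<in> K \<and> eventually (\<lambda>q. q \<in> K) (at p within S)")
  case True
  then obtain K where K: "K \<in> L" "p \<in> K" "eventually (\<lambda>q. q \<in> K) (at p within S)" by blast
  obtain d where d: "d > 0" "\<And>v. v \<in> {0..1} \<Longrightarrow> v \<noteq> T p \<Longrightarrow> dist v (T p) < d \<Longrightarrow> \<bar>\<Phi> v - \<Phi> (T p)\<bar> \<le> R ^ n"
    using IH[OF T_in[OF p]] unfolding eventually_at by blast
  have "(T \<longlongrightarrow> T p) (at p within {0..1})" using cont_T p unfolding continuous_on_def by blast
  then have "(T \<longlongrightarrow> T p) (at p within S)" using S by (rule tendsto_within_subset)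
  then have "eventually (\<lambda>q. dist (T q) (T p) < d) (at p within S)" using d(1) by (rule tendstoD)
  then show ?thesis
    using K(3)
  proof eventually_elim
    case (elim q)
    have "T q \<in> {0..1}" using elim(2) K(1) L_sub_unit T_in by blast
    then have "\<bar>\<Phi> (T q) - \<Phi> (T p)\<bar> \<le> R ^ n"
      using d(2)[of "T q"] elim(1) R by (cases "T q = T p") auto
    then show ?case using conformal_lap[OF K(1) elim(2) K(2)] R by simp
  qed
next
  case False
  obtain F where "finite F \<and> F \<subseteq> L \<and>
      (\<forall>a b. 0 \<le> a \<longrightarrow> a \<le> b \<longrightarrow> b \<le> 1 \<longrightarrow> {a<..<b} \<inter> \<Union>F = {} \<longrightarrow> \<Phi> b - \<Phi> a \<le> R ^ Suc n)"
    using tight[of "R ^ Suc n"] R by auto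
  then have F: "finite F" "F \<subseteq> L"
    "0 \<le> a \<Longrightarrow> a \<le> b \<Longrightarrow> b \<le> 1 \<Longrightarrow> {a<..<b} \<inter> \<Union>F = {} \<Longrightarrow> \<Phi> b - \<Phi> a \<le> R ^ Suc n" for a b
    by simp_all
  have "eventually (\<lambda>q. q \<notin> K) (at p within S)" if "K \<in> F" for K
    using dich[of K] False that F(2) by blast
  then have "eventually (\<lambda>q. \<forall>K\<in>F. q \<notin> K) (at p within S)"
    using F(1) by (intro eventually_ball_finite) auto
  then obtain d where d: "d > 0" "\<And>q. q \<in> S \<Longrightarrow> q \<noteq> p \<Longrightarrow> dist q p < d \<Longrightarrow> \<forall>K\<in>F. q \<notin> K"
    unfolding eventually_at by blast
  have "\<bar>\<Phi> q - \<Phi> p\<bar> \<le> R ^ Suc n" if q: "q \<in> S" "q \<noteq> p" "dist q p < d" for q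
  proof -
    have notF: "u \<notin> \<Union>F" if u: "(p < u \<and> u < q) \<or> (q < u \<and> u < p)" for u
    proof -
      have "dist u p < d" using u q(3) by (auto simp: dist_real_def)
      then show ?thesis using d(2)[OF between[OF q(1) u]] u by auto
    qed
    have q01: "q \<in> {0..1}" using q(1) S by blast
    show ?thesis
    proof (cases "p \<le> q")
      case True
      have "{p<..<q} \<inter> \<Union>F = {}" using notF by auto
      then have "\<Phi> q - \<Phi> p \<le> R ^ Suc n" using F(3)[of p q] True p q01 by simp
      moreover have "\<Phi> p \<le> \<Phi> q" using mono_onD[OF mono p q01 True] .
      ultimately show ?thesis by simp
    next
      case False
      then have le: "q \<le> p" by simp
      have "{q<..<p} \<inter> \<Union>F = {}" using notF by auto
      then have "\<Phi> p - \<Phi> q \<le> R ^ Suc n" using F(3)[of q p] le p q01 by simp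
      moreover have "\<Phi> q \<le> \<Phi> p" using mono_onD[OF mono q01 p le] .
      ultimately show ?thesis by simp
    qed
  qed
  then show ?thesis unfolding eventually_at using d(1) by blast
qed

text \<open>The jump of \<open>\<Phi>\<close> on either side of a point is \<open>R\<close> times a jump at the image point, or it
  vanishes by tightness.\<close>

lemma oscillation:
  "p \<in> {0..1} \<Longrightarrow> eventually (\<lambda>q. \<bar>\<Phi> q - \<Phi> p\<bar> \<le> R ^ n) (at p within {0..1})"
proof (induction n arbitrary: p)
  case 0
  have "\<bar>\<Phi> q - \<Phi> p\<bar> \<le> 1" if "q \<in> {0..1}" for q
    using mono_onD[OF mono, of 0 q] mono_onD[OF mono, of q 1] mono_onD[OF mono, of 0 p] mono_onD[OF mono, of p 1]
      that 0 \<Phi>0 \<Phi>1 by auto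
  then show ?case unfolding eventually_at by (intro exI[of _ 1]) auto
next
  case (Suc n)
  have right: "eventually (\<lambda>q. \<bar>\<Phi> q - \<Phi> p\<bar> \<le> R ^ Suc n) (at p within {p<..1})"
  proof (rule one_sided_oscillation[OF Suc.prems _ _ _ Suc.IH])
    fix K assume "K \<in> L"
    then obtain l r where K: "l < r" "K = {l..r}" using L_interval by blast
    show "(p \<in> K \<and> eventually (\<lambda>q. q \<in> K) (at p within {p<..1})) \<or> eventually (\<lambda>q. q \<notin> K) (at p within {p<..1})"
    proof (cases "l \<le> p \<and> p < r")
      case True
      then have "eventually (\<lambda>q. q \<in> K) (at p within {p<..1})"
        unfolding eventually_at K(2) by (intro exI[of _ "r - p"]) (auto simp: dist_real_def)
      then show ?thesis using True K by auto
    next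
      case False
      then have "eventually (\<lambda>q. q \<notin> K) (at p within {p<..1})"
        unfolding eventually_at K(2) by (intro exI[of _ "if p < l then l - p else 1"]) (auto simp: dist_real_def)
      then show ?thesis by blast
    qed
  qed (use Suc.prems in auto)
  have left: "eventually (\<lambda>q. \<bar>\<Phi> q - \<Phi> p\<bar> \<le> R ^ Suc n) (at p within {0..<p})"
  proof (rule one_sided_oscillation[OF Suc.prems _ _ _ Suc.IH])
    fix K assume "K \<in> L"
    then obtain l r where K: "l < r" "K = {l..r}" using L_interval by blast
    show "(p \<in> K \<and> eventually (\<lambda>q. q \<in> K) (at p within {0..<p})) \<or> eventually (\<lambda>q. q \<notin> K) (at p within {0..<p})"
    proof (cases "l < p \<and> p \<le> r")
      case True
      then have "eventually (\<lambda>q. q \<in> K) (at p within {0..<p})"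
        unfolding eventually_at K(2) by (intro exI[of _ "p - l"]) (auto simp: dist_real_def)
      then show ?thesis using True K by auto
    next
      case False
      then have "eventually (\<lambda>q. q \<notin> K) (at p within {0..<p})"
        unfolding eventually_at K(2) by (intro exI[of _ "if r < p then p - r else 1"]) (auto simp: dist_real_def)
      then show ?thesis by blast
    qed
  qed (use Suc.prems in auto)
  have "{0..1} - {p} = ({p<..1} \<union> {0..<p}) - {p}" using Suc.prems by auto
  then have "at p within {0..1} = at p within ({p<..1} \<union> {0..<p})" unfolding at_within_def by simp
  then show ?case using right left by (simp add: at_within_union eventually_sup)
qed

lemma continuous: "continuous_on {0..1} \<Phi>"
  unfolding continuous_on_def tendsto_iff
proof (intro ballI allI impI)
  fix p e :: real assume p: "p \<in> {0..1}" and e: "e > 0"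
  obtain n where n: "R ^ n < e" using real_arch_pow_inv[OF e R(2)] by blast
  show "\<forall>\<^sub>F q in at p within {0..1}. dist (\<Phi> q) (\<Phi> p) < e"
    using oscillation[OF p, of n] by (rule eventually_mono) (use n in \<open>simp add: dist_real_def\<close>)
qed

text \<open>The set \<open>A\<close> may cross infinitely many laps, so constancy cannot be passed
  from lap to lap. Instead, each lap contributes at most one value and the uncovered points
  countably many, whereas a connected set of values with two elements is uncountable.\<close>

lemma constant_image:
  assumes A: "A \<subseteq> {0..1}" "connected A" and c: "\<And>u. u \<in> A \<Longrightarrow> \<Phi> u = c"
  shows "\<exists>c'. \<forall>u\<in>T ` A. \<Phi> u = c'"
proof (rule ccontr)
  assume "\<not> ?thesis"
  then obtain u v where uv: "u \<in> T ` A" "v \<in> T ` A" "\<Phi> u \<noteq> \<Phi> v" by metis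
  have "connected (T ` A)" using A cont_T continuous_on_subset by (blast intro: connected_continuous_image)
  moreover have "T ` A \<subseteq> {0..1}" using A T_in by blast
  ultimately have "connected (\<Phi> ` T ` A)"
    using continuous continuous_on_subset by (blast intro: connected_continuous_image)
  then have "uncountable (\<Phi> ` T ` A)" using connected_uncountable[OF _ imageI[OF uv(1)] imageI[OF uv(2)] uv(3)] by blast
  moreover have "\<Phi> ` T ` A \<subseteq> (\<Union>K\<in>L. \<Phi> ` T ` (A \<inter> K)) \<union> \<Phi> ` T ` ({0..1} - \<Union>L)"
  proof
    fix w assume "w \<in> \<Phi> ` T ` A"
    then obtain x where x: "x \<in> A" "w = \<Phi> (T x)" by blast
    show "w \<in> (\<Union>K\<in>L. \<Phi> ` T ` (A \<inter> K)) \<union> \<Phi> ` T ` ({0..1} - \<Union>L)"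
    proof (cases "x \<in> \<Union>L")
      case True
      then obtain K where "K \<in> L" "x \<in> K" by blast
      then show ?thesis using x by blast
    next
      case False
      then have "x \<in> {0..1} - \<Union>L" using A(1) x(1) by blast
      then show ?thesis using x(2) by simp
    qed
  qed
  moreover have "countable (\<Phi> ` T ` (A \<inter> K))" if K: "K \<in> L" for K
  proof -
    have "\<Phi> (T x) = \<Phi> (T x')" if "x \<in> A \<inter> K" "x' \<in> A \<inter> K" for x x'
      using conformal_lap[OF K, of x x'] that c R(1) by simp
    then have "\<exists>b. \<Phi> ` T ` (A \<inter> K) \<subseteq> {b}" by blast
    then show ?thesis by (meson countable_finite countable_subset finite.emptyI finite.insertI)
  qed
  then have "countable ((\<Union>K\<in>L. \<Phi> ` T ` (A \<inter> K)) \<union> \<Phi> ` T ` ({0..1} - \<Union>L))"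
    using L_countable countable_image[OF countable_image[OF L_cover]] by (intro countable_Un countable_UN)
  ultimately show False using countable_subset by blast
qed

text \<open>An interval on which \<open>\<Phi>\<close> is constant has iterated images on which
  \<open>\<Phi>\<close> is constant. By mixing some iterate meets both \<open>\<Phi> < 1/2\<close>
  and \<open>\<Phi> > 1/2\<close>.\<close>

lemma injective: "inj_on \<Phi> {0..1}"
proof -
  have False if xy: "x \<in> {0..1}" "y \<in> {0..1}" "x < y" "\<Phi> x = \<Phi> y" for x y
  proof -
    have const: "\<exists>c. \<forall>u\<in>(T ^^ m) ` {x..y}. \<Phi> u = c" for m
    proof (induction m)
      case 0
      show ?case
      proof (intro exI ballI)
        fix u assume "u \<in> (T ^^ 0) ` {x..y}"
        then have u: "u \<in> {x..y}" by simp
        then have "u \<in> {0..1}" using xy by auto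
        then show "\<Phi> u = \<Phi> x"
          using mono_onD[OF mono xy(1), of u] mono_onD[OF mono _ xy(2), of u] u xy(4) by simp
      qed
    next
      case (Suc m)
      then obtain c where c: "\<And>u. u \<in> (T ^^ m) ` {x..y} \<Longrightarrow> \<Phi> u = c" by blast
      have xy01: "{x..y} \<subseteq> {0..1}" using xy by auto
      have "continuous_on {x..y} (T ^^ m)"
        using continuous_on_interval_map_funpow[OF T] xy01 by (rule continuous_on_subset)
      then have "connected ((T ^^ m) ` {x..y})" by (rule connected_continuous_image) simp
      moreover have "(T ^^ m) ` {x..y} \<subseteq> {0..1}" using interval_map_funpow_in[OF T] xy01 by blast
      ultimately have "\<exists>c'. \<forall>u\<in>T ` (T ^^ m) ` {x..y}. \<Phi> u = c'" using c by (intro constant_image)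
      then show ?case by (simp add: image_comp)
    qed
    let ?U = "{x<..<y}" and ?V = "{0..1} \<inter> \<Phi> -` {..<1/2}" and ?W = "{0..1} \<inter> \<Phi> -` {1/2<..}"
    have U: "openin (top_of_set {0..1}) ?U"
      unfolding openin_open using xy by (intro exI[of _ "{x<..<y}"]) auto
    have V: "openin (top_of_set {0..1}) ?V" "openin (top_of_set {0..1}) ?W"
      using continuous by (auto intro: continuous_openin_preimage_gen)
    have ne: "?U \<noteq> {}" "?V \<noteq> {}" "?W \<noteq> {}"
    proof -
      show "?U \<noteq> {}" using xy by simp
      have "0 \<in> ?V" "1 \<in> ?W" using \<Phi>0 \<Phi>1 by auto
      then show "?V \<noteq> {}" "?W \<noteq> {}" by blast+
    qed
    have "\<exists>n. \<forall>m\<ge>n. (T ^^ m) ` ?U \<inter> ?V \<noteq> {}" "\<exists>n. \<forall>m\<ge>n. (T ^^ m) ` ?U \<inter> ?W \<noteq> {}"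
      by (rule mixing[unfolded topologically_mixing_def, rule_format]; use U V ne in blast)+
    then obtain n1 n2 where n: "\<And>m. m \<ge> n1 \<Longrightarrow> (T ^^ m) ` ?U \<inter> ?V \<noteq> {}"
      "\<And>m. m \<ge> n2 \<Longrightarrow> (T ^^ m) ` ?U \<inter> ?W \<noteq> {}" by blast
    define m where "m = n1 + n2"
    have "n1 \<le> m" "n2 \<le> m" by (simp_all add: m_def)
    note * = n(1)[OF this(1)] n(2)[OF this(2)]
    obtain v where v: "v \<in> (T ^^ m) ` ?U \<inter> ?V" using *(1)[folded ex_in_conv] by (rule exE)
    obtain w where w: "w \<in> (T ^^ m) ` ?U \<inter> ?W" using *(2)[folded ex_in_conv] by (rule exE)
    have "v \<in> (T ^^ m) ` {x..y}" "w \<in> (T ^^ m) ` {x..y}"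
      using v w greaterThanLessThan_subseteq_atLeastAtMost_iff[of x y x y] by blast+
    then have "\<Phi> v = \<Phi> w" using const[of m] by metis
    then show False using v w by simp
  qed
  then show ?thesis unfolding inj_on_def by (metis linorder_less_linear)
qed

lemma image: "\<Phi> ` {0..1} = {0..1}"
proof
  show "\<Phi> ` {0..1} \<subseteq> {0..1}"
  proof
    fix v assume "v \<in> \<Phi> ` {0..1}"
    then obtain u where u: "u \<in> {0..1}" "v = \<Phi> u" by blast
    then show "v \<in> {0..1}"
      using mono_onD[OF mono, of 0 u] mono_onD[OF mono, of u 1] \<Phi>0 \<Phi>1 by auto
  qed
  show "{0..1} \<subseteq> \<Phi> ` {0..1}"
  proof
    fix v :: real assume "v \<in> {0..1}"
    then have "\<exists>u\<ge>0. u \<le> 1 \<and> \<Phi> u = v" using \<Phi>0 \<Phi>1 continuous by (intro IVT') auto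
    then show "v \<in> \<Phi> ` {0..1}" by auto
  qed
qed

lemma less_iff: "x \<in> {0..1} \<Longrightarrow> x' \<in> {0..1} \<Longrightarrow> \<Phi> x < \<Phi> x' \<longleftrightarrow> x < x'"
  using mono_onD[OF mono] inj_onD[OF injective] by (metis linorder_not_less order_less_le)

lemma linear_on_lap:
  assumes K: "K \<in> L" and u: "u \<in> K"
  obtains D where "\<bar>D\<bar> = 1 / R" "\<And>v. v \<in> K \<Longrightarrow> \<Phi> (T v) - \<Phi> (T u) = D * (\<Phi> v - \<Phi> u)"
proof -
  obtain a b where ab: "K = {a..b}" using L_interval[OF K] by blast
  have sub: "K \<subseteq> {0..1}" by (rule L_sub_unit[OF K])
  have "strict_mono_on K T \<or> strict_antimono_on K T"
    using injective_eq_monotone_map[of K T] continuous_on_subset[OF cont_T sub] L_inj[OF K] ab by simp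
  then show thesis
  proof
    assume m: "strict_mono_on K T"
    have "\<Phi> (T v) - \<Phi> (T u) = (1 / R) * (\<Phi> v - \<Phi> u)" if v: "v \<in> K" for v
    proof -
      have abs: "\<bar>\<Phi> v - \<Phi> u\<bar> = R * \<bar>\<Phi> (T v) - \<Phi> (T u)\<bar>" by (rule conformal_lap[OF K v u])
      have in01: "u \<in> {0..1}" "v \<in> {0..1}" "T u \<in> {0..1}" "T v \<in> {0..1}" using u v sub T_in by blast+
      consider "u < v" | "v < u" | "u = v" by linarith
      then show ?thesis
      proof cases
        case 1
        then have "T u < T v" using m u v unfolding monotone_on_def by blast
        then have "\<Phi> u < \<Phi> v" "\<Phi> (T u) < \<Phi> (T v)" using 1 in01 less_iff by blast+
        then show ?thesis using abs R(1) by (simp add: field_simps)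
      next
        case 2
        then have "T v < T u" using m u v unfolding monotone_on_def by blast
        then have "\<Phi> v < \<Phi> u" "\<Phi> (T v) < \<Phi> (T u)" using 2 in01 less_iff by blast+
        then show ?thesis using abs R(1) by (simp add: field_simps)
      qed simp
    qed
    then show thesis using that[of "1 / R"] R(1) by simp
  next
    assume m: "strict_antimono_on K T"
    have "\<Phi> (T v) - \<Phi> (T u) = (- 1 / R) * (\<Phi> v - \<Phi> u)" if v: "v \<in> K" for v
    proof -
      have abs: "\<bar>\<Phi> v - \<Phi> u\<bar> = R * \<bar>\<Phi> (T v) - \<Phi> (T u)\<bar>" by (rule conformal_lap[OF K v u])
      have in01: "u \<in> {0..1}" "v \<in> {0..1}" "T u \<in> {0..1}" "T v \<in> {0..1}" using u v sub T_in by blast+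
      consider "u < v" | "v < u" | "u = v" by linarith
      then show ?thesis
      proof cases
        case 1
        then have "T v < T u" using m u v unfolding monotone_on_def by blast
        then have "\<Phi> u < \<Phi> v" "\<Phi> (T v) < \<Phi> (T u)" using 1 in01 less_iff by blast+
        then show ?thesis using abs R(1) by (simp add: field_simps)
      next
        case 2
        then have "T u < T v" using m u v unfolding monotone_on_def by blast
        then have "\<Phi> v < \<Phi> u" "\<Phi> (T u) < \<Phi> (T v)" using 2 in01 less_iff by blast+
        then show ?thesis using abs R(1) by (simp add: field_simps)
      qed simp
    qed
    then show thesis using that[of "- 1 / R"] R(1) by simp
  qed
qed

text \<open>The conjugate map is affine with slope of modulus \<open>1 / R\<close> on the image of
  each lap, so the slope can fail only at the countably many images of lap endpoints and uncovered
  points.\<close>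

lemma conjugate_constant_slope:
  "\<exists>g. interval_map g \<and> constant_slope g (1 / R) \<and> topologically_conjugate T g"
proof -
  obtain \<phi> where h: "homeomorphism {0..1} {0..1} \<Phi> \<phi>"
    using homeomorphism_compact[OF _ continuous image injective] by auto
  have \<phi>: "continuous_on {0..1} \<phi>" "\<And>x. x \<in> {0..1} \<Longrightarrow> \<phi> x \<in> {0..1}"
    "\<And>x. x \<in> {0..1} \<Longrightarrow> \<Phi> (\<phi> x) = x" "\<And>x. x \<in> {0..1} \<Longrightarrow> \<phi> (\<Phi> x) = x"
    using h unfolding homeomorphism_def by auto
  define g where "g = \<Phi> \<circ> T \<circ> \<phi>"
  have "interval_map g"
    unfolding interval_map_def
  proof
    have "\<Phi> u \<in> {0..1}" if "u \<in> {0..1}" for u using image imageI[OF that, of \<Phi>] by simp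
    then show "g ` {0..1} \<subseteq> {0..1}" unfolding g_def comp_def using \<phi>(2) T_in by (intro image_subsetI) meson
    have sub: "\<phi> ` {0..1} \<subseteq> {0..1}" using \<phi>(2) by (rule image_subsetI)
    have "T ` {0..1} \<subseteq> {0..1}" using T_in by (rule image_subsetI)
    then have sub': "T ` \<phi> ` {0..1} \<subseteq> {0..1}" using image_mono[OF sub, of T] by (rule subset_trans[rotated])
    have "continuous_on {0..1} (T \<circ> \<phi>)"
      by (rule continuous_on_compose[OF \<phi>(1) continuous_on_subset[OF cont_T sub]])
    then show "continuous_on {0..1} g"
      unfolding g_def comp_assoc
      by (rule continuous_on_compose) (simp only: image_comp[symmetric] continuous_on_subset[OF continuous sub'])
  qed
  moreover have "topologically_conjugate T g"
    unfolding topologically_conjugate_def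
    using h \<phi>(4) by (intro exI[of _ \<Phi>] exI[of _ \<phi>]) (auto simp: g_def)
  moreover have "constant_slope g (1 / R)"
    unfolding constant_slope_def
  proof (rule countable_subset)
    let ?E = "({0..1} - \<Union>L) \<union> (\<Union>K\<in>L. {Inf K, Sup K})"
    show "countable (\<Phi> ` ?E)" using L_countable L_cover by (intro countable_image countable_Un countable_UN) auto
    show "{x\<in>{0..1}. \<not> (\<exists>D. (g has_real_derivative D) (at x within {0..1}) \<and> \<bar>D\<bar> = 1 / R)} \<subseteq> \<Phi> ` ?E"
    proof (rule subsetI, rule ccontr)
      fix x assume x: "x \<in> {x\<in>{0..1}. \<not> (\<exists>D. (g has_real_derivative D) (at x within {0..1}) \<and> \<bar>D\<bar> = 1 / R)}"
        and "x \<notin> \<Phi> ` ?E"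
      then have x01: "x \<in> {0..1}" by blast
      define u where "u = \<phi> x"
      have u: "u \<in> {0..1}" "\<Phi> u = x" using \<phi>(2,3) x01 u_def by auto
      then have "u \<notin> ?E" using \<open>x \<notin> \<Phi> ` ?E\<close> by blast
      then obtain K where K: "K \<in> L" "u \<in> K" "u \<noteq> Inf K" "u \<noteq> Sup K" using u(1) by blast
      obtain l r where lr: "l < r" "K = {l..r}" using L_interval[OF K(1)] by blast
      have lu: "l < u" "u < r" using K lr by auto
      have lr01: "l \<in> {0..1}" "r \<in> {0..1}" using L_sub_unit[OF K(1)] lr by auto
      obtain D where D: "\<bar>D\<bar> = 1 / R" "\<And>v. v \<in> K \<Longrightarrow> \<Phi> (T v) - \<Phi> (T u) = D * (\<Phi> v - \<Phi> u)"
        by (rule linear_on_lap[OF K(1,2)]) blast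
      \<comment> \<open>Within this radius of \<open>x\<close> every point is the image under
        \<open>\<Phi>\<close> of a point of \<open>K\<close>.\<close>
      define d where "d = min (x - \<Phi> l) (\<Phi> r - x)"
      have d: "d > 0" unfolding d_def using less_iff lr01 u lu by force
      have "((\<lambda>t. g x + D * (t - x)) has_real_derivative D) (at x within {0..1})"
        by (auto intro!: derivative_eq_intros)
      then have "(g has_real_derivative D) (at x within {0..1})"
      proof (rule has_field_derivative_transform_within[OF _ d x01])
        fix t assume t: "t \<in> {0..1}" "dist t x < d"
        define v where "v = \<phi> t"
        have v: "v \<in> {0..1}" "\<Phi> v = t" using \<phi>(2,3) t(1) v_def by auto
        have "\<Phi> l < \<Phi> v" "\<Phi> v < \<Phi> r" using t(2) v(2) unfolding d_def dist_real_def by auto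
        then have "v \<in> K" using less_iff lr01 v(1) lr by auto
        then show "g x + D * (t - x) = g t" using D(2)[of v] u v by (simp add: g_def u_def v_def)
      qed
      then show False using x D(1) by blast
    qed
  qed
  ultimately show ?thesis by blast
qed

lemma entropy_le: "topological_entropy T \<le> ereal (ln (1 / R))"
proof (rule entropy_le_of_Lipschitz[OF T continuous injective])
  show "\<Phi> ` {0..1} \<subseteq> {0..1}" using image by simp
  show "\<bar>\<Phi> (T x) - \<Phi> (T y)\<bar> \<le> 1 / R * \<bar>\<Phi> x - \<Phi> y\<bar>" if "x \<in> {0..1}" "y \<in> {0..1}" for x y
    using expand[OF that] R(1) by (simp add: field_simps)
  show "1 \<le> 1 / R" using R by simp
qed

end

section \<open>The lower entropy bound and the resulting linearization\<close>

context renewal_system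
begin

text \<open>Were \<open>exp h\<close> below \<open>1 / R\<close>, the horseshoe bound on loops would
  dominate the loop series on all of \<open>(0, R)\<close> by one convergent series, contradicting
  its divergence at \<open>R\<close>.\<close>

lemma entropy_ge:
  assumes h: "topological_entropy T = ereal h"
  shows "ln (1 / R) \<le> h"
proof (rule ccontr)
  assume "\<not> ?thesis"
  then have "exp h < 1 / R" using R(1) by (subst ln_less_cancel_iff[symmetric]) auto
  then have hR: "exp h * R < 1" using R(1) by (simp add: field_simps)
  let ?b = "\<lambda>n. 2 * R ^ n + (exp h * R) ^ n"
  have b: "summable ?b" using R hR by (intro summable_add summable_mult summable_geometric) auto
  have "loop_gf z \<le> suminf ?b" if z: "0 < z" "z < R" for z
    unfolding loop_gf_def
  proof (rule suminf_le)
    show "summable (\<lambda>n. real (loop_count n) * z ^ n)" using z by (intro loops_summable) auto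
    fix n
    have "real (loop_count n) * z ^ n \<le> (2 + exp (n * h)) * R ^ n"
      using loops_entropy_bound(2)[OF j y h, of n] z
      unfolding loops_def by (intro mult_mono power_mono) (auto intro: add_nonneg_nonneg)
    also have "\<dots> = ?b n" by (simp add: distrib_right exp_of_nat_mult power_mult_distrib)
    finally show "real (loop_count n) * z ^ n \<le> ?b n" .
  qed (rule b)
  then have "\<forall>\<^sub>F z in at_left R. loop_gf z \<le> suminf ?b"
    by (intro eventually_mono[OF eventually_below_R]) blast
  moreover have "\<forall>\<^sub>F z in at_left R. suminf ?b < loop_gf z"
    using loop_gf_at_top by (simp add: filterlim_at_top_dense)
  ultimately have "\<forall>\<^sub>F z in at_left R. False" by eventually_elim simp
  then show False by simp
qed

theorem linearizable_of_renewal: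
  assumes "topological_entropy T < \<infinity>"
  shows "linearizable T"
proof (rule conformal_distribution)
  fix \<Phi> assume \<Phi>: "mono_on {0..1} \<Phi>" "\<Phi> 0 = 0" "\<Phi> 1 = (1::real)"
    "\<And>x x'. x \<in> {0..1} \<Longrightarrow> x' \<in> {0..1} \<Longrightarrow> R * \<bar>\<Phi> (T x) - \<Phi> (T x')\<bar> \<le> \<bar>\<Phi> x - \<Phi> x'\<bar>"
    "\<And>x x'. x \<in> {0..1} \<Longrightarrow> x' \<in> {0..1} \<Longrightarrow> inj_on T (closed_segment x x') \<Longrightarrow>
      \<bar>\<Phi> x - \<Phi> x'\<bar> = R * \<bar>\<Phi> (T x) - \<Phi> (T x')\<bar>"
    "\<And>\<epsilon>. \<epsilon> > 0 \<Longrightarrow> \<exists>F. finite F \<and> F \<subseteq> L \<and>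
      (\<forall>a b. 0 \<le> a \<longrightarrow> a \<le> b \<longrightarrow> b \<le> 1 \<longrightarrow> {a<..<b} \<inter> \<Union>F = {} \<longrightarrow> \<Phi> b - \<Phi> a \<le> \<epsilon>)"
  interpret conformal_map T L R \<Phi>
  proof
    show "interval_map T" "topologically_mixing T" "countable L" "countable ({0..1} - \<Union>L)"
      by (fact T mixing L_countable L_cover)+
    show "0 < R" "R < 1" using R by auto
    show "mono_on {0..1} \<Phi>" "\<Phi> 0 = 0" "\<Phi> 1 = 1" by (fact \<Phi>(1-3))+
  qed (fact L_interval L_sub_unit L_inj \<Phi>(4-6))+
  obtain h where h: "topological_entropy T = ereal h"
    using assms topological_entropy_nonneg[of T] by (cases "topological_entropy T") auto
  have "h = ln (1 / R)" using entropy_ge[OF h] entropy_le unfolding h by simp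
  then have "exp (real_of_ereal (topological_entropy T)) = 1 / R" using h R by simp
  then show "linearizable T" unfolding linearizable_def using conjugate_constant_slope by simp
qed

end

section \<open>Laps of a Markov partition\<close>

text \<open>The values at the ends are one-sided limits of inner values. This is what makes maximal
  intervals of monotonicity closed.\<close>

lemma mono_on_Icc_of_Ioo:
  fixes f :: "real \<Rightarrow> real"
  assumes cont: "continuous_on {c..e} f" and mono: "mono_on {c<..<e} f"
  shows "mono_on {c..e} f"
proof (rule mono_onI)
  fix x y assume xy: "x \<in> {c..e}" "y \<in> {c..e}" "x \<le> y"
  show "f x \<le> f y"
  proof (cases "x = y")
    case False
    define m where "m = (x + y) / 2"
    have m: "x < m" "m < y" using xy(3) False by (auto simp: m_def)
    have "(f \<longlongrightarrow> f x) (at_right x)"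
      using continuous_on_subset[OF cont, of "{x..m}"] xy m by (intro continuous_on_Icc_at_rightD) auto
    moreover have "\<forall>\<^sub>F t in at_right x. f t \<le> f m"
      using eventually_at_right_real[OF m(1)] by eventually_elim (use mono_onD[OF mono] xy m in auto)
    ultimately have "f x \<le> f m" by (intro tendsto_upperbound) auto
    have "(f \<longlongrightarrow> f y) (at_left y)"
      using continuous_on_subset[OF cont, of "{m..y}"] xy m by (intro continuous_on_Icc_at_leftD) auto
    moreover have "\<forall>\<^sub>F t in at_left y. f m \<le> f t"
      using eventually_at_left_real[OF m(2)] by eventually_elim (use mono_onD[OF mono] xy m in auto)
    ultimately have "f m \<le> f y" by (intro tendsto_lowerbound) auto
    then show ?thesis using \<open>f x \<le> f m\<close> by simp
  qed simp
qed

lemma antimono_on_iff_uminus: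
  fixes f :: "real \<Rightarrow> real"
  shows "antimono_on A f \<longleftrightarrow> mono_on A (\<lambda>x. - f x)"
  unfolding monotone_on_def by simp

lemma monotone_map_on_Icc_of_Ioo:
  assumes "continuous_on {c..e} f" "monotone_map_on {c<..<e} f"
  shows "monotone_map_on {c..e} f"
  using mono_on_Icc_of_Ioo[OF assms(1)] mono_on_Icc_of_Ioo[OF continuous_on_minus[OF assms(1)]] assms(2)
  unfolding monotone_map_on_def antimono_on_iff_uminus by blast

lemma monotone_map_on_subset:
  "monotone_map_on A f \<Longrightarrow> B \<subseteq> A \<Longrightarrow> monotone_map_on B f"
  unfolding monotone_map_on_def by (meson monotone_on_subset)

lemma mono_on_Union:
  fixes f :: "real \<Rightarrow> real"
  assumes "\<And>M. M \<in> \<F> \<Longrightarrow> is_interval M" "\<And>M. M \<in> \<F> \<Longrightarrow> a \<in> M" "\<And>M. M \<in> \<F> \<Longrightarrow> mono_on M f"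
  shows "mono_on (\<Union>\<F>) f"
proof (rule mono_onI)
  fix x y assume "x \<in> \<Union>\<F>" "y \<in> \<Union>\<F>" and le: "x \<le> y"
  then obtain M M' where M: "M \<in> \<F>" "x \<in> M" and M': "M' \<in> \<F>" "y \<in> M'" by blast
  consider "a \<le> x" | "y \<le> a" | "x \<le> a" "a \<le> y" by linarith
  then show "f x \<le> f y"
  proof cases
    case 1
    then have "x \<in> M'" using mem_is_interval_1_I[OF assms(1)[OF M'(1)] assms(2)[OF M'(1)] M'(2)] le by blast
    then show ?thesis using mono_onD[OF assms(3)[OF M'(1)]] M'(2) le by blast
  next
    case 2
    then have "y \<in> M" using mem_is_interval_1_I[OF assms(1)[OF M(1)] M(2) assms(2)[OF M(1)]] le by blast
    then show ?thesis using mono_onD[OF assms(3)[OF M(1)]] M(2) le by blast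
  next
    case 3
    have "f x \<le> f a" using mono_onD[OF assms(3)[OF M(1)] M(2) assms(2)[OF M(1)] 3(1)] .
    also have "f a \<le> f y" using mono_onD[OF assms(3)[OF M'(1)] assms(2)[OF M'(1)] M'(2) 3(2)] .
    finally show ?thesis .
  qed
qed

text \<open>The division that witnesses piecewise monotonicity may cut finer than the maximal
  intervals of monotonicity, to which alone the Markov condition refers. The hull enlarges a piece
  \<open>d\<close> to the maximal interval around it.\<close>

definition monotone_hull :: "(real \<Rightarrow> real) \<Rightarrow> real set \<Rightarrow> real set \<Rightarrow> real set" where
  "monotone_hull S i d = \<Union>{M. is_interval M \<and> d \<subseteq> M \<and> M \<subseteq> i \<and> monotone_map_on M S}"

text \<open>All intervals in the union contain \<open>a\<close> and \<open>b\<close>, and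
  \<open>S a \<noteq> S b\<close> by injectivity. They are therefore monotone in the same direction,
  their union is monotone, and continuity adds its endpoints.\<close>

lemma monotone_hull:
  assumes S: "interval_map S" and mix: "topologically_mixing S"
    and i: "i = {p..q}" "i \<subseteq> {0..1}" and d: "d = {a..b}" "a < b" "d \<subseteq> i" "monotone_map_on d S"
  shows "d \<subseteq> monotone_hull S i d" "maximal_monotone_interval S i (monotone_hull S i d)"
    "\<exists>c e. c < e \<and> monotone_hull S i d = {c..e}"
proof -
  let ?F = "{M. is_interval M \<and> d \<subseteq> M \<and> M \<subseteq> i \<and> monotone_map_on M S}"
  let ?K = "monotone_hull S i d"
  have dF: "d \<in> ?F" using d by (simp add: is_interval_cc)
  then show dK: "d \<subseteq> ?K" unfolding monotone_hull_def by blast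
  have Ki: "?K \<subseteq> i" unfolding monotone_hull_def by blast
  have ab: "a \<in> d" "b \<in> d" using d by auto
  have "inj_on S d" using d i by (intro monotone_map_on_inj[OF S mix]) (auto simp: is_interval_cc)
  then have ne: "S a \<noteq> S b" using ab d(2) by (metis inj_onD less_irrefl)
  have F: "is_interval M" "a \<in> M" "b \<in> M" "monotone_map_on M S" if "M \<in> ?F" for M using that ab by auto
  have monoK: "monotone_map_on ?K S"
  proof (cases "S a < S b")
    case True
    have M: "mono_on M S" if "M \<in> ?F" for M
    proof (rule ccontr)
      assume "\<not> mono_on M S"
      then have "antimono_on M S" using F(4)[OF that] unfolding monotone_map_on_def by blast
      then have "S b \<le> S a" using F(2,3)[OF that] d(2) unfolding monotone_on_def by (meson less_imp_le)
      then show False using True by simp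
    qed
    have "mono_on (\<Union>?F) S" by (rule mono_on_Union[OF F(1) F(2) M])
    then show ?thesis unfolding monotone_hull_def monotone_map_on_def by (rule disjI1)
  next
    case False
    have M: "mono_on M (\<lambda>x. - S x)" if "M \<in> ?F" for M
    proof (rule ccontr)
      assume "\<not> mono_on M (\<lambda>x. - S x)"
      then have "mono_on M S"
        using F(4)[OF that] unfolding monotone_map_on_def antimono_on_iff_uminus by blast
      then have "S a \<le> S b" using mono_onD[OF _ F(2,3)[OF that]] d(2) by (meson less_imp_le)
      then show False using False ne by simp
    qed
    have "mono_on (\<Union>?F) (\<lambda>x. - S x)" by (rule mono_on_Union[OF F(1) F(2) M])
    then show ?thesis unfolding monotone_hull_def monotone_map_on_def antimono_on_iff_uminus by (rule disjI2)
  qed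
  have "connected (\<Union>?F)"
  proof (rule connected_Union)
    show "connected M" if "M \<in> ?F" for M using F(1)[OF that] by (simp add: is_interval_connected_1)
    have "a \<in> \<Inter>?F" using F(2) by blast
    then show "\<Inter>?F \<noteq> {}" by blast
  qed
  then have intK: "is_interval ?K" unfolding monotone_hull_def by (simp add: is_interval_connected_1)
  have max: "L \<subseteq> ?K" if "is_interval L" "?K \<subseteq> L" "L \<subseteq> i" "monotone_map_on L S" for L
    unfolding monotone_hull_def using that dK by blast
  show "maximal_monotone_interval S i ?K"
    unfolding maximal_monotone_interval_def using intK Ki monoK max by blast
  define c where "c = Inf ?K"
  define e where "e = Sup ?K"
  have bdd: "bdd_below ?K" "bdd_above ?K" using Ki i(1) by (meson bdd_above_Icc bdd_above_mono bdd_below_Icc bdd_below_mono)+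
  have aK: "a \<in> ?K" "b \<in> ?K" using ab dK by auto
  have sub: "?K \<subseteq> {c..e}" unfolding c_def e_def using bdd by (auto intro: cInf_lower cSup_upper)
  have sup: "{c<..<e} \<subseteq> ?K"
  proof
    fix x assume x: "x \<in> {c<..<e}"
    obtain u where "u \<in> ?K" "u < x" using x bdd(1) aK cInf_less_iff[of ?K x] unfolding c_def by auto
    moreover obtain v where "v \<in> ?K" "x < v" using x bdd(2) aK less_cSup_iff[of ?K x] unfolding e_def by auto
    ultimately show "x \<in> ?K" using mem_is_interval_1_I[OF intK, of u v x] by simp
  qed
  have cei: "{c..e} \<subseteq> i"
  proof -
    have "p \<le> c" unfolding c_def using aK Ki i(1) by (intro cInf_greatest) auto
    moreover have "e \<le> q" unfolding e_def using aK Ki i(1) by (intro cSup_least) auto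
    ultimately show ?thesis using i(1) by auto
  qed
  have "continuous_on {c..e} S"
    using S cei i(2) unfolding interval_map_def by (meson continuous_on_subset subset_trans)
  then have "monotone_map_on {c..e} S"
    using monotone_map_on_subset[OF monoK sup] by (intro monotone_map_on_Icc_of_Ioo)
  then have "{c..e} \<subseteq> ?K" using max[of "{c..e}"] sub cei by (simp add: is_interval_cc)
  then have "?K = {c..e}" using sub by blast
  moreover have "c < e" using subsetD[OF sub aK(1)] subsetD[OF sub aK(2)] d(2) by simp
  ultimately show "\<exists>c e. c < e \<and> ?K = {c..e}" by blast
qed

lemma markov_partitionD:
  assumes "markov_partition S Q"
  shows "countable Q" "\<forall>i\<in>Q. \<exists>a b. 0 \<le> a \<and> a < b \<and> b \<le> 1 \<and> i = {a..b}"
    "\<forall>i\<in>Q. \<forall>j\<in>Q. i \<noteq> j \<longrightarrow> interior i \<inter> interior j = {}"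
    "countable ({0..1} - \<Union>Q)"
    "\<forall>i\<in>Q. piecewise_monotone_on i S"
    "\<forall>i\<in>Q. \<forall>j\<in>Q. \<forall>K. maximal_monotone_interval S i K \<and> S ` K \<inter> interior j \<noteq> {} \<longrightarrow> j \<subseteq> S ` K"
  using assms unfolding markov_partition_def by - (elim conjE, assumption)+

lemma markov_partition_interval:
  assumes "markov_partition S Q" "i \<in> Q"
  shows "\<exists>a b. 0 \<le> a \<and> a < b \<and> b \<le> 1 \<and> i = {a..b}"
  using markov_partitionD(2)[OF assms(1)] assms(2) by (rule bspec)

text \<open>The laps are the hulls of the nondegenerate division pieces. Degenerate pieces are
  single points, finitely many in each partition element, and go into the countable uncovered
  set.\<close>

lemma markov_partition_lap_system:
  assumes S: "interval_map S" and mix: "topologically_mixing S" and Q: "markov_partition S Q"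
  shows "\<exists>L. lap_system S Q L \<and> (\<forall>K\<in>L. monotone_map_on K S)"
proof -
  have "\<forall>i\<in>Q. \<exists>\<D>. \<D> division_of i \<and> (\<forall>K\<in>\<D>. monotone_map_on K S)"
    using markov_partitionD(5)[OF Q] unfolding piecewise_monotone_on_def .
  then obtain \<D> where \<D>: "\<And>i. i \<in> Q \<Longrightarrow> \<D> i division_of i" "\<And>i K. i \<in> Q \<Longrightarrow> K \<in> \<D> i \<Longrightarrow> monotone_map_on K S"
    by metis
  have Q01: "i \<subseteq> {0..1}" if "i \<in> Q" for i using markov_partition_interval[OF Q that] by auto
  have Qcount: "countable Q" and Qdisj: "\<And>i i'. i \<in> Q \<Longrightarrow> i' \<in> Q \<Longrightarrow> i \<noteq> i' \<Longrightarrow> interior i \<inter> interior i' = {}"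
    and Qcov: "countable ({0..1} - \<Union>Q)"
    and Qmark: "\<And>i j K. i \<in> Q \<Longrightarrow> j \<in> Q \<Longrightarrow> maximal_monotone_interval S i K \<Longrightarrow> S ` K \<inter> interior j \<noteq> {} \<Longrightarrow> j \<subseteq> S ` K"
    using markov_partitionD[OF Q] by simp_all
  define I where "I = (SIGMA i:Q. {d \<in> \<D> i. interior d \<noteq> {}})"
  define L where "L = (\<lambda>(i, d). monotone_hull S i d) ` I"
  have hull: "d \<subseteq> monotone_hull S i d" "maximal_monotone_interval S i (monotone_hull S i d)"
    "\<exists>c e. c < e \<and> monotone_hull S i d = {c..e}" if id: "(i, d) \<in> I" for i d
  proof -
    have i: "i \<in> Q" "d \<in> \<D> i" "interior d \<noteq> {}" using id unfolding I_def by auto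
    obtain p q where pq: "i = {p..q}" using markov_partition_interval[OF Q i(1)] by blast
    obtain a b where ab: "d = {a..b}" using division_ofD(4)[OF \<D>(1)[OF i(1)] i(2)] by (auto simp: cbox_interval)
    then have "a < b" using i(3) by simp
    moreover have "d \<subseteq> i" using division_ofD(2)[OF \<D>(1)[OF i(1)] i(2)] .
    ultimately show "d \<subseteq> monotone_hull S i d" "maximal_monotone_interval S i (monotone_hull S i d)"
      "\<exists>c e. c < e \<and> monotone_hull S i d = {c..e}"
      using monotone_hull[OF S mix pq Q01[OF i(1)] ab _ _ \<D>(2)[OF i(1,2)]] by auto
  qed
  have L: "\<exists>i\<in>Q. maximal_monotone_interval S i K" if "K \<in> L" for K
    using that hull(2) unfolding L_def I_def by fastforce
  have Lmono: "monotone_map_on K S" "is_interval K" if "K \<in> L" for K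
    using L[OF that] unfolding maximal_monotone_interval_def by blast+
  have Lsub: "\<exists>i\<in>Q. K \<subseteq> i" if "K \<in> L" for K
    using L[OF that] unfolding maximal_monotone_interval_def by blast
  have "lap_system S Q L"
  proof
    show "interval_map S" by (rule S)
    show "\<exists>a b. 0 \<le> a \<and> a < b \<and> b \<le> 1 \<and> i = {a..b}" if "i \<in> Q" for i
      by (rule markov_partition_interval[OF Q that])
    show "interior i \<inter> interior i' = {}" if "i \<in> Q" "i' \<in> Q" "i \<noteq> i'" for i i'
      by (rule Qdisj[OF that])
    show "countable L"
    proof -
      have "countable {d \<in> \<D> i. interior d \<noteq> {}}" if "i \<in> Q" for i
        using division_ofD(1)[OF \<D>(1)[OF that]] by (intro countable_finite) simp
      then show ?thesis unfolding L_def I_def using Qcount by (intro countable_image countable_SIGMA) auto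
    qed
    show "\<exists>a b. a < b \<and> K = {a..b}" if "K \<in> L" for K using that hull(3) unfolding L_def by auto
    show "\<exists>i\<in>Q. K \<subseteq> i" if "K \<in> L" for K by (rule Lsub[OF that])
    show "inj_on S K" if "K \<in> L" for K
      using monotone_map_on_inj[OF S mix Lmono(2)[OF that] _ Lmono(1)[OF that]] Lsub[OF that] Q01 by blast
    show "i \<subseteq> S ` K" if "K \<in> L" "i \<in> Q" "S ` K \<inter> interior i \<noteq> {}" for K i
      using L[OF that(1)] Qmark that by blast
    show "countable ({0..1} - \<Union>L)"
    proof (rule countable_subset)
      have "countable (i - \<Union>L)" if i: "i \<in> Q" for i
      proof (rule countable_finite, rule finite_subset)
        show "finite (\<Union>{d \<in> \<D> i. interior d = {}})"
        proof (rule finite_Union)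
          show "finite {d \<in> \<D> i. interior d = {}}" using division_ofD(1)[OF \<D>(1)[OF i]] by simp
          fix d assume "d \<in> {d \<in> \<D> i. interior d = {}}"
          then have d: "d \<in> \<D> i" "interior d = {}" by auto
          obtain a b where "d = {a..b}" using division_ofD(4)[OF \<D>(1)[OF i] d(1)] by (auto simp: cbox_interval)
          then show "finite d" using d(2) by (cases "a = b") auto
        qed
        show "i - \<Union>L \<subseteq> \<Union>{d \<in> \<D> i. interior d = {}}"
        proof
          fix x assume x: "x \<in> i - \<Union>L"
          then obtain d where d: "d \<in> \<D> i" "x \<in> d" using division_ofD(6)[OF \<D>(1)[OF i]] by blast
          have "interior d = {}"
          proof (rule ccontr)
            assume "interior d \<noteq> {}"
            then have "(i, d) \<in> I" unfolding I_def using i d(1) by blast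
            then have "x \<in> monotone_hull S i d" "monotone_hull S i d \<in> L"
              using hull(1) d(2) unfolding L_def by auto
            then show False using x by blast
          qed
          then show "x \<in> \<Union>{d \<in> \<D> i. interior d = {}}" using d by blast
        qed
      qed
      then show "countable (({0..1} - \<Union>Q) \<union> (\<Union>i\<in>Q. i - \<Union>L))"
        using Qcount Qcov by (intro countable_Un countable_UN)
      show "{0..1} - \<Union>L \<subseteq> ({0..1} - \<Union>Q) \<union> (\<Union>i\<in>Q. i - \<Union>L)" by blast
    qed
  qed
  then show ?thesis using Lmono(1) by blast
qed

section \<open>Transition times and the number of preimages\<close>

text \<open>The iterate is not constant on a small interval inside \<open>G\<close>, so the image of
  that interval is connected with two points, hence uncountable. This produces generic points on
  prescribed itineraries.\<close>

lemma mixing_image_avoids_countable: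
  assumes T: "interval_map T" and mix: "topologically_mixing T"
    and G: "openin (top_of_set {0..1}) G" "G \<noteq> {}" and Z: "countable Z"
  obtains v where "v \<in> G" "(T ^^ n) v \<notin> Z"
proof -
  obtain U where U: "open U" "G = {0..1} \<inter> U" using G(1) unfolding openin_open by blast
  obtain p where p: "p \<in> {0..1}" "p \<in> U" using G(2) U by blast
  have "{0..1} = closure {0<..<1::real}" by simp
  then have "U \<inter> {0<..<1} \<noteq> {}" using p open_Int_closure_eq_empty[OF U(1), of "{0<..<1}"] by blast
  then obtain r where r: "r \<in> U \<inter> {0<..<1}" by blast
  have "open (U \<inter> {0<..<1})" using U(1) by (intro open_Int) auto
  then obtain e where e: "e > 0" "cball r e \<subseteq> U \<inter> {0<..<1}" using r open_contains_cball_eq by blast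
  define a b where "a = r - e" and "b = r + e"
  have ab: "a < b" "{a..b} \<subseteq> U" "{a..b} \<subseteq> {0..1}"
    using e unfolding a_def b_def by (auto simp: cball_eq_atLeastAtMost subset_iff)
  then have ab01: "0 \<le> a" "b \<le> 1" by auto
  obtain u u' where u: "u \<in> {a<..<b}" "u' \<in> {a<..<b}" "(T ^^ n) u \<noteq> (T ^^ n) u'"
    using topologically_mixing_nonconstant[OF T mix ab01(1) ab(1) ab01(2)] by blast
  have "connected ((T ^^ n) ` {a..b})"
    using continuous_on_subset[OF continuous_on_interval_map_funpow[OF T] ab(3)]
    by (rule connected_continuous_image) simp
  moreover have "u \<in> {a..b}" "u' \<in> {a..b}" using u by auto
  ultimately have "uncountable ((T ^^ n) ` {a..b})" using connected_uncountable u(3) by blast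
  then have "\<not> (T ^^ n) ` {a..b} \<subseteq> Z" using countable_subset[OF _ Z] by (rule contrapos_nn)
  then obtain v where v: "v \<in> {a..b}" "(T ^^ n) v \<notin> Z" unfolding image_subset_iff by blast
  moreover have "v \<in> G" unfolding U(2) using v(1) ab(2,3) by blast
  ultimately show thesis using that by simp
qed

text \<open>By uniform continuity an interval mapped over \<open>j\<close> has length at least
  \<open>\<delta>\<close>. Its interior then contains a point of the grid of mesh
  \<open>1 / m\<close>, and disjoint interiors use different grid points. The maximum in
  \<open>transition_matrix\<close> is thereby taken over a finite set.\<close>

lemma card_horseshoe_le:
  assumes S: "interval_map S" and i: "i \<subseteq> {0..1}" and j: "j = {c..d}" "c < d"
  obtains m where "\<And>\<A>. finite \<A> \<Longrightarrow> (\<forall>K\<in>\<A>. is_interval K \<and> K \<subseteq> i \<and> j \<subseteq> S ` K) \<Longrightarrow>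
    pairwise (\<lambda>K L. interior K \<inter> interior L = {}) \<A> \<Longrightarrow> card \<A> \<le> m"
proof -
  have "uniformly_continuous_on {0..1} S"
    using S unfolding interval_map_def by (intro compact_uniformly_continuous) auto
  then obtain \<delta> where \<delta>: "\<delta> > 0" "\<And>x x'. x \<in> {0..1} \<Longrightarrow> x' \<in> {0..1} \<Longrightarrow> dist x' x < \<delta> \<Longrightarrow> dist (S x') (S x) < d - c"
    unfolding uniformly_continuous_on_def using j(2) by (metis diff_gt_0_iff_gt)
  obtain m :: nat where m: "2 / \<delta> < m" using reals_Archimedean2 by blast
  have m0: "real m > 0" using m \<delta>(1) by (metis divide_pos_pos less_trans zero_less_numeral)
  show thesis
  proof (rule that[of "m + 2"])
    fix \<A> assume \<A>: "finite \<A>" "\<forall>K\<in>\<A>. is_interval K \<and> K \<subseteq> i \<and> j \<subseteq> S ` K"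
      "pairwise (\<lambda>K L. interior K \<inter> interior L = {}) \<A>"
    have "\<exists>t\<le>m + 1. real t / m \<in> interior K" if K: "K \<in> \<A>" for K
    proof -
      have K': "is_interval K" "K \<subseteq> {0..1}" "j \<subseteq> S ` K" using \<A>(2) K i by auto
      have "c \<in> S ` K" "d \<in> S ` K" using K'(3) j by auto
      then obtain x x' where x: "x \<in> K" "S x = c" "x' \<in> K" "S x' = d" by blast
      define p q where "p = min x x'" and "q = max x x'"
      have pq: "p \<in> K" "q \<in> K" "0 \<le> p" "q \<le> 1"
        using x K'(2) unfolding p_def q_def by (auto simp: min_def max_def)
      have "\<not> dist x' x < \<delta>"
      proof
        assume "dist x' x < \<delta>"
        then have "dist (S x') (S x) < d - c" using \<delta>(2) x K'(2) by blast
        then show False using x j(2) by (simp add: dist_real_def)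
      qed
      then have "\<delta> \<le> q - p" unfolding p_def q_def dist_real_def by auto
      then have "2 < (q - p) * m" using m \<delta>(1) m0
        by (smt (verit, best) divide_less_eq mult.commute mult_right_mono)
      define t where "t = nat (\<lfloor>p * m\<rfloor> + 1)"
      have "0 \<le> p * m" using pq(3) m0 by simp
      then have t: "real t = of_int \<lfloor>p * m\<rfloor> + 1" unfolding t_def by simp
      have "p * m < t" "t \<le> p * m + 1" unfolding t by linarith+
      then have "p < t / m" "t / m < q" using m0 \<open>2 < (q - p) * m\<close> by (auto simp: field_simps)
      moreover have "{p<..<q} \<subseteq> interior K"
        using mem_is_interval_1_I[OF K'(1) pq(1,2)] by (intro interior_maximal) auto
      moreover have "t \<le> m + 1"
      proof -
        have "real t / m < 1" using \<open>t / m < q\<close> pq(4) by linarith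
        then have "real t < m" using m0 by (simp add: divide_less_eq_1_pos)
        then show ?thesis by simp
      qed
      ultimately show ?thesis by (intro exI[of _ t]) auto
    qed
    then obtain t where t: "\<And>K. K \<in> \<A> \<Longrightarrow> t K \<le> m + 1" "\<And>K. K \<in> \<A> \<Longrightarrow> real (t K) / m \<in> interior K" by metis
    have "inj_on t \<A>"
    proof (rule inj_onI, rule ccontr)
      fix K K' assume K: "K \<in> \<A>" "K' \<in> \<A>" "t K = t K'" "K \<noteq> K'"
      have "interior K \<inter> interior K' = {}" using pairwiseD[OF \<A>(3) K(1,2,4)] .
      then show False using t(2)[OF K(1)] t(2)[OF K(2)] K(3) by auto
    qed
    moreover have "t ` \<A> \<subseteq> {..m + 1}" using t(1) by blast
    ultimately have "card \<A> \<le> card {..m + 1}" by (meson card_inj_on_le finite_atMost)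
    then show "card \<A> \<le> m + 2" by simp
  qed
qed

lemma transition_matrix_nonzero:
  assumes S: "interval_map S" and i: "i \<subseteq> {0..1}" and j: "j = {c..d}" "c < d"
    and K: "is_interval K" "K \<subseteq> i" "monotone_map_on K S" "j \<subseteq> S ` K"
  shows "transition_matrix S i j \<noteq> 0"
proof -
  let ?X = "{card \<A> | \<A>. finite \<A> \<and>
          (\<forall>K\<in>\<A>. is_interval K \<and> K \<subseteq> i \<and> monotone_map_on K S \<and> j \<subseteq> S ` K) \<and>
          pairwise (\<lambda>K L. interior K \<inter> interior L = {}) \<A>}"
  obtain m where m: "\<And>\<A>. finite \<A> \<Longrightarrow> (\<forall>K\<in>\<A>. is_interval K \<and> K \<subseteq> i \<and> j \<subseteq> S ` K) \<Longrightarrow>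
    pairwise (\<lambda>K L. interior K \<inter> interior L = {}) \<A> \<Longrightarrow> card \<A> \<le> m"
    by (rule card_horseshoe_le[OF S i j]) blast
  have "?X \<subseteq> {..m}" using m by blast
  then have "finite ?X" using finite_subset by blast
  moreover have "1 \<in> ?X"
    using K by (intro CollectI exI[of _ "{K}"]) (auto simp: pairwise_def)
  ultimately have "1 \<le> Max ?X" by (rule Max_ge)
  moreover have "j \<subseteq> S ` i" using K by blast
  ultimately show ?thesis unfolding transition_matrix_def by simp
qed

lemma transition_power_image:
  assumes "transition_power S Q n i j \<noteq> 0"
  shows "j \<subseteq> (S ^^ n) ` i"
  using assms
proof (induction n arbitrary: i)
  case 0
  then show ?case by (simp split: if_splits)
next
  case (Suc n)
  then obtain k where "of_nat (transition_matrix S i k) * transition_power S Q n k j \<noteq> 0"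
    by (metis (mono_tags, lifting) infsum_0 transition_power.simps(2))
  then have "transition_matrix S i k \<noteq> 0" "transition_power S Q n k j \<noteq> 0" by auto
  then have "k \<subseteq> S ` i" "j \<subseteq> (S ^^ n) ` k"
    using Suc.IH unfolding transition_matrix_def by (auto split: if_splits)
  then have "j \<subseteq> (S ^^ n) ` S ` i" by blast
  moreover have "(S ^^ n) ` S ` i = (S ^^ Suc n) ` i" by (auto simp: funpow_swap1 image_iff)
  ultimately show ?case by simp
qed

lemma transition_power_Suc_nonzero:
  assumes "k \<in> Q" "transition_matrix S i k \<noteq> 0" "transition_power S Q n k j \<noteq> 0"
  shows "transition_power S Q (Suc n) i j \<noteq> 0"
proof -
  let ?f = "\<lambda>k. of_nat (transition_matrix S i k) * transition_power S Q n k j"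
  have "infsum ?f {k} \<le> infsum ?f Q"
    using assms(1) by (intro infsum_mono_neutral nonneg_summable_on_complete) auto
  moreover have "infsum ?f {k} \<noteq> 0" using assms(2,3) by simp
  ultimately show ?thesis by (metis le_zero_eq transition_power.simps(2))
qed

section \<open>Transition times and orbits of generic points\<close>

context lap_system
begin

text \<open>The orbit of \<open>x\<close> passes through inner points of laps and of elements of
  \<open>P\<close>. At each step the Markov property makes the current lap cover the next element,
  which gives a nonzero matrix entry.\<close>

lemma transition_power_nonzero:
  assumes mono: "\<And>K. K \<in> L \<Longrightarrow> monotone_map_on K T" and j: "j \<in> P"
    and "i \<in> P" "x \<in> {0..1}" "x \<in> i" "generic ((T ^^ n) x)" "(T ^^ n) x \<in> j"
  shows "transition_power T P n i j \<noteq> 0"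
  using assms(3-)
proof (induction n arbitrary: i x)
  case 0
  have x: "generic x" "x \<in> j" using "0.prems"(4,5) by simp_all
  have "i = j" by (rule P_eqI[OF "0.prems"(1) j "0.prems"(3) generic_interior[OF x(1) j x(2)]])
  then show ?case by simp
next
  case (Suc n)
  have Tn: "(T ^^ Suc n) x = (T ^^ n) (T x)" by (simp add: funpow_swap1)
  have u: "T x \<in> {0..1}" using funpow_in[OF Suc.prems(2), of 1] by simp
  have gx: "generic x" by (rule generic_preimage[OF Suc.prems(2,4)])
  have gu: "generic (T x)" by (rule generic_preimage[OF u Suc.prems(4)[unfolded Tn]])
  obtain M where M: "M \<in> L" "T x \<in> interior M" using gu by (rule generic_in_lap)
  obtain k where k: "k \<in> P" "M \<subseteq> k" using L_sub[OF M(1)] by (rule bexE)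
  have uk: "T x \<in> interior k" "T x \<in> k" using M(2) interior_mono[OF k(2)] interior_subset by blast+
  obtain K where K: "K \<in> L" "x \<in> interior K" using gx by (rule generic_in_lap)
  obtain i' where i': "i' \<in> P" "K \<subseteq> i'" using L_sub[OF K(1)] by (rule bexE)
  have "x \<in> interior i'" using K(2) interior_mono[OF i'(2)] by blast
  then have "i = i'" by (rule P_eqI[OF Suc.prems(1) i'(1) Suc.prems(3)])
  have "x \<in> K" using K(2) interior_subset by blast
  then have kK: "k \<subseteq> T ` K" using L_markov[OF K(1) k(1)] uk(1) by blast
  obtain c d where "k = {c..d}" "c < d" using P_interval[OF k(1)] by blast
  moreover have "is_interval K" using L_interval[OF K(1)] by (auto simp: is_interval_cc)
  ultimately have "transition_matrix T i k \<noteq> 0"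
    using transition_matrix_nonzero[OF T P_sub[OF Suc.prems(1)], of k c d K] mono[OF K(1)] kK i'(2) \<open>i = i'\<close> by simp
  moreover have "transition_power T P n k j \<noteq> 0"
    using Suc.IH[OF k(1) u uk(2) Suc.prems(4,5)[unfolded Tn]] .
  ultimately show ?case by (rule transition_power_Suc_nonzero[OF k(1)])
qed

lemma openin_hitting:
  assumes "i \<in> P" "j \<in> P"
  shows "openin (top_of_set {0..1}) {v\<in>interior j. (T ^^ n) v \<in> interior i}"
proof -
  have "openin (top_of_set {0..1}) ({0..1} \<inter> (T ^^ n) -` interior i)"
    using continuous_on_interval_map_funpow[OF T] by (intro continuous_openin_preimage_gen) auto
  then have "openin (top_of_set {0..1}) (({0..1} \<inter> (T ^^ n) -` interior i) \<inter> interior j)"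
    by (rule openin_Int_open) simp
  moreover have "({0..1} \<inter> (T ^^ n) -` interior i) \<inter> interior j = {v\<in>interior j. (T ^^ n) v \<in> interior i}"
    using P_sub[OF assms(2)] interior_subset by blast
  ultimately show ?thesis by simp
qed

lemma hitting_time:
  assumes mix: "topologically_mixing T" and ij: "i \<in> P" "j \<in> P"
  shows "\<exists>n\<ge>1. {v\<in>interior j. (T ^^ n) v \<in> interior i} \<noteq> {}"
proof -
  have op: "openin (top_of_set {0..1}) (interior k) \<and> interior k \<noteq> {}" if k: "k \<in> P" for k
  proof -
    obtain a b where "k = {a..b}" "a < b" using P_interval[OF k] by blast
    moreover have "interior k \<subseteq> {0..1}" using P_sub[OF k] interior_subset by blast
    ultimately show ?thesis by (auto intro: open_subset)
  qed
  obtain n where n: "\<forall>m\<ge>n. (T ^^ m) ` interior j \<inter> interior i \<noteq> {}"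
    using mix[unfolded topologically_mixing_def, rule_format, of "interior j" "interior i"] op[OF ij(1)] op[OF ij(2)] by blast
  have "(T ^^ Suc n) ` interior j \<inter> interior i \<noteq> {}" by (rule n[rule_format]) simp
  then show ?thesis by (intro exI[of _ "Suc n"]) auto
qed

text \<open>Mixing provides an open set of points going from \<open>j\<close> to \<open>i\<close>;
  one of them has a generic image, so the \<open>LEAST\<close> in the definition is taken over a
  nonempty set.\<close>

lemma transition_time_nonzero:
  assumes mix: "topologically_mixing T" and mono: "\<And>K. K \<in> L \<Longrightarrow> monotone_map_on K T"
    and ij: "i \<in> P" "j \<in> P"
  shows "1 \<le> transition_time T P j i" "transition_power T P (transition_time T P j i) j i \<noteq> 0"
proof -
  obtain n where n: "n \<ge> 1" "{v\<in>interior j. (T ^^ n) v \<in> interior i} \<noteq> {}"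
    using hitting_time[OF mix ij] by blast
  obtain v where v: "v \<in> {v\<in>interior j. (T ^^ n) v \<in> interior i}" "(T ^^ n) v \<notin> {w\<in>{0..1}. \<not> generic w}"
    by (rule mixing_image_avoids_countable[OF T mix openin_hitting[OF ij] n(2) countable_nongeneric])
  have vj: "v \<in> j" "(T ^^ n) v \<in> i" using v(1) interior_subset by blast+
  then have v01: "v \<in> {0..1}" using P_sub[OF ij(2)] by blast
  then have "generic ((T ^^ n) v)" using v(2) funpow_in by blast
  then have "transition_power T P n j i \<noteq> 0"
    using transition_power_nonzero[OF mono ij(1) ij(2) v01 vj(1) _ vj(2)] by blast
  then have "1 \<le> transition_time T P j i \<and> transition_power T P (transition_time T P j i) j i \<noteq> 0"
    unfolding transition_time_def using n(1)
    by (intro LeastI[of "\<lambda>n. 1 \<le> n \<and> transition_power T P n j i \<noteq> 0" n]) simp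
  then show "1 \<le> transition_time T P j i" "transition_power T P (transition_time T P j i) j i \<noteq> 0"
    by simp_all
qed

text \<open>A preimage \<open>x\<close> of \<open>y\<close> of order \<open>n\<close>, lying in \<open>i\<close>, is reached from \<open>j\<close> in
  \<open>transition_time T P j i \<le> \<rho> * n\<close> steps, so it can be charged to a loop at \<open>j\<close>.\<close>

lemma preimages_exponential_bound:
  assumes mix: "topologically_mixing T" and mono: "\<And>K. K \<in> L \<Longrightarrow> monotone_map_on K T"
    and j: "j \<in> P" and h: "topological_entropy T = ereal h"
    and \<rho>: "0 \<le> \<rho>" "\<And>i. i \<in> P \<Longrightarrow> real (transition_time T P j i) \<le> \<rho> * real (transition_time T P i j)"
    and y: "generic y" "y \<in> j"
  shows "finite {x\<in>{0..1}. (T ^^ n) x = y}"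
    "real (card {x\<in>{0..1}. (T ^^ n) x = y}) \<le> 3 * exp (\<rho> + (\<rho> + 1) * h) ^ n"
proof -
  have h0: "0 \<le> h" using topological_entropy_nonneg[of T] h by simp
  let ?X = "{x\<in>{0..1}. (T ^^ n) x = y}"
  define m where "m = nat \<lfloor>\<rho> * n\<rfloor>"
  have m: "real m \<le> \<rho> * n" unfolding m_def using \<rho>(1) by simp
  let ?Y = "SIGMA l:{..m}. {w\<in>j. (T ^^ (n + l)) w = y}"
  have "\<exists>p. fst p \<le> m \<and> snd p \<in> j \<and> (T ^^ fst p) (snd p) = x" if x: "x \<in> ?X" for x
  \<comment> \<open>Transition times are at least 1, so order 0 is separate: there
    \<open>x = y\<close> is itself in \<open>j\<close>, reached in 0 steps.\<close>
  proof (cases "n = 0")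
    case True
    then show ?thesis using x y by (intro exI[of _ "(0, x)"]) auto
  next
    case False
    have x': "x \<in> {0..1}" "(T ^^ n) x = y" using x by auto
    have gx: "generic x" using generic_preimage[OF x'(1)] x'(2) y by metis
    obtain K where K: "K \<in> L" "x \<in> interior K" using gx by (rule generic_in_lap)
    obtain i where i: "i \<in> P" "K \<subseteq> i" using L_sub[OF K(1)] by (rule bexE)
    have xi: "x \<in> i" using K(2) i(2) interior_subset by blast
    have "transition_power T P n i j \<noteq> 0"
      using transition_power_nonzero[OF mono j i(1) x'(1) xi, of n] x'(2) y by blast
    \<comment> \<open>The orbit from \<open>x\<close> to \<open>y\<close> itself shows that
      \<open>j\<close> can be reached from \<open>i\<close> in \<open>n\<close> steps. The ratio
      bound then limits the time needed from \<open>j\<close> to \<open>i\<close>.\<close>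
    then have le: "transition_time T P i j \<le> n"
      unfolding transition_time_def using False by (intro Least_le) simp
    define l where "l = transition_time T P j i"
    have "x \<in> (T ^^ l) ` j"
      using transition_power_image[OF transition_time_nonzero(2)[OF mix mono i(1) j]] xi unfolding l_def by blast
    moreover have "real l \<le> \<rho> * n"
      using \<rho>(2)[OF i(1)] mult_left_mono[of "real (transition_time T P i j)" "real n" \<rho>] le \<rho>(1)
      unfolding l_def by simp
    then have "l \<le> m" unfolding m_def by (simp add: le_nat_floor)
    ultimately obtain w where "w \<in> j" "(T ^^ l) w = x" "l \<le> m" by blast
    then show ?thesis by (intro exI[of _ "(l, w)"]) simp
  qed
  then have "\<forall>x\<in>?X. \<exists>p. fst p \<le> m \<and> snd p \<in> j \<and> (T ^^ fst p) (snd p) = x" by (rule ballI)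
  then obtain f where "\<forall>x\<in>?X. fst (f x) \<le> m \<and> snd (f x) \<in> j \<and> (T ^^ fst (f x)) (snd (f x)) = x"
    by (rule bchoice[THEN exE])
  then have f: "fst (f x) \<le> m" "snd (f x) \<in> j" "(T ^^ fst (f x)) (snd (f x)) = x" if "x \<in> ?X" for x
    using that by simp_all
  have inj: "inj_on f ?X"
  proof (rule inj_onI)
    fix x x' assume x: "x \<in> ?X" "x' \<in> ?X" "f x = f x'"
    have "x = (T ^^ fst (f x)) (snd (f x))" by (rule f(3)[OF x(1), symmetric])
    also have "\<dots> = (T ^^ fst (f x')) (snd (f x'))" by (simp only: x(3))
    also have "\<dots> = x'" by (rule f(3)[OF x(2)])
    finally show "x = x'" .
  qed
  have sub: "f ` ?X \<subseteq> ?Y"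
  proof (rule image_subsetI)
    fix x assume x: "x \<in> ?X"
    have "(T ^^ (n + fst (f x))) (snd (f x)) = (T ^^ n) x"
      by (simp only: funpow_add comp_apply f(3)[OF x])
    also have "\<dots> = y" using x by blast
    finally have "(fst (f x), snd (f x)) \<in> ?Y" using f(1,2)[OF x] by (intro SigmaI) simp_all
    then show "f x \<in> ?Y" by (simp only: prod.collapse)
  qed
  have fin: "finite ?Y" using loops_entropy_bound(1)[OF j y h] by (intro finite_SigmaI) auto
  show "finite ?X" using inj sub fin by (rule inj_on_finite)
  have "card ?X \<le> card ?Y" using inj sub fin by (rule card_inj_on_le)
  also have "card ?Y = (\<Sum>l\<le>m. card {w\<in>j. (T ^^ (n + l)) w = y})"
    using loops_entropy_bound(1)[OF j y h] by (intro card_SigmaI) auto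
  finally have "real (card ?X) \<le> (\<Sum>l\<le>m. real (card {w\<in>j. (T ^^ (n + l)) w = y}))"
    by (simp only: of_nat_sum[symmetric] of_nat_le_iff)
  also have "\<dots> \<le> (\<Sum>l\<le>m. 3 * exp ((n + \<rho> * n) * h))"
  proof (rule sum_mono)
    fix l assume "l \<in> {..m}"
    then have "real l \<le> real m" by simp
    then have "real l \<le> \<rho> * n" using m by linarith
    then have "real (n + l) * h \<le> (n + \<rho> * n) * h" using h0 by (intro mult_right_mono) auto
    moreover have "0 \<le> (n + \<rho> * n) * h" using h0 \<rho>(1) by simp
    then have "1 \<le> exp ((n + \<rho> * n) * h)" by simp
    ultimately have "2 + exp (real (n + l) * h) \<le> 3 * exp ((n + \<rho> * n) * h)"
      using exp_le_cancel_iff[of "real (n + l) * h" "(n + \<rho> * n) * h"] by linarith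
    then show "real (card {w\<in>j. (T ^^ (n + l)) w = y}) \<le> 3 * exp ((n + \<rho> * n) * h)"
      using loops_entropy_bound(2)[OF j y h, of "n + l"] by linarith
  qed
  also have "\<dots> = (1 + real m) * (3 * exp ((n + \<rho> * n) * h))" by simp
  \<comment> \<open>The number \<open>1 + m\<close> of admissible times is absorbed into
    \<open>exp (\<rho> * n)\<close>. This is the summand \<open>\<rho>\<close> in the exponent;
    \<open>(\<rho> + 1) * h\<close> comes from loops of length at most
    \<open>(1 + \<rho>) * n\<close>.\<close>
  also have "\<dots> \<le> exp (\<rho> * n) * (3 * exp ((n + \<rho> * n) * h))"
  proof (rule mult_right_mono)
    have "1 + real m \<le> 1 + \<rho> * n" using m by simp
    also have "\<dots> \<le> exp (\<rho> * n)" by (rule exp_ge_add_one_self)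
    finally show "1 + real m \<le> exp (\<rho> * n)" .
  qed simp
  also have "\<dots> = 3 * exp (\<rho> + (\<rho> + 1) * h) ^ n"
    by (simp add: exp_of_nat_mult[symmetric] exp_add[symmetric] algebra_simps)
  finally show "real (card ?X) \<le> 3 * exp (\<rho> + (\<rho> + 1) * h) ^ n" .
qed

end

section \<open>From the ratio hypothesis to the growth of preimages near any point\<close>

context lap_system
begin

lemma transition_time_ratio_bound:
  assumes mix: "topologically_mixing T" and mono: "\<And>K. K \<in> L \<Longrightarrow> monotone_map_on K T"
    and j: "j \<in> P" and fin: "transition_time_ratio_sup T j P < \<infinity>"
  shows "\<exists>\<rho>\<ge>0. \<forall>i\<in>P. real (transition_time T P j i) \<le> \<rho> * real (transition_time T P i j)"
proof -
  let ?r = "\<lambda>i. real (transition_time T P j i) / real (transition_time T P i j)"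
  have le: "ereal (?r i) \<le> transition_time_ratio_sup T j P" if "i \<in> P" for i
    unfolding transition_time_ratio_sup_def using that by (rule SUP_upper)
  obtain \<rho> where \<rho>: "transition_time_ratio_sup T j P = ereal \<rho>"
    using fin le[OF j] by (cases "transition_time_ratio_sup T j P") auto
  show ?thesis
  proof (intro exI[of _ \<rho>] conjI ballI)
    have "0 \<le> ?r j" by simp
    then show "0 \<le> \<rho>" using le[OF j] unfolding \<rho> by simp
    fix i assume i: "i \<in> P"
    have "?r i \<le> \<rho>" using le[OF i] unfolding \<rho> by simp
    moreover have "0 < real (transition_time T P i j)"
      using transition_time_nonzero(1)[OF mix mono j i] by simp
    ultimately show "real (transition_time T P j i) \<le> \<rho> * real (transition_time T P i j)"
      by (simp add: pos_divide_le_eq)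
  qed
qed

text \<open>A point \<open>v\<close> of \<open>U\<close> is sent by \<open>T ^^ q\<close> to a
  generic point of \<open>j\<close>. Its preimages of order \<open>n\<close> are among those of
  \<open>(T ^^ q) v\<close> of order \<open>q + n\<close>, at the cost of a factor
  \<open>B ^ q\<close>. The constants precede \<open>Z\<close> because \<open>Z\<close> will be the
  nongeneric set of the perturbed map, whereas the threshold for \<open>k\<close> must be fixed
  earlier.\<close>

lemma preimages_growth:
  assumes mix: "topologically_mixing T" and mono: "\<And>K. K \<in> L \<Longrightarrow> monotone_map_on K T"
    and j: "j \<in> P" and fin: "transition_time_ratio_sup T j P < \<infinity>" and ent: "topological_entropy T < \<infinity>"
    and U: "openin (top_of_set {0..1}) U" "U \<noteq> {}"
  shows "\<exists>C B. 1 \<le> B \<and> (\<forall>Z. countable Z \<longrightarrow> (\<exists>w\<in>U - Z. \<forall>n.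
    finite {x\<in>{0..1}. (T ^^ n) x = w} \<and> real (card {x\<in>{0..1}. (T ^^ n) x = w}) \<le> C * B ^ n))"
proof -
  obtain h where h: "topological_entropy T = ereal h"
    using ent topological_entropy_nonneg[of T] by (cases "topological_entropy T") auto
  have h0: "0 \<le> h" using topological_entropy_nonneg[of T] h by simp
  obtain \<rho> where \<rho>: "0 \<le> \<rho>"
    "\<And>i. i \<in> P \<Longrightarrow> real (transition_time T P j i) \<le> \<rho> * real (transition_time T P i j)"
    using transition_time_ratio_bound[OF mix mono j fin] by blast
  define B where "B = exp (\<rho> + (\<rho> + 1) * h)"
  have B: "1 \<le> B" unfolding B_def using \<rho>(1) h0 by simp
  have j': "openin (top_of_set {0..1}) (interior j)" "interior j \<noteq> {}"
  proof -
    obtain a b where "j = {a..b}" "a < b" using P_interval[OF j] by blast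
    then show "interior j \<noteq> {}" by simp
    have "interior j \<subseteq> {0..1}" using P_sub[OF j] interior_subset by blast
    then show "openin (top_of_set {0..1}) (interior j)" by (intro open_subset) auto
  qed
  obtain q where q: "\<forall>m\<ge>q. (T ^^ m) ` U \<inter> interior j \<noteq> {}"
    using mix[unfolded topologically_mixing_def, rule_format, of U "interior j"] U j' by blast
  define G where "G = ({0..1} \<inter> (T ^^ q) -` interior j) \<inter> U"
  have "openin (top_of_set {0..1}) ({0..1} \<inter> (T ^^ q) -` interior j)"
    using continuous_on_interval_map_funpow[OF T] by (intro continuous_openin_preimage_gen) auto
  then have G: "openin (top_of_set {0..1}) G" unfolding G_def using U(1) by (rule openin_Int)
  have U01: "U \<subseteq> {0..1}" using openin_imp_subset[OF U(1)] .
  have "(T ^^ q) ` U \<inter> interior j \<noteq> {}" using q by blast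
  then have Gne: "G \<noteq> {}" unfolding G_def using U01 by blast
  have "\<exists>w\<in>U - Z. \<forall>n. finite {x\<in>{0..1}. (T ^^ n) x = w} \<and>
      real (card {x\<in>{0..1}. (T ^^ n) x = w}) \<le> (3 * B ^ q) * B ^ n" if Z: "countable Z" for Z
  proof -
    have "countable ({w\<in>{0..1}. \<not> generic w} \<union> (T ^^ q) ` Z)"
      using countable_nongeneric Z by (intro countable_Un countable_image)
    then obtain v where v: "v \<in> G" "(T ^^ q) v \<notin> {w\<in>{0..1}. \<not> generic w} \<union> (T ^^ q) ` Z"
      by (rule mixing_image_avoids_countable[OF T mix G Gne])
    have v': "v \<in> {0..1}" "v \<in> U" "(T ^^ q) v \<in> j" "v \<notin> Z"
      using v interior_subset unfolding G_def by blast+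
    have y: "generic ((T ^^ q) v)" using v(2) funpow_in[OF v'(1)] by blast
    show ?thesis
    proof (intro bexI[of _ v] allI)
      show "v \<in> U - Z" using v' by blast
      fix n
      let ?X = "{x\<in>{0..1}. (T ^^ (q + n)) x = (T ^^ q) v}"
      note bound = preimages_exponential_bound[OF mix mono j h \<rho> y v'(3), of "q + n"]
      have sub: "{x\<in>{0..1}. (T ^^ n) x = v} \<subseteq> ?X" by (auto simp: funpow_add)
      have "card {x\<in>{0..1}. (T ^^ n) x = v} \<le> card ?X" by (rule card_mono[OF bound(1) sub])
      then have "real (card {x\<in>{0..1}. (T ^^ n) x = v}) \<le> 3 * B ^ (q + n)"
        using bound(2) unfolding B_def by linarith
      then show "finite {x\<in>{0..1}. (T ^^ n) x = v} \<and>
          real (card {x\<in>{0..1}. (T ^^ n) x = v}) \<le> (3 * B ^ q) * B ^ n"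
        using finite_subset[OF sub bound(1)] by (simp add: power_add mult.assoc)
    qed
  qed
  then show ?thesis using B by blast
qed

end

section \<open>Window perturbations\<close>

lemma window_perturbation_lap_system:
  assumes S: "lap_system S P L" and j: "j \<in> P"
    and image: "\<And>i. i \<in> P \<Longrightarrow> S ` j \<inter> interior i \<noteq> {} \<Longrightarrow> i \<subseteq> S ` j"
    and T: "interval_map T" "topologically_mixing T" "\<And>x. x \<in> {0..1} - interior j \<Longrightarrow> T x = S x"
    and D: "D division_of j" "\<And>K. K \<in> D \<Longrightarrow> interior K \<noteq> {}" "\<And>K. K \<in> D \<Longrightarrow> T ` K = S ` j"
      "\<And>K. K \<in> D \<Longrightarrow> monotone_map_on K T"
  shows "lap_system T P ({K\<in>L. \<exists>i\<in>P. i \<noteq> j \<and> K \<subseteq> i} \<union> D)"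
proof -
  interpret S: lap_system S P L by (rule S)
  have D_Icc: "\<exists>a b. a < b \<and> K = {a..b}" if K: "K \<in> D" for K
  proof -
    obtain a b where "K = {a..b}" using division_ofD(4)[OF D(1) K] by (auto simp: cbox_interval)
    then show ?thesis using D(2)[OF K] by (intro exI[of _ a] exI[of _ b]) simp
  qed
  have D_sub: "K \<subseteq> j" if "K \<in> D" for K using division_ofD(2)[OF D(1) that] .
  have j01: "j \<subseteq> {0..1}" by (rule S.P_sub[OF j])
  have eq: "T x = S x" if "x \<in> K" "K \<subseteq> i" "i \<in> P" "i \<noteq> j" for x K i
  proof (rule T(3))
    have "x \<notin> interior j" using S.P_eqI[OF that(3) j, of x] that by blast
    then show "x \<in> {0..1} - interior j" using that S.P_sub[OF that(3)] by blast
  qed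
  show ?thesis
  proof
    show "interval_map T" by (rule T)
    show "\<exists>a b. 0 \<le> a \<and> a < b \<and> b \<le> 1 \<and> i = {a..b}" if "i \<in> P" for i using S.P_interval[OF that] .
    show "interior i \<inter> interior i' = {}" if "i \<in> P" "i' \<in> P" "i \<noteq> i'" for i i' using S.P_disjoint[OF that] .
    have "countable D" using division_ofD(1)[OF D(1)] by (rule countable_finite)
    then show "countable ({K\<in>L. \<exists>i\<in>P. i \<noteq> j \<and> K \<subseteq> i} \<union> D)" using S.L_countable by simp
    show "\<exists>a b. a < b \<and> K = {a..b}" if "K \<in> {K\<in>L. \<exists>i\<in>P. i \<noteq> j \<and> K \<subseteq> i} \<union> D" for K
      using that D_Icc S.L_interval by blast
    show "\<exists>i\<in>P. K \<subseteq> i" if "K \<in> {K\<in>L. \<exists>i\<in>P. i \<noteq> j \<and> K \<subseteq> i} \<union> D" for K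
      using that D_sub j by blast
    show "inj_on T K" if K: "K \<in> {K\<in>L. \<exists>i\<in>P. i \<noteq> j \<and> K \<subseteq> i} \<union> D" for K
    proof (cases "K \<in> D")
      case True
      have "is_interval K" using D_Icc[OF True] by (auto simp: is_interval_cc)
      moreover have "K \<subseteq> {0..1}" using D_sub[OF True] j01 by (rule subset_trans)
      ultimately show ?thesis using monotone_map_on_inj[OF T(1,2)] D(4)[OF True] by simp
    next
      case False
      then obtain i where i: "K \<in> L" "i \<in> P" "i \<noteq> j" "K \<subseteq> i" using K by blast
      have "inj_on S K" by (rule S.L_inj[OF i(1)])
      then show ?thesis using eq[OF _ i(4,2,3)] by (simp cong: inj_on_cong)
    qed
    show "i \<subseteq> T ` K" if K: "K \<in> {K\<in>L. \<exists>i\<in>P. i \<noteq> j \<and> K \<subseteq> i} \<union> D" and i: "i \<in> P" "T ` K \<inter> interior i \<noteq> {}" for K i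
    proof (cases "K \<in> D")
      case True
      then show ?thesis using image[OF i(1)] i(2) D(3)[OF True] by simp
    next
      case False
      then obtain i' where i': "K \<in> L" "i' \<in> P" "i' \<noteq> j" "K \<subseteq> i'" using K by blast
      have "T ` K = S ` K" using eq[OF _ i'(4,2,3)] by (rule image_cong[OF refl])
      then show ?thesis using S.L_markov[OF i'(1) i(1)] i(2) by simp
    qed
    show "countable ({0..1} - \<Union>({K\<in>L. \<exists>i\<in>P. i \<noteq> j \<and> K \<subseteq> i} \<union> D))"
    proof (rule countable_subset[OF _ S.L_cover], rule subsetI)
      fix x assume x: "x \<in> {0..1} - \<Union>({K\<in>L. \<exists>i\<in>P. i \<noteq> j \<and> K \<subseteq> i} \<union> D)"
      have "x \<notin> K" if K: "K \<in> L" for K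
      proof
        assume xK: "x \<in> K"
        obtain i where i: "i \<in> P" "K \<subseteq> i" using S.L_sub[OF K] by (rule bexE)
        show False
        proof (cases "i = j")
          case True
          then have "x \<in> \<Union>D" using xK i(2) division_ofD(6)[OF D(1)] by blast
          then show False using x by blast
        next
          case False
          then show False using x xK K i by blast
        qed
      qed
      then show "x \<in> {0..1} - \<Union>L" using x by blast
    qed
  qed
qed

text \<open>First entrances are orbit segments outside \<open>j\<close> until the end, so their
  growth bound passes from \<open>S\<close> to \<open>T\<close>. An orbit of \<open>S\<close> that
  returns to \<open>interior j\<close> at time \<open>N\<close> meets it at no intermediate time,
  and its first step can be replaced by a step from any of the \<open>2 * k + 1\<close> pieces. This
  yields the required number of first returns of order \<open>N\<close>.\<close>

lemma window_perturbation_linearizable: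
  assumes S: "lap_system S P L" and mixS: "topologically_mixing S" and j: "j \<in> P"
    and image: "\<And>i. i \<in> P \<Longrightarrow> S ` j \<inter> interior i \<noteq> {} \<Longrightarrow> i \<subseteq> S ` j"
    and growth: "\<And>Z. countable Z \<Longrightarrow> \<exists>w\<in>interior j - Z. \<forall>n.
      finite {x\<in>{0..1}. (S ^^ n) x = w} \<and> real (card {x\<in>{0..1}. (S ^^ n) x = w}) \<le> C * B ^ n"
    and B: "1 \<le> B"
    and N: "N \<ge> 1" "{v\<in>interior j. (S ^^ N) v \<in> interior j} \<noteq> {}"
      "\<And>l x. 1 \<le> l \<Longrightarrow> l < N \<Longrightarrow> x \<in> interior j \<Longrightarrow> (S ^^ l) x \<notin> interior j"
    and k: "(2 * B) ^ N \<le> real (2 * k + 1)"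
    and window: "window_perturbation S j k T"
  shows "linearizable T"
proof -
  interpret S: lap_system S P L by (rule S)
  have T: "interval_map T" "topologically_mixing T" "topological_entropy T < \<infinity>"
    "\<And>x. x \<in> {0..1} - interior j \<Longrightarrow> T x = S x"
    using window unfolding window_perturbation_def CPMM_def by auto
  obtain D where D: "D division_of j" "card D = 2 * k + 1" "\<And>K. K \<in> D \<Longrightarrow> interior K \<noteq> {}"
    "\<And>K. K \<in> D \<Longrightarrow> T ` K = S ` j" "\<And>K. K \<in> D \<Longrightarrow> monotone_map_on K T"
    using window unfolding window_perturbation_def by auto
  define M where "M = {K\<in>L. \<exists>i\<in>P. i \<noteq> j \<and> K \<subseteq> i} \<union> D"
  interpret W: lap_system T P M
    unfolding M_def by (rule window_perturbation_lap_system[OF S j image T(1,2,4) D(1,3-5)])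
  have j01: "j \<subseteq> {0..1}" by (rule S.P_sub[OF j])
  \<comment> \<open>The point obeys the growth bound of \<open>S\<close> and is generic for the laps
    of \<open>T\<close>.\<close>
  obtain w where w: "w \<in> interior j - {w\<in>{0..1}. \<not> W.generic w}"
    "\<And>n. finite {x\<in>{0..1}. (S ^^ n) x = w}" "\<And>n. real (card {x\<in>{0..1}. (S ^^ n) x = w}) \<le> C * B ^ n"
    using growth[OF W.countable_nongeneric] by blast
  have wj: "w \<in> j" using w(1) interior_subset by blast
  have gw: "W.generic w" using w(1) wj j01 by blast
  have sub: "W.preimages j (\<lambda>_. False) n w \<subseteq> {x\<in>{0..1}. (S ^^ n) x = w}" for n
  proof
    fix x assume "x \<in> W.preimages j (\<lambda>_. False) n w"
    then have x: "x \<in> {0..1}" "(T ^^ n) x = w" "\<And>l. l < n \<Longrightarrow> (T ^^ l) x \<notin> j"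
      unfolding W.preimages_def by auto
    have "(S ^^ l) x = (T ^^ l) x" if "l \<le> n" for l
      using that
    proof (induction l)
      case (Suc l)
      have "(T ^^ l) x \<in> {0..1} - interior j"
        using W.funpow_in[OF x(1), of l] x(3)[of l] Suc.prems interior_subset by auto
      then show ?case using T(4)[of "(T ^^ l) x"] Suc by simp
    qed simp
    then show "x \<in> {x\<in>{0..1}. (S ^^ n) x = w}" using x(1,2) by simp
  qed
  have "renewal_system T P M j w D C B N"
  proof
    show "topologically_mixing T" "j \<in> P" "W.generic w" "w \<in> j" "1 \<le> B" "1 \<le> N"
      by (fact T(2) j gw wj B N(1))+
    show "finite D" "j = \<Union>D" using division_ofD(1,6)[OF D(1)] by simp_all
    show "D \<subseteq> M" unfolding M_def by blast
    show "finite (W.preimages j (\<lambda>_. False) n w)" for n using finite_subset[OF sub w(2)] .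
    show "real (card (W.preimages j (\<lambda>_. False) n w)) \<le> C * B ^ n" for n
      using card_mono[OF w(2) sub[of n]] w(3)[of n] by linarith
    obtain v where v: "v \<in> {v\<in>interior j. (S ^^ N) v \<in> interior j}" "(S ^^ N) v \<notin> {w\<in>{0..1}. \<not> W.generic w}"
      by (rule mixing_image_avoids_countable[OF S.T mixS S.openin_hitting[OF j j] N(2) W.countable_nongeneric])
    define w' where "w' = (S ^^ N) v"
    have v': "v \<in> interior j" "w' \<in> interior j" using v(1) unfolding w'_def by auto
    have vj: "v \<in> j" "w' \<in> j" using v' interior_subset by blast+
    have v01: "v \<in> {0..1}" using vj j01 by blast
    have gw': "W.generic w'" using v(2) S.funpow_in[OF v01] unfolding w'_def by blast
    define u where "u = S v"
    have u01: "u \<in> {0..1}" using S.funpow_in[OF v01, of 1] unfolding u_def by simp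
    have Tu: "(T ^^ l) u = (S ^^ Suc l) v" if "l < N" for l
      using that
    proof (induction l)
      case (Suc l)
      have "(S ^^ Suc l) v \<in> {0..1} - interior j"
        using N(3)[of "Suc l" v] Suc.prems v'(1) S.funpow_in[OF v01, of "Suc l"] by simp
      then have "T ((S ^^ Suc l) v) = S ((S ^^ Suc l) v)" by (rule T(4))
      then show ?case using Suc by simp
    qed (simp add: u_def)
    have "\<exists>p\<in>K. T p = u" if "K \<in> D" for K
      using D(4)[OF that] vj(1) unfolding u_def by (metis imageE imageI)
    then have "\<forall>K\<in>D. \<exists>p. p \<in> K \<and> T p = u" by blast
    then obtain p where "\<forall>K\<in>D. p K \<in> K \<and> T (p K) = u" by (rule bchoice[THEN exE])
    then have p: "p K \<in> K" "T (p K) = u" if "K \<in> D" for K using that by simp_all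
    have pj: "p K \<in> j" if "K \<in> D" for K using p(1)[OF that] division_ofD(2)[OF D(1) that] by blast
    have p01: "p K \<in> {0..1}" if "K \<in> D" for K using pj[OF that] j01 by blast
    have Tp: "(T ^^ Suc l) (p K) = (S ^^ Suc l) v" if "K \<in> D" "l < N" for K l
      using Tu[OF that(2)] p(2)[OF that(1)] by (simp add: funpow_swap1)
    have Np: "(T ^^ N) (p K) = w'" if "K \<in> D" for K
      using Tp[OF that, of "N - 1"] N(1) unfolding w'_def by simp
    have gp: "W.generic ((T ^^ l) (p K))" if "K \<in> D" "l \<le> N" for K l
      using W.generic_iterate[OF p01[OF that(1)] _ that(2)] Np[OF that(1)] gw' by simp
    have mem: "p K \<in> W.preimages j (\<lambda>l. l = 0) N w'" if K: "K \<in> D" for K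
    proof -
      have "(T ^^ l) (p K) \<in> j \<longleftrightarrow> l = 0" if l: "l < N" for l
      proof (cases l)
        case 0
        then show ?thesis using pj[OF K] by simp
      next
        case (Suc l')
        have "(T ^^ l) (p K) = (S ^^ l) v" using Tp[OF K, of l'] l unfolding Suc by simp
        then have "(T ^^ l) (p K) \<notin> interior j" using N(3)[of l v] l Suc v'(1) by simp
        \<comment> \<open>The choice of \<open>N\<close> only excludes the interior of
          \<open>j\<close>; genericity excludes its endpoints.\<close>
        then have "(T ^^ l) (p K) \<notin> j" using W.generic_interior[OF gp[OF K, of l] j] l by auto
        then show ?thesis using Suc by simp
      qed
      then show ?thesis using p01[OF K] Np[OF K] unfolding W.preimages_def by simp
    qed
    \<comment> \<open>Adjacent pieces share an endpoint, where two choices could coincide.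
      Genericity puts \<open>p K\<close> in the interior of one lap, which must be a piece of
      \<open>D\<close> and meets no other piece there.\<close>
    have "inj_on p D"
    proof (rule inj_onI)
      fix K K' assume K: "K \<in> D" "K' \<in> D" "p K = p K'"
      have "W.generic (p K)" using gp[OF K(1), of 0] by simp
      then obtain A where A: "A \<in> M" "p K \<in> interior A" by (rule W.generic_in_lap)
      have "A \<in> D"
      proof (rule ccontr)
        assume "A \<notin> D"
        then obtain i where i: "i \<in> P" "i \<noteq> j" "A \<subseteq> i" using A(1) unfolding M_def by blast
        then have "p K \<in> interior i" using A(2) interior_mono by blast
        then show False using W.P_eqI[OF j i(1) pj[OF K(1)]] i(2) by simp
      qed
      have "K'' = A" if K'': "K'' \<in> D" "p K \<in> K''" for K''
      proof (rule ccontr)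
        assume "K'' \<noteq> A"
        then have "interior A \<inter> interior K'' = {}" using division_ofD(5)[OF D(1) K''(1) \<open>A \<in> D\<close>] by blast
        then have "interior A \<inter> closure (interior K'') = {}" by (simp add: open_Int_closure_eq_empty)
        moreover have "K'' \<in> M" unfolding M_def using K''(1) by blast
        then have "closure (interior K'') = K''" using W.L_interval by fastforce
        ultimately show False using A(2) K''(2) by blast
      qed
      then show "K = K'" using p(1)[OF K(1)] p(1)[OF K(2)] K by metis
    qed
    then have "card (p ` D) = 2 * k + 1" using D(2) by (simp add: card_image)
    then show "\<exists>w\<in>j. \<exists>A \<subseteq> W.preimages j (\<lambda>l. l = 0) N w. W.generic w \<and> (2 * B) ^ N \<le> real (card A)"
      using mem k gw' vj(2) by (intro bexI[of _ w'] exI[of _ "p ` D"]) auto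
  qed
  then show ?thesis by (rule renewal_system.linearizable_of_renewal[OF _ T(3)])
qed

section \<open>The threshold for the order of the perturbation\<close>

theorem theorem9:
  fixes S :: "real \<Rightarrow> real" and P Q :: "real set set" and j j' :: "real set"
  assumes "S \<in> CPMM"
    and "markov_partition S Q"
    and "j' \<in> Q"
    and "transition_time_ratio_sup S j' Q < \<infinity>"
    and "markov_partition S P"
    and "j \<in> P"
    and "monotone_map_on j S"
  shows "\<forall>\<^sub>F k in sequentially. \<forall>T. window_perturbation S j k T \<longrightarrow> linearizable T"
proof -
  have S: "interval_map S" "topologically_mixing S" "topological_entropy S < \<infinity>"
    using assms(1) unfolding CPMM_def by auto
  obtain L where L: "lap_system S P L" using markov_partition_lap_system[OF S(1,2) assms(5)] by blast
  obtain L' where L': "lap_system S Q L'" "\<And>K. K \<in> L' \<Longrightarrow> monotone_map_on K S"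
    using markov_partition_lap_system[OF S(1,2) assms(2)] by blast
  interpret P: lap_system S P L by (rule L)
  interpret Q: lap_system S Q L' by (rule L')
  obtain a b where ab: "0 \<le> a" "a < b" "b \<le> 1" "j = {a..b}" using P.P_interval[OF assms(6)] by blast
  have "{a<..<b} \<subseteq> {0..1}" using ab by auto
  then have j: "openin (top_of_set {0..1}) (interior j)" "interior j \<noteq> {}"
    using ab by (auto intro: open_subset)
  obtain C B where CB: "1 \<le> B" "\<And>Z. countable Z \<Longrightarrow> \<exists>w\<in>interior j - Z. \<forall>n.
      finite {x\<in>{0..1}. (S ^^ n) x = w} \<and> real (card {x\<in>{0..1}. (S ^^ n) x = w}) \<le> C * B ^ n"
    using Q.preimages_growth[OF S(2) L'(2) assms(3,4) S(3) j] by blast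
  \<comment> \<open>Minimality keeps the intermediate points of a shortest return outside
    \<open>interior j\<close>, where every window perturbation agrees with \<open>S\<close>. The
    same \<open>N\<close> thus serves all of them.\<close>
  define N where "N = (LEAST n. 1 \<le> n \<and> {v\<in>interior j. (S ^^ n) v \<in> interior j} \<noteq> {})"
  have ex: "\<exists>n. 1 \<le> n \<and> {v\<in>interior j. (S ^^ n) v \<in> interior j} \<noteq> {}"
    using P.hitting_time[OF S(2) assms(6,6)] by blast
  have N: "1 \<le> N \<and> {v\<in>interior j. (S ^^ N) v \<in> interior j} \<noteq> {}"
    unfolding N_def by (rule LeastI_ex[OF ex])
  have least: "(S ^^ l) x \<notin> interior j" if "1 \<le> l" "l < N" "x \<in> interior j" for l x
    using not_less_Least[OF that(2)[unfolded N_def]] that by blast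
  have "maximal_monotone_interval S j j"
    unfolding maximal_monotone_interval_def using assms(7) ab(4) by (auto simp: is_interval_cc)
  then have image: "i \<subseteq> S ` j" if "i \<in> P" "S ` j \<inter> interior i \<noteq> {}" for i
    using markov_partitionD(6)[OF assms(5)] assms(6) that by blast
  show ?thesis
  proof (rule eventually_sequentiallyI, intro allI impI)
    \<comment> \<open>The bound involves only \<open>B\<close> and \<open>N\<close>, both obtained
      from \<open>S\<close>, \<open>Q\<close> and \<open>j\<close> before \<open>T\<close> is
      introduced.\<close>
    fix k T assume k: "nat \<lceil>(2 * B) ^ N\<rceil> \<le> k" and T: "window_perturbation S j k T"
    have "(2 * B) ^ N \<le> real k" using k by (simp add: nat_ceiling_le_eq)
    then have "(2 * B) ^ N \<le> real (2 * k + 1)" by simp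
    then show "linearizable T"
      using window_perturbation_linearizable[OF L S(2) assms(6) image CB(2,1) _ _ least _ T] N by blast
  qed
qed

end
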